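(* Let $H$ be a (finite-dimensional) semisimple Hopf algebra over an algebraically closed field $\Bbbk$ of characteristic $0$ with an idempotent integral $\Lambda$. Let $\{V_0,\dots,V_{n-1}\}$ be a complete set of non-isomorphic simple $H$-modules with $V_0$ the trivial module, with associated central primitive idempotents $e_0,\dots,e_{n-1}$ and irreducible characters $\chi_0,\dots,\chi_{n-1}$, let $d_i=\dim_{\Bbbk}V_i$, and let $s$ be the antipode of $H^*$. (1) For $m>1$ and $0\le i\le n-1$, $\chi_i(\Lambda^{\{m\}})=\frac{1}{d_i}\langle\chi_is(\chi_i),\Lambda^{\{m-1\}}\rangle$. Moreover, $\chi_{\operatorname{reg}}(\Lambda^{\{m\}})=\chi_{\operatorname{ad}}(\Lambda^{\{m-1\}})$ for $m>1$. (2) For $0\le i\le n-1$: $\chi_i(\Lambda^{\{1\}})=\delta_{i0}$; $\chi_i(\Lambda^{\{2\}})=\frac{1}{d_i}$; and for $m>2$, $$\chi_i(\Lambda^{\{m\}})=\frac{1}{d_i}\sum_{i_1,\cdots,i_{m-2}=0}^{n-1}\frac{1}{d^2_{i_1}\cdots d^2_{i_{m-2}}}\langle\chi_{i_2}s(\chi_{i_2}),e_{i_1}\rangle\cdots \langle\chi_{i_{m-2}}s(\chi_{i_{m-2}}),e_{i_{m-3}}\rangle\,\langle\chi_{i}s(\chi_{i}),e_{i_{m-2}}\rangle.$$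
   Context: Sweedler notation: $\Delta(a)=a_1\otimes a_2$; $S$ is the antipode of $H$; $\langle f,a\rangle=f(a)$ for $f\in H^*$, $a\in H$; products in $H^*$ are convolution products, and $s(f)=f\circ S$. In this semisimple characteristic-$0$ case $S^2=\mathrm{id}$ and the distinguished group-like element is $1$, so the commutator is $\{a,b\}=a_1b_1S(a_2)S(b_2)$ for $a,b\in H$. Iterated commutators: $\Lambda^{\{1\}}=\Lambda$ and $\Lambda^{\{m\}}=\{\Lambda^{\{m-1\}},\Lambda\}$ for $m>1$. $\chi_{\operatorname{reg}}$ is the character of the left regular representation of $H$, and $\chi_{\operatorname{ad}}$ is the character of the left adjoint representation $a\mapsto(b\mapsto a_1bS(a_2))$ of $H$ on itself. In (2), for $m>2$ the product of pairings is $\left(\prod_{k=2}^{m-2}\langle\chi_{i_k}s(\chi_{i_k}),e_{i_{k-1}}\rangle\right)\langle\chi_is(\chi_i),e_{i_{m-2}}\rangle$, where the product over $k$ is empty for $m=3$. *)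

theory Defs
  imports
    "HOL-Computational_Algebra.Polynomial"
    "HOL-Library.Poly_Mapping"
    "HOL-Library.FuncSet"
begin

section \<open>Tensor products\<close>

text \<open>
  \<^typ>\<open>'p \<Rightarrow>\<^sub>0 'k\<close> is the free vector space on the basis \<^typ>\<open>'p\<close>. The tensor powers
  of \<open>H\<close> are the quotients of the free vector spaces on \<^typ>\<open>'h \<times> 'h\<close> and
  \<^typ>\<open>'h \<times> 'h \<times> 'h\<close> by the relations of multilinearity. We work with representatives:
  an element of a tensor power is given by a formal linear combination of tuples, and
  equality in the tensor power is \<open>tensor_eq\<close>.
\<close>

definition free_scale :: "'k::field \<Rightarrow> ('p \<Rightarrow>\<^sub>0 'k) \<Rightarrow> ('p \<Rightarrow>\<^sub>0 'k)" where
  "free_scale c t = Poly_Mapping.map ((*) c) t"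

abbreviation free_gen :: "'p \<Rightarrow> ('p \<Rightarrow>\<^sub>0 'k::field)" where
  "free_gen p \<equiv> Poly_Mapping.single p 1"

lemma lookup_free_scale: "Poly_Mapping.lookup (free_scale c t) p = c * Poly_Mapping.lookup t p"
  by (simp add: free_scale_def Poly_Mapping.map.rep_eq when_def)

lemma vector_space_free_scale: "vector_space free_scale"
  by unfold_locales
    (auto intro!: poly_mapping_eqI simp: lookup_add lookup_free_scale algebra_simps)

definition lin_ext :: "('k::field \<Rightarrow> 'w::ab_group_add \<Rightarrow> 'w) \<Rightarrow> ('p \<Rightarrow> 'w) \<Rightarrow> ('p \<Rightarrow>\<^sub>0 'k) \<Rightarrow> 'w" where
  "lin_ext sc f t = (\<Sum>p\<in>Poly_Mapping.keys t. sc (Poly_Mapping.lookup t p) (f p))"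

text \<open>
  The members of \<open>slots\<close> are the ways of putting a variable vector into one component of a
  tuple, the other components being fixed; every slot has to become linear.
\<close>

definition multilinear_relations ::
    "('k::field \<Rightarrow> 'h::ab_group_add \<Rightarrow> 'h) \<Rightarrow> ('h \<Rightarrow> 'p) set \<Rightarrow> ('p \<Rightarrow>\<^sub>0 'k) set" where
  "multilinear_relations scale slots = module.span free_scale
     ({free_gen (q (x + y)) - free_gen (q x) - free_gen (q y) | q x y. q \<in> slots} \<union>
      {free_gen (q (scale c x)) - free_scale c (free_gen (q x)) | q c x. q \<in> slots})"

definition tensor_eq ::
    "('k::field \<Rightarrow> 'h::ab_group_add \<Rightarrow> 'h) \<Rightarrow> ('h \<Rightarrow> 'p) set \<Rightarrow> ('p \<Rightarrow>\<^sub>0 'k) \<Rightarrow> ('p \<Rightarrow>\<^sub>0 'k) \<Rightarrow> bool" where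
  "tensor_eq scale slots t u \<longleftrightarrow> t - u \<in> multilinear_relations scale slots"

definition slots2 :: "('h \<Rightarrow> 'h \<times> 'h) set" where
  "slots2 = {\<lambda>x. (x, y) | y. True} \<union> {\<lambda>x. (y, x) | y. True}"

definition slots3 :: "('h \<Rightarrow> 'h \<times> 'h \<times> 'h) set" where
  "slots3 = {\<lambda>x. (x, y, z) | y z. True} \<union> {\<lambda>x. (y, x, z) | y z. True} \<union> {\<lambda>x. (y, z, x) | y z. True}"

definition tensor_mult :: "('h::ring_1 \<times> 'h \<Rightarrow>\<^sub>0 'k::field) \<Rightarrow> ('h \<times> 'h \<Rightarrow>\<^sub>0 'k) \<Rightarrow> ('h \<times> 'h \<Rightarrow>\<^sub>0 'k)" where
  "tensor_mult t u =
     lin_ext free_scale (\<lambda>(x, y). lin_ext free_scale (\<lambda>(x', y'). free_gen (x * x', y * y')) u) t"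

section \<open>Hopf algebras\<close>

text \<open>
  \<open>sweedler sc \<Delta> f a\<close> is \<open>f(a\<^sub>1, a\<^sub>2)\<close> in Sweedler notation, summation understood, for a
  bilinear \<open>f\<close> with values in a space with scalar multiplication \<open>sc\<close>.
\<close>

definition sweedler ::
    "('k::field \<Rightarrow> 'w::ab_group_add \<Rightarrow> 'w) \<Rightarrow> ('h \<Rightarrow> ('h \<times> 'h \<Rightarrow>\<^sub>0 'k)) \<Rightarrow> ('h \<Rightarrow> 'h \<Rightarrow> 'w) \<Rightarrow> 'h \<Rightarrow> 'w" where
  "sweedler sc \<Delta> f a = lin_ext sc (\<lambda>(a1, a2). f a1 a2) (\<Delta> a)"

locale hopf_algebra = vector_space scale
  for scale :: "'k::field \<Rightarrow> 'h::ring_1 \<Rightarrow> 'h" +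
  fixes \<Delta> :: "'h \<Rightarrow> ('h \<times> 'h \<Rightarrow>\<^sub>0 'k)"
    and \<epsilon> :: "'h \<Rightarrow> 'k"
    and S :: "'h \<Rightarrow> 'h"
  assumes scale_mult_left: "scale c x * y = scale c (x * y)"
    and scale_mult_right: "x * scale c y = scale c (x * y)"
    and comult_add: "tensor_eq scale slots2 (\<Delta> (a + b)) (\<Delta> a + \<Delta> b)"
    and comult_scale: "tensor_eq scale slots2 (\<Delta> (scale c a)) (free_scale c (\<Delta> a))"
    and comult_one: "tensor_eq scale slots2 (\<Delta> 1) (free_gen (1, 1))"
    and comult_mult: "tensor_eq scale slots2 (\<Delta> (a * b)) (tensor_mult (\<Delta> a) (\<Delta> b))"
    and coassoc: "tensor_eq scale slots3
          (sweedler free_scale \<Delta> (\<lambda>a1 a2. sweedler free_scale \<Delta> (\<lambda>b1 b2. free_gen (b1, b2, a2)) a1) a)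
          (sweedler free_scale \<Delta> (\<lambda>a1 a2. sweedler free_scale \<Delta> (\<lambda>b1 b2. free_gen (a1, b1, b2)) a2) a)"
    and counit_linear: "Vector_Spaces.linear scale (*) \<epsilon>"
    and counit_one: "\<epsilon> 1 = 1"
    and counit_mult: "\<epsilon> (a * b) = \<epsilon> a * \<epsilon> b"
    and counit_left: "sweedler scale \<Delta> (\<lambda>a1 a2. scale (\<epsilon> a1) a2) a = a"
    and counit_right: "sweedler scale \<Delta> (\<lambda>a1 a2. scale (\<epsilon> a2) a1) a = a"
    and antipode_linear: "Vector_Spaces.linear scale scale S"
    and antipode_left: "sweedler scale \<Delta> (\<lambda>a1 a2. S a1 * a2) a = scale (\<epsilon> a) 1"
    and antipode_right: "sweedler scale \<Delta> (\<lambda>a1 a2. a1 * S a2) a = scale (\<epsilon> a) 1"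

text \<open>
  Integrals are left integrals; in a semisimple Hopf algebra they are two-sided. The zero
  vector satisfies the equations but is not an idempotent in the intended sense.
\<close>

definition idempotent_integral ::
    "('k::field \<Rightarrow> 'h::ring_1 \<Rightarrow> 'h) \<Rightarrow> ('h \<Rightarrow> 'k) \<Rightarrow> 'h \<Rightarrow> bool" where
  "idempotent_integral scale \<epsilon> \<Lambda> \<longleftrightarrow>
     (\<forall>h. h * \<Lambda> = scale (\<epsilon> h) \<Lambda>) \<and> \<Lambda> * \<Lambda> = \<Lambda> \<and> \<Lambda> \<noteq> 0"

text \<open>
  \<open>{a, b} = a\<^sub>1 b\<^sub>1 S(a\<^sub>2) S(b\<^sub>2)\<close>: the commutator of a Hopf algebra with \<open>S\<^sup>2 = id\<close> and trivial
  distinguished group-like element.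
\<close>

definition hopf_commutator ::
    "('k::field \<Rightarrow> 'h::ring_1 \<Rightarrow> 'h) \<Rightarrow> ('h \<Rightarrow> ('h \<times> 'h \<Rightarrow>\<^sub>0 'k)) \<Rightarrow> ('h \<Rightarrow> 'h) \<Rightarrow> 'h \<Rightarrow> 'h \<Rightarrow> 'h" where
  "hopf_commutator scale \<Delta> S a b =
     sweedler scale \<Delta> (\<lambda>a1 a2. sweedler scale \<Delta> (\<lambda>b1 b2. a1 * b1 * S a2 * S b2) b) a"

text \<open>\<open>iterated_commutator scale \<Delta> S \<Lambda> m\<close> is \<open>\<Lambda>\<^bsup>{m}\<^esup>\<close>, meaningful for \<open>m \<ge> 1\<close>.\<close>

fun iterated_commutator ::
    "('k::field \<Rightarrow> 'h::ring_1 \<Rightarrow> 'h) \<Rightarrow> ('h \<Rightarrow> ('h \<times> 'h \<Rightarrow>\<^sub>0 'k)) \<Rightarrow> ('h \<Rightarrow> 'h) \<Rightarrow> 'h \<Rightarrow> nat \<Rightarrow> 'h" where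
  "iterated_commutator scale \<Delta> S \<Lambda> 0 = undefined"
| "iterated_commutator scale \<Delta> S \<Lambda> (Suc 0) = \<Lambda>"
| "iterated_commutator scale \<Delta> S \<Lambda> (Suc (Suc m)) =
     hopf_commutator scale \<Delta> S (iterated_commutator scale \<Delta> S \<Lambda> (Suc m)) \<Lambda>"

definition adjoint_action ::
    "('k::field \<Rightarrow> 'h::ring_1 \<Rightarrow> 'h) \<Rightarrow> ('h \<Rightarrow> ('h \<times> 'h \<Rightarrow>\<^sub>0 'k)) \<Rightarrow> ('h \<Rightarrow> 'h) \<Rightarrow> 'h \<Rightarrow> 'h \<Rightarrow> 'h" where
  "adjoint_action scale \<Delta> S a b = sweedler scale \<Delta> (\<lambda>a1 a2. a1 * b * S a2) a"

definition convolution ::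
    "('h \<Rightarrow> ('h \<times> 'h \<Rightarrow>\<^sub>0 'k::field)) \<Rightarrow> ('h \<Rightarrow> 'k) \<Rightarrow> ('h \<Rightarrow> 'k) \<Rightarrow> 'h \<Rightarrow> 'k" where
  "convolution \<Delta> f g a = sweedler (*) \<Delta> (\<lambda>a1 a2. f a1 * g a2) a"

definition dual_antipode :: "('h \<Rightarrow> 'h) \<Rightarrow> ('h \<Rightarrow> 'k) \<Rightarrow> 'h \<Rightarrow> 'k" where
  "dual_antipode S f = f \<circ> S"

section \<open>Modules\<close>

text \<open>
  The underlying space of a module is a subspace \<open>V\<close> of an ambient vector space, so that
  modules of different dimensions can be members of one family. The value of the action
  \<open>\<rho>\<close> outside \<open>V\<close> is irrelevant.
\<close>

definition algebra_module ::
    "('k::field \<Rightarrow> 'h::ring_1 \<Rightarrow> 'h) \<Rightarrow> ('k \<Rightarrow> 'v::ab_group_add \<Rightarrow> 'v) \<Rightarrow> 'v set \<Rightarrow> ('h \<Rightarrow> 'v \<Rightarrow> 'v) \<Rightarrow> bool" where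
  "algebra_module scale scaleV V \<rho> \<longleftrightarrow>
     vector_space scaleV \<and> module.subspace scaleV V \<and>
     (\<forall>h. \<forall>v\<in>V. \<rho> h v \<in> V) \<and>
     (\<forall>h. \<forall>v\<in>V. \<forall>w\<in>V. \<rho> h (v + w) = \<rho> h v + \<rho> h w) \<and>
     (\<forall>h c. \<forall>v\<in>V. \<rho> h (scaleV c v) = scaleV c (\<rho> h v)) \<and>
     (\<forall>h h'. \<forall>v\<in>V. \<rho> (h + h') v = \<rho> h v + \<rho> h' v) \<and>
     (\<forall>h c. \<forall>v\<in>V. \<rho> (scale c h) v = scaleV c (\<rho> h v)) \<and>
     (\<forall>v\<in>V. \<rho> 1 v = v) \<and>
     (\<forall>h h'. \<forall>v\<in>V. \<rho> (h * h') v = \<rho> h (\<rho> h' v))"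

definition submodule ::
    "('k::field \<Rightarrow> 'v::ab_group_add \<Rightarrow> 'v) \<Rightarrow> ('h \<Rightarrow> 'v \<Rightarrow> 'v) \<Rightarrow> 'v set \<Rightarrow> 'v set \<Rightarrow> bool" where
  "submodule scaleV \<rho> W V \<longleftrightarrow>
     module.subspace scaleV W \<and> W \<subseteq> V \<and> (\<forall>h. \<forall>w\<in>W. \<rho> h w \<in> W)"

definition simple_module ::
    "('k::field \<Rightarrow> 'h::ring_1 \<Rightarrow> 'h) \<Rightarrow> ('k \<Rightarrow> 'v::ab_group_add \<Rightarrow> 'v) \<Rightarrow> 'v set \<Rightarrow> ('h \<Rightarrow> 'v \<Rightarrow> 'v) \<Rightarrow> bool" where
  "simple_module scale scaleV V \<rho> \<longleftrightarrow>
     algebra_module scale scaleV V \<rho> \<and> V \<noteq> {0} \<and>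
     (\<forall>W. submodule scaleV \<rho> W V \<longrightarrow> W = {0} \<or> W = V)"

definition semisimple_module ::
    "('k::field \<Rightarrow> 'h::ring_1 \<Rightarrow> 'h) \<Rightarrow> ('k \<Rightarrow> 'v::ab_group_add \<Rightarrow> 'v) \<Rightarrow> 'v set \<Rightarrow> ('h \<Rightarrow> 'v \<Rightarrow> 'v) \<Rightarrow> bool" where
  "semisimple_module scale scaleV V \<rho> \<longleftrightarrow>
     algebra_module scale scaleV V \<rho> \<and>
     (\<forall>W. submodule scaleV \<rho> W V \<longrightarrow>
        (\<exists>W'. submodule scaleV \<rho> W' V \<and> W \<inter> W' = {0} \<and> {w + w' | w w'. w \<in> W \<and> w' \<in> W'} = V))"

definition semisimple_algebra :: "('k::field \<Rightarrow> 'h::ring_1 \<Rightarrow> 'h) \<Rightarrow> bool" where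
  "semisimple_algebra scale \<longleftrightarrow> semisimple_module scale scale UNIV (*)"

definition isomorphic_modules ::
    "('k::field \<Rightarrow> 'v::ab_group_add \<Rightarrow> 'v) \<Rightarrow> 'v set \<Rightarrow> ('h \<Rightarrow> 'v \<Rightarrow> 'v) \<Rightarrow>
     ('k \<Rightarrow> 'w::ab_group_add \<Rightarrow> 'w) \<Rightarrow> 'w set \<Rightarrow> ('h \<Rightarrow> 'w \<Rightarrow> 'w) \<Rightarrow> bool" where
  "isomorphic_modules scaleV V \<rho> scaleW W \<sigma> \<longleftrightarrow>
     (\<exists>f. bij_betw f V W \<and>
        (\<forall>v\<in>V. \<forall>w\<in>V. f (v + w) = f v + f w) \<and>
        (\<forall>c. \<forall>v\<in>V. f (scaleV c v) = scaleW c (f v)) \<and>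
        (\<forall>h. \<forall>v\<in>V. f (\<rho> h v) = \<sigma> h (f v)))"

definition trivial_module ::
    "('h \<Rightarrow> 'k::field) \<Rightarrow> ('k \<Rightarrow> 'v::ab_group_add \<Rightarrow> 'v) \<Rightarrow> 'v set \<Rightarrow> ('h \<Rightarrow> 'v \<Rightarrow> 'v) \<Rightarrow> bool" where
  "trivial_module \<epsilon> scaleV V \<rho> \<longleftrightarrow>
     vector_space.dim scaleV V = 1 \<and> (\<forall>h. \<forall>v\<in>V. \<rho> h v = scaleV (\<epsilon> h) v)"

text \<open>
  Completeness quantifies over the simple modules, with an arbitrary action, whose underlying
  space is a subspace of \<open>H\<close>. This covers all simple modules up to isomorphism: a simple module
  is a quotient of \<open>H\<close>, hence isomorphic as a vector space to a subspace of \<open>H\<close>; see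
  \<open>complete_simple_modules_cover\<close> below.
\<close>

definition complete_simple_modules ::
    "('k::field \<Rightarrow> 'h::ring_1 \<Rightarrow> 'h) \<Rightarrow> ('k \<Rightarrow> 'v::ab_group_add \<Rightarrow> 'v) \<Rightarrow>
     nat \<Rightarrow> (nat \<Rightarrow> 'v set) \<Rightarrow> (nat \<Rightarrow> 'h \<Rightarrow> 'v \<Rightarrow> 'v) \<Rightarrow> bool" where
  "complete_simple_modules scale scaleV n V \<rho> \<longleftrightarrow>
     (\<forall>i<n. simple_module scale scaleV (V i) (\<rho> i)) \<and>
     (\<forall>i<n. \<forall>j<n. i \<noteq> j \<longrightarrow> \<not> isomorphic_modules scaleV (V i) (\<rho> i) scaleV (V j) (\<rho> j)) \<and>
     (\<forall>W \<sigma>. simple_module scale scale W \<sigma> \<longrightarrow>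
        (\<exists>i<n. isomorphic_modules scale W \<sigma> scaleV (V i) (\<rho> i)))"

lemma complete_simple_modules_cover:
  fixes scaleW :: "'k::field \<Rightarrow> 'w::ab_group_add \<Rightarrow> 'w"
  assumes H: "vector_space (scale :: 'k \<Rightarrow> 'h::ring_1 \<Rightarrow> 'h)"
    and complete: "complete_simple_modules scale scaleV n V \<rho>"
    and simple: "simple_module scale scaleW W \<sigma>"
  shows "\<exists>i<n. isomorphic_modules scaleW W \<sigma> scaleV (V i) (\<rho> i)"
proof -
  have mod: "algebra_module scale scaleW W \<sigma>" and W0: "W \<noteq> {0}"
    and sub: "\<And>U. submodule scaleW \<sigma> U W \<Longrightarrow> U = {0} \<or> U = W"
    using simple by (auto simp: simple_module_def)
  interpret h: vector_space scale by (rule H)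
  interpret w: vector_space scaleW using mod by (simp add: algebra_module_def)
  interpret vector_space_pair scale scaleW ..
  have W: "w.subspace W" and cl: "\<And>h v. v \<in> W \<Longrightarrow> \<sigma> h v \<in> W"
    and ad: "\<And>h v u. v \<in> W \<Longrightarrow> u \<in> W \<Longrightarrow> \<sigma> h (v + u) = \<sigma> h v + \<sigma> h u"
    and sc: "\<And>h c v. v \<in> W \<Longrightarrow> \<sigma> h (scaleW c v) = scaleW c (\<sigma> h v)"
    and lad: "\<And>h h' v. v \<in> W \<Longrightarrow> \<sigma> (h + h') v = \<sigma> h v + \<sigma> h' v"
    and lsc: "\<And>h c v. v \<in> W \<Longrightarrow> \<sigma> (scale c h) v = scaleW c (\<sigma> h v)"
    and one: "\<And>v. v \<in> W \<Longrightarrow> \<sigma> 1 v = v"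
    and mult: "\<And>h h' v. v \<in> W \<Longrightarrow> \<sigma> (h * h') v = \<sigma> h (\<sigma> h' v)"
    using mod by (simp_all add: algebra_module_def)
  obtain w where w: "w \<in> W" "w \<noteq> 0"
    using W0 w.subspace_0[OF W] by blast
  define \<phi> where "\<phi> h = \<sigma> h w" for h
  have lin: "Vector_Spaces.linear scale scaleW \<phi>"
    by (rule Vector_Spaces.linear.intro)
      (auto intro!: h.vector_space_axioms w.vector_space_axioms
        simp: \<phi>_def lad lsc w module_hom_def module_hom_axioms_def h.module_axioms w.module_axioms)
  interpret \<phi>: Vector_Spaces.linear scale scaleW \<phi> by (rule lin)
  have "submodule scaleW \<sigma> (range \<phi>) W"
    using \<phi>.subspace_image[OF h.subspace_UNIV]
    by (auto simp: submodule_def \<phi>_def cl w mult[symmetric])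
  moreover have "w \<in> range \<phi>"
    using one[OF w(1)] by (metis \<phi>_def rangeI)
  ultimately have range: "range \<phi> = W"
    using sub w(2) by blast
  obtain g where g: "Vector_Spaces.linear scaleW scale g" and inv: "\<And>v. v \<in> W \<Longrightarrow> \<phi> (g v) = v"
    using linear_exists_right_inverse_on[OF lin h.subspace_UNIV] range by auto
  interpret g: Vector_Spaces.linear scaleW scale g by (rule g)
  define \<tau> where "\<tau> h x = g (\<sigma> h (\<phi> x))" for h x
  have "algebra_module scale scale (g ` W) \<tau>"
    using H g.subspace_image[OF W]
    by (auto simp: algebra_module_def \<tau>_def inv cl ad sc lad lsc one mult
        g.add[symmetric] g.scale[symmetric] w.subspace_add[OF W] w.subspace_scale[OF W])
  moreover have "g ` W \<noteq> {0}"
    by (metis imageI singletonD inv w \<phi>.zero)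
  moreover have "U = {0} \<or> U = g ` W" if U: "submodule scale \<tau> U (g ` W)" for U
  proof -
    have gU: "g (\<phi> x) = x" if "x \<in> U" for x
      using U that by (auto simp: submodule_def inv)
    have "\<phi> ` U \<subseteq> W"
      using U by (auto simp: submodule_def inv)
    moreover have "\<sigma> h (\<phi> x) \<in> \<phi> ` U" if "x \<in> U" for h x
    proof -
      have "\<tau> h x \<in> U" using U that by (auto simp: submodule_def)
      moreover have "\<phi> (\<tau> h x) = \<sigma> h (\<phi> x)"
        using \<open>\<phi> ` U \<subseteq> W\<close> that by (auto simp: \<tau>_def inv cl)
      ultimately show ?thesis by (metis imageI)
    qed
    ultimately have "submodule scaleW \<sigma> (\<phi> ` U) W"
      using U \<phi>.subspace_image[of U] by (auto simp: submodule_def)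
    then have "\<phi> ` U = {0} \<or> \<phi> ` U = W" by (rule sub)
    moreover have "g ` \<phi> ` U = U" using gU by force
    ultimately show ?thesis using g.zero by auto
  qed
  ultimately have simple': "simple_module scale scale (g ` W) \<tau>"
    by (simp add: simple_module_def)
  have "\<forall>U \<upsilon>. simple_module scale scale U \<upsilon> \<longrightarrow>
      (\<exists>i<n. isomorphic_modules scale U \<upsilon> scaleV (V i) (\<rho> i))"
    using complete unfolding complete_simple_modules_def by (elim conjE)
  with simple' obtain i where i: "i < n"
    and "isomorphic_modules scale (g ` W) \<tau> scaleV (V i) (\<rho> i)"
    by meson
  then obtain f where bij: "bij_betw f (g ` W) (V i)"
    and fadd: "\<forall>v\<in>g ` W. \<forall>u\<in>g ` W. f (v + u) = f v + f u"
    and fscale: "\<forall>c. \<forall>v\<in>g ` W. f (scale c v) = scaleV c (f v)"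
    and fact: "\<forall>h. \<forall>v\<in>g ` W. f (\<tau> h v) = \<rho> i h (f v)"
    unfolding isomorphic_modules_def by (elim exE conjE)
  have "inj_on g W" by (metis inj_onI inv)
  then have "bij_betw g W (g ` W)" by (rule inj_on_imp_bij_betw)
  then have "bij_betw (\<lambda>v. f (g v)) W (V i)"
    using bij_betw_trans[OF _ bij] by (simp add: comp_def)
  moreover have "f (g (v + u)) = f (g v) + f (g u)" if "v \<in> W" "u \<in> W" for v u
    using fadd that by (simp add: g.add)
  moreover have "f (g (scaleW c v)) = scaleV c (f (g v))" if "v \<in> W" for c v
    using fscale that by (simp add: g.scale)
  moreover have "f (g (\<sigma> h v)) = \<rho> i h (f (g v))" if "v \<in> W" for h v
    using fact that by (simp add: \<tau>_def inv)
  ultimately have "isomorphic_modules scaleW W \<sigma> scaleV (V i) (\<rho> i)"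
    unfolding isomorphic_modules_def by (intro exI[of _ "\<lambda>v. f (g v)"] conjI ballI allI)
  with i show ?thesis by blast
qed

section \<open>Characters and central idempotents\<close>

definition trace_on :: "('k::field \<Rightarrow> 'v::ab_group_add \<Rightarrow> 'v) \<Rightarrow> 'v set \<Rightarrow> ('v \<Rightarrow> 'v) \<Rightarrow> 'k" where
  "trace_on scaleV V f =
     (let B = (SOME B. \<not> module.dependent scaleV B \<and> module.span scaleV B = V)
      in \<Sum>b\<in>B. module.representation scaleV B (f b) b)"

definition module_character ::
    "('k::field \<Rightarrow> 'v::ab_group_add \<Rightarrow> 'v) \<Rightarrow> 'v set \<Rightarrow> ('h \<Rightarrow> 'v \<Rightarrow> 'v) \<Rightarrow> 'h \<Rightarrow> 'k" where
  "module_character scaleV V \<rho> h = trace_on scaleV V (\<rho> h)"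

definition central_idempotent :: "'h::ring_1 \<Rightarrow> bool" where
  "central_idempotent e \<longleftrightarrow> e * e = e \<and> (\<forall>h. e * h = h * e)"

definition central_primitive_idempotent :: "'h::ring_1 \<Rightarrow> bool" where
  "central_primitive_idempotent e \<longleftrightarrow>
     central_idempotent e \<and> e \<noteq> 0 \<and>
     (\<forall>f g. central_idempotent f \<and> central_idempotent g \<and> f * g = 0 \<and> e = f + g \<longrightarrow> f = 0 \<or> g = 0)"

end

theory Submission
  imports Defs
begin

text \<open>
  Commutators with an integral are governed by averaging. The tensor \<open>\<Lambda>\<^sub>1 \<otimes> S(\<Lambda>\<^sub>2)\<close> satisfies
  \<open>h \<Lambda>\<^sub>1 \<otimes> S(\<Lambda>\<^sub>2) = \<Lambda>\<^sub>1 \<otimes> S(\<Lambda>\<^sub>2) h\<close> (lemma \<open>casimir\<close>), so \<open>T \<mapsto> \<Lambda>\<^sub>1 T S(\<Lambda>\<^sub>2)\<close> maps endomorphisms of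
  \<open>V\<^sub>i\<close> to module endomorphisms, which are scalars by Schur's lemma. If moreover
  \<open>S(\<Lambda>\<^sub>2) \<Lambda>\<^sub>1 = 1\<close>, the trace is preserved and the scalar is \<open>tr(T) / d\<^sub>i\<close> (lemma \<open>averaging\<close>).
  Since \<open>{a, \<Lambda>} = a\<^sub>1 (\<Lambda>\<^sub>1 S(a\<^sub>2) S(\<Lambda>\<^sub>2))\<close>, this gives
  \<open>\<chi>\<^sub>i({a, \<Lambda>}) = \<chi>\<^sub>i(a\<^sub>1) \<chi>\<^sub>i(S(a\<^sub>2)) / d\<^sub>i\<close>, and the same argument on \<open>H\<close> gives the formula for the
  regular character. As \<open>\<chi>\<^sub>i s(\<chi>\<^sub>i)\<close> is a trace function, it is the combination of the \<open>\<chi>\<^sub>j\<close> with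
  coefficients \<open>\<langle>\<chi>\<^sub>i s(\<chi>\<^sub>i), e\<^sub>j\<rangle> / d\<^sub>j\<close>; iterating, from \<open>\<langle>\<chi>\<^sub>i s(\<chi>\<^sub>i), \<Lambda>\<rangle> = 1\<close>, yields the closed formula.

  The condition \<open>S(\<Lambda>\<^sub>2) \<Lambda>\<^sub>1 = 1\<close> follows from \<open>S\<^sup>2 = id\<close>, the theorem of Larson and Radford, and most
  of the text is devoted to its proof (lemma \<open>antipode_involution\<close>). The functional
  \<open>\<lambda>(h) = Tr(x \<mapsto> h S\<^sup>2(x))\<close> is an integral of the dual algebra with \<open>\<lambda>(\<Lambda>) = 1\<close>, from which its
  nondegeneracy, the bijectivity of \<open>S\<close>, a group-like element \<open>g\<close> with \<open>\<lambda>(h\<^sub>1) h\<^sub>2 = \<lambda>(h) g\<close>, and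
  Radford's formula \<open>g S\<^sup>4(k) = k g\<close> follow. Moreover \<open>S\<^sup>2\<close> is conjugation by a unit \<open>w\<close>, which may
  be chosen with \<open>g w\<^sup>2 = 1\<close>.

  The crucial point is \<open>\<lambda>(1) = Tr(S\<^sup>2) \<noteq> 0\<close> (lemma \<open>lam_one_nonzero\<close>). The eigenvalues of \<open>w\<close> are
  roots of unity, and over the complex numbers \<open>Tr(S\<^sup>2)\<close> would be the sum of the numbers
  \<open>\<bar>\<chi>\<^sub>i(w)\<bar>\<^sup>2\<close>. Over a general field of characteristic \<open>0\<close> this positivity is replaced by one of
  rational Gram matrices: if \<open>\<lambda>(1) = 0\<close> then \<open>\<lambda>\<close> vanishes on the spectral idempotents of \<open>g\<close>, and
  these equations have integer coefficients up to factors that can be cancelled (lemma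
  \<open>rational_gram_kernel\<close>). Once \<open>\<lambda>(1) \<noteq> 0\<close>, one gets \<open>g = 1\<close> and \<open>S\<^sup>4 = id\<close>. The regular character
  of the dual algebra, divided by \<open>dim H\<close>, is an idempotent \<open>E\<close> of \<open>H\<close> fixed by \<open>S\<^sup>2\<close>, and
  \<open>Tr(S\<^sup>2) = dim H * Tr(x \<mapsto> E S\<^sup>2(x))\<close> with an integer as the second factor. An involution whose
  trace is a nonzero multiple of the dimension is \<open>1\<close> or \<open>-1\<close>, and \<open>S\<^sup>2(1) = 1\<close>.
\<close>

section \<open>Linear maps, finite-dimensional subspaces and traces\<close>

text \<open>
  Linearity is relative to a subspace, because a module action is unspecified outside its
  underlying space.
\<close>

definition lin_on :: "('k \<Rightarrow> 'a::ab_group_add \<Rightarrow> 'a) \<Rightarrow> ('k \<Rightarrow> 'b::ab_group_add \<Rightarrow> 'b) \<Rightarrow> 'a set \<Rightarrow> ('a \<Rightarrow> 'b) \<Rightarrow> bool" where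
  "lin_on s1 s2 V f \<longleftrightarrow>
     (\<forall>x\<in>V. \<forall>y\<in>V. f (x + y) = f x + f y) \<and> (\<forall>c. \<forall>x\<in>V. f (s1 c x) = s2 c (f x))"

abbreviation lin :: "('k \<Rightarrow> 'a::ab_group_add \<Rightarrow> 'a) \<Rightarrow> ('k \<Rightarrow> 'b::ab_group_add \<Rightarrow> 'b) \<Rightarrow> ('a \<Rightarrow> 'b) \<Rightarrow> bool" where
  "lin s1 s2 \<equiv> lin_on s1 s2 UNIV"

lemma lin_onI:
  assumes "\<And>x y. x \<in> V \<Longrightarrow> y \<in> V \<Longrightarrow> f (x + y) = f x + f y"
    and "\<And>c x. x \<in> V \<Longrightarrow> f (s1 c x) = s2 c (f x)"
  shows "lin_on s1 s2 V f"
  using assms by (simp add: lin_on_def)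

lemma lin_on_add: "lin_on s1 s2 V f \<Longrightarrow> x \<in> V \<Longrightarrow> y \<in> V \<Longrightarrow> f (x + y) = f x + f y"
  by (simp add: lin_on_def)

lemma lin_on_scale: "lin_on s1 s2 V f \<Longrightarrow> x \<in> V \<Longrightarrow> f (s1 c x) = s2 c (f x)"
  by (simp add: lin_on_def)

lemma lin_on_subset: "lin_on s1 s2 V f \<Longrightarrow> W \<subseteq> V \<Longrightarrow> lin_on s1 s2 W f"
  unfolding lin_on_def by blast

lemma lin_on_compose:
  "lin_on s1 s2 V f \<Longrightarrow> lin_on s2 s3 W g \<Longrightarrow> f ` V \<subseteq> W \<Longrightarrow> lin_on s1 s3 V (\<lambda>x. g (f x))"
  by (auto simp: lin_on_def image_subset_iff)

lemma lin_on_zero: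
  assumes "lin_on s1 s2 V f" "0 \<in> V" shows "f 0 = 0"
proof -
  have "f (0 + 0) = f 0 + f 0" using assms by (intro lin_on_add)
  then show ?thesis by simp
qed

lemma lin_on_diff:
  assumes f: "lin_on s1 s2 V f" and "x - y \<in> V" "y \<in> V" shows "f (x - y) = f x - f y"
proof -
  have "f ((x - y) + y) = f (x - y) + f y" using assms by (intro lin_on_add)
  then show ?thesis by (simp add: algebra_simps)
qed

lemma lin_sum: "lin s1 s2 f \<Longrightarrow> f (\<Sum>i\<in>A. g i) = (\<Sum>i\<in>A. f (g i))"
  by (induction A rule: infinite_finite_induct) (auto simp: lin_on_zero lin_on_add)

text \<open>
  A locale of its own: additions to \<^locale>\<open>vector_space\<close> would be copied into its global
  interpretation by the real vector spaces and shadow the local ones.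
\<close>

locale vspace = vector_space
begin

lemma lin_on_sum:
  assumes f: "lin_on scale s2 V f" and V: "subspace V" and g: "\<And>i. i \<in> A \<Longrightarrow> g i \<in> V"
  shows "f (\<Sum>i\<in>A. g i) = (\<Sum>i\<in>A. f (g i))"
  using g
proof (induction A rule: infinite_finite_induct)
  case (insert i A)
  then have "(\<Sum>i\<in>A. g i) \<in> V" by (intro subspace_sum V) auto
  with insert show ?case by (simp add: lin_on_add[OF f])
qed (use lin_on_zero[OF f subspace_0[OF V]] in auto)

definition fin_dim :: "'b set \<Rightarrow> bool" where
  "fin_dim V \<longleftrightarrow> subspace V \<and> (\<exists>B. finite B \<and> span B = V)"

lemma fin_dim_subspace: "fin_dim V \<Longrightarrow> subspace V"
  by (simp add: fin_dim_def)

lemma fin_dim_basis: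
  assumes "fin_dim V"
  obtains B where "finite B" "independent B" "span B = V" "card B = dim V"
proof -
  obtain C where C: "finite C" "span C = V" and V: "subspace V"
    using assms by (auto simp: fin_dim_def)
  obtain B where B: "B \<subseteq> V" "independent B" "V \<subseteq> span B" "card B = dim V"
    by (rule basis_exists)
  have "finite B" using independent_span_bound[of C B] B C by auto
  moreover have "span B = V" using B V span_minimal by blast
  ultimately show ?thesis using that B by blast
qed

lemma fin_dim_sub:
  assumes V: "fin_dim V" and W: "subspace W" "W \<subseteq> V"
  shows "fin_dim W"
proof -
  obtain C where C: "finite C" "span C = V" using V by (auto simp: fin_dim_def)
  obtain B where B: "B \<subseteq> W" "independent B" "W \<subseteq> span B" "card B = dim W"
    by (rule basis_exists)
  have "finite B" using independent_span_bound[of C B] B C W by auto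
  moreover have "span B = W" using B W span_minimal by blast
  ultimately show ?thesis using W by (auto simp: fin_dim_def)
qed

lemma fin_dim_dim_mono:
  assumes V: "fin_dim V" and W: "subspace W" "W \<subseteq> V"
  shows "dim W \<le> dim V"
proof -
  obtain C where C: "finite C" "span C = V" "card C = dim V" by (rule fin_dim_basis[OF V])
  then show ?thesis using dim_le_card[of W C] W by simp
qed

lemma fin_dim_dim_eq:
  assumes V: "fin_dim V" and W: "subspace W" "W \<subseteq> V" and dim: "dim V \<le> dim W"
  shows "W = V"
proof (rule ccontr)
  assume "W \<noteq> V"
  then obtain v where v: "v \<in> V" "v \<notin> W" using W by blast
  obtain B where B: "finite B" "independent B" "span B = W" "card B = dim W"
    by (rule fin_dim_basis[OF fin_dim_sub[OF V W]])
  have "independent (insert v B)" using B v by (simp add: independent_insert)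
  then have "dim (span (insert v B)) = card (insert v B)" by (rule dim_span_eq_card_independent)
  also have "\<dots> = Suc (card B)" using B v by (metis card_insert_disjoint span_base)
  finally have "dim (span (insert v B)) = Suc (dim W)" using B by simp
  moreover have "span (insert v B) \<subseteq> V"
    using B v W fin_dim_subspace[OF V] by (intro span_minimal) (auto dest: span_base)
  ultimately show False using fin_dim_dim_mono[OF V, of "span (insert v B)"] dim by simp
qed

lemma fin_dim_dim_0:
  assumes "fin_dim V" "dim V = 0" shows "V = {0}"
proof -
  obtain B where B: "finite B" "independent B" "span B = V" "card B = dim V"
    by (rule fin_dim_basis[OF assms(1)])
  then show ?thesis using assms by auto
qed

lemma lin_on_representation:
  assumes "independent B" shows "lin_on scale (*) (span B) (\<lambda>x. representation B x b)"
  using assms by (intro lin_onI) (auto simp: representation_add representation_scale)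

text \<open>Both sides are the sum of the products of the matrix entries of \<open>f\<close> and \<open>g\<close>.\<close>

lemma trace_sum_commute:
  assumes B: "finite B" "independent B" "span B = V" and C: "finite C" "independent C" "span C = W"
    and f: "lin_on scale scale V f" "f ` V \<subseteq> W" and g: "lin_on scale scale W g" "g ` W \<subseteq> V"
  shows "(\<Sum>b\<in>B. representation B (g (f b)) b) = (\<Sum>c\<in>C. representation C (f (g c)) c)"
proof -
  have expand: "(\<Sum>b\<in>B. representation B (g (f b)) b) =
      (\<Sum>b\<in>B. \<Sum>c\<in>C. representation C (f b) c * representation B (g c) b)"
    if B: "finite B" "independent B" "span B = V" and C: "finite C" "independent C" "span C = W"
    and f: "lin_on scale scale V f" "f ` V \<subseteq> W" and g: "lin_on scale scale W g" "g ` W \<subseteq> V"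
  for B C V W f g
  proof (rule sum.cong[OF refl])
    fix b assume b: "b \<in> B"
    then have fb: "f b \<in> W" using f B span_base by blast
    have C_in: "c \<in> W" "g c \<in> V" if "c \<in> C" for c using g C that span_base by blast+
    have W: "subspace W" and V: "subspace V" using B C subspace_span by blast+
    have "g (f b) = g (\<Sum>c\<in>C. representation C (f b) c *s c)"
      using C fb by (subst sum_representation_eq) auto
    also have "\<dots> = (\<Sum>c\<in>C. g (representation C (f b) c *s c))"
      using C_in W by (intro lin_on_sum[OF g(1) W]) (auto intro: subspace_scale)
    also have "\<dots> = (\<Sum>c\<in>C. representation C (f b) c *s g c)"
      using C_in by (intro sum.cong) (auto simp: lin_on_scale[OF g(1)])
    finally have gf: "g (f b) = \<dots>" .
    have lin: "lin_on scale (*) V (\<lambda>x. representation B x b)"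
      using lin_on_representation[OF B(2)] B by simp
    show "representation B (g (f b)) b =
        (\<Sum>c\<in>C. representation C (f b) c * representation B (g c) b)"
      unfolding gf using C_in V
      by (subst lin_on_sum[OF lin V]) (auto intro: subspace_scale simp: lin_on_scale[OF lin])
  qed
  show ?thesis
    unfolding expand[OF assms] expand[OF C B g f]
    by (subst sum.swap) (simp add: mult.commute)
qed

text \<open>
  The trace refers to a basis picked by choice; taking the identity as one of the two maps in
  \<open>trace_sum_commute\<close> shows that every other basis gives the same sum.
\<close>

lemma trace_on_basis:
  assumes B: "finite B" "independent B" "span B = V" and f: "lin_on scale scale V f" "f ` V \<subseteq> V"
  shows "trace_on scale V f = (\<Sum>b\<in>B. representation B (f b) b)"
proof -
  define C where "C = (SOME C. independent C \<and> span C = V)"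
  have C: "independent C \<and> span C = V"
    unfolding C_def by (rule someI) (use B in blast)
  then have "finite C" using independent_span_bound[of B C] B span_superset by blast
  have id: "lin_on scale scale V (\<lambda>x. x)" by (simp add: lin_on_def)
  have "trace_on scale V f = (\<Sum>c\<in>C. representation C (f c) c)"
    by (simp add: trace_on_def C_def Let_def)
  also have "\<dots> = (\<Sum>b\<in>B. representation B (f b) b)"
    using trace_sum_commute[OF \<open>finite C\<close> _ _ B(1-3) f id] C by simp
  finally show ?thesis .
qed

lemma trace_commute:
  assumes V: "fin_dim V" and W: "fin_dim W"
    and f: "lin_on scale scale V f" "f ` V \<subseteq> W" and g: "lin_on scale scale W g" "g ` W \<subseteq> V"
  shows "trace_on scale V (\<lambda>x. g (f x)) = trace_on scale W (\<lambda>x. f (g x))"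
proof -
  obtain B where B: "finite B" "independent B" "span B = V" by (rule fin_dim_basis[OF V])
  obtain C where C: "finite C" "independent C" "span C = W" by (rule fin_dim_basis[OF W])
  have "lin_on scale scale V (\<lambda>x. g (f x))" "lin_on scale scale W (\<lambda>x. f (g x))"
    using lin_on_compose[OF f(1) g(1) f(2)] lin_on_compose[OF g(1) f(1) g(2)] by auto
  moreover have "(\<lambda>x. g (f x)) ` V \<subseteq> V" "(\<lambda>x. f (g x)) ` W \<subseteq> W" using f g by auto
  ultimately show ?thesis
    using trace_on_basis[OF B] trace_on_basis[OF C] trace_sum_commute[OF B C f g] by simp
qed

lemma trace_cong:
  assumes V: "fin_dim V" and f: "lin_on scale scale V f" "f ` V \<subseteq> V"
    and eq: "\<And>x. x \<in> V \<Longrightarrow> f x = g x"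
  shows "trace_on scale V f = trace_on scale V g"
proof -
  obtain B where B: "finite B" "independent B" "span B = V" by (rule fin_dim_basis[OF V])
  note sV = fin_dim_subspace[OF V]
  have "g (x + y) = g x + g y" if "x \<in> V" "y \<in> V" for x y
    using that eq lin_on_add[OF f(1)] subspace_add[OF sV] by metis
  moreover have "g (c *s x) = c *s g x" if "x \<in> V" for c x
    using that eq lin_on_scale[OF f(1)] subspace_scale[OF sV] by metis
  ultimately have g: "lin_on scale scale V g" "g ` V \<subseteq> V"
    using f(2) eq by (auto simp: lin_on_def)
  show ?thesis
    unfolding trace_on_basis[OF B f] trace_on_basis[OF B g]
    using B eq by (intro sum.cong) (auto simp: span_base)
qed

lemma trace_sum:
  assumes V: "fin_dim V"
    and f: "\<And>i. i \<in> I \<Longrightarrow> lin_on scale scale V (f i)" "\<And>i. i \<in> I \<Longrightarrow> f i ` V \<subseteq> V"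
  shows "trace_on scale V (\<lambda>x. \<Sum>i\<in>I. c i *s f i x) = (\<Sum>i\<in>I. c i * trace_on scale V (f i))"
proof -
  obtain B where B: "finite B" "independent B" "span B = V" by (rule fin_dim_basis[OF V])
  have sV: "subspace V" by (rule fin_dim_subspace[OF V])
  have in_V: "f i x \<in> V" if "i \<in> I" "x \<in> V" for i x using f that by blast
  have lin: "lin_on scale scale V (\<lambda>x. \<Sum>i\<in>I. c i *s f i x)"
  proof (rule lin_onI)
    fix x y assume "x \<in> V" "y \<in> V"
    then show "(\<Sum>i\<in>I. c i *s f i (x + y)) = (\<Sum>i\<in>I. c i *s f i x) + (\<Sum>i\<in>I. c i *s f i y)"
      by (simp add: sum.distrib[symmetric] scale_right_distrib[symmetric] lin_on_add[OF f(1)])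
  next
    fix a x assume "x \<in> V"
    then show "(\<Sum>i\<in>I. c i *s f i (a *s x)) = a *s (\<Sum>i\<in>I. c i *s f i x)"
      by (simp add: scale_sum_right lin_on_scale[OF f(1)] mult.commute)
  qed
  have V': "(\<lambda>x. \<Sum>i\<in>I. c i *s f i x) ` V \<subseteq> V"
    using in_V sV by (auto intro!: subspace_sum subspace_scale)
  have rep: "lin_on scale (*) V (\<lambda>x. representation B x b)" for b
    using lin_on_representation[OF B(2)] B by simp
  have "trace_on scale V (\<lambda>x. \<Sum>i\<in>I. c i *s f i x) =
      (\<Sum>b\<in>B. representation B (\<Sum>i\<in>I. c i *s f i b) b)"
    by (rule trace_on_basis[OF B lin V'])
  also have "\<dots> = (\<Sum>b\<in>B. \<Sum>i\<in>I. c i * representation B (f i b) b)"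
  proof (rule sum.cong[OF refl])
    fix b assume "b \<in> B"
    then have b: "b \<in> V" using B span_base by blast
    show "representation B (\<Sum>i\<in>I. c i *s f i b) b = (\<Sum>i\<in>I. c i * representation B (f i b) b)"
      using in_V b sV by (subst lin_on_sum[OF rep sV])
        (auto intro: subspace_scale simp: lin_on_scale[OF rep])
  qed
  also have "\<dots> = (\<Sum>i\<in>I. c i * (\<Sum>b\<in>B. representation B (f i b) b))"
    by (subst sum.swap) (simp add: sum_distrib_left)
  also have "\<dots> = (\<Sum>i\<in>I. c i * trace_on scale V (f i))"
    using f by (intro sum.cong) (auto simp: trace_on_basis[OF B])
  finally show ?thesis .
qed

lemma trace_scale:
  assumes "fin_dim V" "lin_on scale scale V f" "f ` V \<subseteq> V"
  shows "trace_on scale V (\<lambda>x. c *s f x) = c * trace_on scale V f"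
  using trace_sum[OF assms(1), of "{()}" "\<lambda>_. f" "\<lambda>_. c"] assms by simp

lemma trace_add:
  assumes "fin_dim V" "lin_on scale scale V f" "f ` V \<subseteq> V" "lin_on scale scale V g" "g ` V \<subseteq> V"
  shows "trace_on scale V (\<lambda>x. f x + g x) = trace_on scale V f + trace_on scale V g"
  using trace_sum[OF assms(1), of "{True, False}" "\<lambda>b. if b then f else g" "\<lambda>_. 1"] assms by simp

lemma trace_id:
  assumes V: "fin_dim V" shows "trace_on scale V (\<lambda>x. x) = of_nat (dim V)"
proof -
  obtain B where B: "finite B" "independent B" "span B = V" "card B = dim V"
    by (rule fin_dim_basis[OF V])
  have "trace_on scale V (\<lambda>x. x) = (\<Sum>b\<in>B. representation B b b)"
    by (rule trace_on_basis[OF B(1-3)]) (auto simp: lin_on_def)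
  also have "\<dots> = of_nat (dim V)" using B by (simp add: representation_basis)
  finally show ?thesis .
qed

lemma trace_rank_one:
  assumes V: "fin_dim V" and \<phi>: "lin_on scale (*) V \<phi>" and v: "v \<in> V"
  shows "trace_on scale V (\<lambda>x. \<phi> x *s v) = \<phi> v"
proof -
  obtain B where B: "finite B" "independent B" "span B = V"
    by (rule fin_dim_basis[OF V])
  have sV: "subspace V" by (rule fin_dim_subspace[OF V])
  have in_V: "b \<in> V" if "b \<in> B" for b using B span_base that by blast
  have "trace_on scale V (\<lambda>x. \<phi> x *s v) = (\<Sum>b\<in>B. representation B (\<phi> b *s v) b)"
    using \<phi> v sV by (intro trace_on_basis[OF B])
      (auto simp: lin_on_def scale_left_distrib subspace_scale)
  also have "\<dots> = (\<Sum>b\<in>B. \<phi> (representation B v b *s b))"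
    using B v in_V by (intro sum.cong)
      (auto simp: representation_scale lin_on_scale[OF \<phi>] mult.commute)
  also have "\<dots> = \<phi> (\<Sum>b\<in>B. representation B v b *s b)"
    using in_V sV by (intro lin_on_sum[OF \<phi> sV, symmetric]) (auto intro: subspace_scale)
  also have "\<dots> = \<phi> v"
    using B v by (subst sum_representation_eq) auto
  finally show ?thesis .
qed

lemma fin_dim_image:
  assumes V: "fin_dim V" and f: "lin_on scale scale V f" "f ` V \<subseteq> V"
  shows "fin_dim (f ` V)"
proof (rule fin_dim_sub[OF V _ f(2)])
  note sV = fin_dim_subspace[OF V]
  show "subspace (f ` V)"
  proof (rule subspaceI)
    show "0 \<in> f ` V" using lin_on_zero[OF f(1) subspace_0[OF sV]] subspace_0[OF sV] by force
    show "x + y \<in> f ` V" if "x \<in> f ` V" "y \<in> f ` V" for x y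
      using that lin_on_add[OF f(1)] subspace_add[OF sV] by force
    show "c *s x \<in> f ` V" if "x \<in> f ` V" for c x
      using that
      by (auto simp: lin_on_scale[OF f(1), symmetric] intro!: imageI subspace_scale[OF sV])
  qed
qed

text \<open>An idempotent factors through its image, where it is the identity.\<close>

lemma trace_idempotent:
  assumes V: "fin_dim V" and P: "lin_on scale scale V P" "P ` V \<subseteq> V"
    and idem: "\<And>x. x \<in> V \<Longrightarrow> P (P x) = P x"
  shows "trace_on scale V P = of_nat (dim (P ` V))"
proof -
  have W: "fin_dim (P ` V)" by (rule fin_dim_image[OF V P])
  have id: "lin_on scale scale (P ` V) (\<lambda>x. x)" by (simp add: lin_on_def)
  have "trace_on scale V P = trace_on scale (P ` V) P"
    using trace_commute[OF V W P(1) order_refl id] P(2) by simp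
  also have "\<dots> = trace_on scale (P ` V) (\<lambda>x. x)"
    using idem P(2) by (intro trace_cong[OF W lin_on_subset[OF P(1)]]) auto
  also have "\<dots> = of_nat (dim (P ` V))" by (rule trace_id[OF W])
  finally show ?thesis .
qed

end

text \<open>
  The map \<open>A\<close> is an involution on the image of the idempotent \<open>B\<close>. Half the sum of \<open>A\<close> and \<open>B\<close> is
  the projection to the fixed space of \<open>A\<close>, so the trace of \<open>A\<close> is twice a rank minus a rank.
\<close>

lemma trace_involution:
  fixes scale :: "'k::field_char_0 \<Rightarrow> 'a::ab_group_add \<Rightarrow> 'a"
  assumes vs: "vector_space scale" and V: "vspace.fin_dim scale V"
    and A: "lin_on scale scale V A" "A ` V \<subseteq> V" and B: "lin_on scale scale V B" "B ` V \<subseteq> V"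
    and AA: "\<And>x. x \<in> V \<Longrightarrow> A (A x) = B x" and AB: "\<And>x. x \<in> V \<Longrightarrow> A (B x) = A x"
    and BA: "\<And>x. x \<in> V \<Longrightarrow> B (A x) = A x" and BB: "\<And>x. x \<in> V \<Longrightarrow> B (B x) = B x"
  defines "P \<equiv> \<lambda>x. scale (1/2) (A x + B x)"
  shows "lin_on scale scale V P" "P ` V \<subseteq> V" "\<And>x. x \<in> V \<Longrightarrow> P (P x) = P x"
    and "trace_on scale V A =
      of_int (2 * int (vector_space.dim scale (P ` V)) - int (vector_space.dim scale (B ` V)))"
proof -
  interpret vspace scale using vs by (rule vspace.intro)
  note sV = fin_dim_subspace[OF V]
  have in_V: "A x \<in> V" "B x \<in> V" if "x \<in> V" for x using A B that by auto
  have lAB: "lin_on scale scale V (\<lambda>x. A x + B x)"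
    by (rule lin_onI)
      (simp_all add: lin_on_add[OF A(1)] lin_on_add[OF B(1)] lin_on_scale[OF A(1)]
        lin_on_scale[OF B(1)] scale_right_distrib ac_simps)
  show lP: "lin_on scale scale V P"
    unfolding P_def
    by (rule lin_onI)
      (simp_all only: lin_on_add[OF lAB] lin_on_scale[OF lAB] scale_right_distrib scale_left_commute)
  show PV: "P ` V \<subseteq> V"
    unfolding P_def using in_V sV by (auto intro: subspace_add subspace_scale)
  show PP: "P (P x) = P x" if x: "x \<in> V" for x
  proof -
    have AB_V: "A x + B x \<in> V" using in_V[OF x] sV by (simp add: subspace_add)
    have "A (P x) + B (P x) = scale (1/2) (A (A x + B x) + B (A x + B x))"
      unfolding P_def lin_on_scale[OF A(1) AB_V] lin_on_scale[OF B(1) AB_V]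
      by (rule scale_right_distrib[symmetric])
    also have "A (A x + B x) + B (A x + B x) = (A x + B x) + (A x + B x)"
      using in_V[OF x] x
      by (simp add: lin_on_add[OF A(1)] lin_on_add[OF B(1)] AA AB BA BB algebra_simps)
    also have "scale (1/2) \<dots> = A x + B x"
      by (subst scale_right_distrib) (simp flip: scale_left_distrib)
    finally show ?thesis by (simp add: P_def)
  qed
  have "of_nat (dim (P ` V)) = trace_on scale V P"
    by (rule trace_idempotent[OF V lP PV PP, symmetric])
  also have "\<dots> = (1/2) * (trace_on scale V (\<lambda>x. A x + B x))"
    unfolding P_def by (rule trace_scale[OF V lAB]) (use in_V sV in \<open>auto intro: subspace_add\<close>)
  also have "\<dots> = (1/2) * (trace_on scale V A + of_nat (dim (B ` V)))"
    using trace_add[OF V A B] trace_idempotent[OF V B BB] by simp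
  finally have "trace_on scale V A = 2 * of_nat (dim (P ` V)) - of_nat (dim (B ` V))"
    by (simp add: field_simps)
  then show "trace_on scale V A = of_int (2 * int (dim (P ` V)) - int (dim (B ` V)))"
    by simp
qed

text \<open>
  Among the nonzero polynomials \<open>p\<close> with \<open>p(f) v = 0\<close> for some \<open>v \<noteq> 0\<close>, one of
  least degree is linear.
\<close>

lemma eigenvector_exists:
  fixes scale :: "'k::alg_closed_field \<Rightarrow> 'a::ab_group_add \<Rightarrow> 'a"
  assumes vs: "vector_space scale" and V: "vspace.fin_dim scale V" "V \<noteq> {0}"
    and f: "lin_on scale scale V f" "f ` V \<subseteq> V"
  shows "\<exists>v\<in>V. \<exists>c. v \<noteq> 0 \<and> f v = scale c v"
proof -
  interpret vspace scale using vs by (rule vspace.intro)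
  note sV = fin_dim_subspace[OF V(1)]
  obtain B where B: "finite B" "independent B" "span B = V" "card B = dim V"
    by (rule fin_dim_basis[OF V(1)])
  obtain v where v: "v \<in> V" "v \<noteq> 0" using V sV subspace_0 by blast
  have it: "(f ^^ i) x \<in> V" if "x \<in> V" for i x using that f by (induction i) auto
  define act where "act p x = (\<Sum>i\<le>degree p. scale (coeff p i) ((f ^^ i) x))" for p x
  have act_V: "act p x \<in> V" if "x \<in> V" for p x
    unfolding act_def using it that sV by (intro subspace_sum subspace_scale) auto
  have act_ge: "act p x = (\<Sum>i\<le>n. scale (coeff p i) ((f ^^ i) x))" if "degree p \<le> n" for p x n
    unfolding act_def using that by (intro sum.mono_neutral_left) (auto simp: coeff_eq_0)
  have act_linear: "act ([:-a, 1:] * q) x = f (act q x) - scale a (act q x)" if x: "x \<in> V" for a q x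
  proof -
    let ?n = "degree q"
    have "act ([:-a, 1:] * q) x =
        (\<Sum>i\<le>Suc ?n. scale (coeff ([:-a, 1:] * q) i) ((f ^^ i) x))"
    proof (rule act_ge)
      have "degree ([:-a, 1:] * q) \<le> degree [:-a, 1:] + degree q" by (rule degree_mult_le)
      also have "\<dots> = Suc (degree q)" by simp
      finally show "degree ([:-a, 1:] * q) \<le> Suc (degree q)" .
    qed
    also have "\<dots> = (\<Sum>i\<le>Suc ?n. scale (coeff (pCons 0 q) i) ((f ^^ i) x)) -
        (\<Sum>i\<le>Suc ?n. scale (a * coeff q i) ((f ^^ i) x))"
      by (simp add: sum_subtractf[symmetric] scale_left_diff_distrib[symmetric] del: sum.atMost_Suc)
    also have "(\<Sum>i\<le>Suc ?n. scale (coeff (pCons 0 q) i) ((f ^^ i) x)) =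
        (\<Sum>i\<le>?n. scale (coeff q i) ((f ^^ Suc i) x))"
      by (subst sum.atMost_Suc_shift) simp
    also have "\<dots> = f (act q x)"
      unfolding act_def using it[OF x] sV
      by (subst lin_on_sum[OF f(1) sV]) (auto intro: subspace_scale simp: lin_on_scale[OF f(1)])
    also have "(\<Sum>i\<le>Suc ?n. scale (a * coeff q i) ((f ^^ i) x)) = scale a (act q x)"
      by (simp add: act_def coeff_eq_0 scale_sum_right)
    finally show ?thesis .
  qed
  (* the polynomials that annihilate some nonzero vector; a root of a least one splits off *)
  define Q where "Q p \<longleftrightarrow> p \<noteq> 0 \<and> (\<exists>x\<in>V. x \<noteq> 0 \<and> act p x = 0)" for p
  (* one more power of f than the dimension: the orbit of v repeats or is dependent *)
  have "\<exists>p. Q p"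
  proof (cases "inj_on (\<lambda>i. (f ^^ i) v) {..card B}")
    case True
    let ?S = "(\<lambda>i. (f ^^ i) v) ` {..card B}"
    have "dependent ?S"
    proof (rule ccontr)
      assume "\<not> dependent ?S"
      then have "card ?S \<le> card B" using independent_span_bound[of B ?S] B it[OF v(1)] by auto
      then show False using True by (simp add: card_image)
    qed
    then obtain u where u: "(\<Sum>x\<in>?S. scale (u x) x) = 0" "\<exists>x\<in>?S. u x \<noteq> 0"
      using dependent_finite[of ?S] by auto
    define p where "p = Poly (map (\<lambda>i. u ((f ^^ i) v)) [0..<Suc (card B)])"
    have coeff: "coeff p i = (if i \<le> card B then u ((f ^^ i) v) else 0)" for i
      by (auto simp: p_def nth_default_def simp del: upt_Suc)
    have "degree p \<le> card B" by (rule degree_le) (simp add: coeff)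
    then have "act p v = (\<Sum>i\<le>card B. scale (u ((f ^^ i) v)) ((f ^^ i) v))"
      by (subst act_ge[of p "card B"]) (auto simp: coeff)
    also have "\<dots> = 0" using u(1) by (simp add: sum.reindex[OF True])
    finally have "act p v = 0" .
    moreover have "p \<noteq> 0"
    proof -
      obtain i where "i \<le> card B" "u ((f ^^ i) v) \<noteq> 0" using u(2) by auto
      then have "coeff p i \<noteq> 0" by (simp add: coeff)
      then show ?thesis by auto
    qed
    ultimately show ?thesis using v by (auto simp: Q_def)
  next
    case False
    then obtain i j where ij: "i < j" "(f ^^ i) v = (f ^^ j) v"
      by (auto simp: inj_on_def) (metis linorder_neqE_nat)
    define p where "p = monom 1 j - (monom 1 i :: 'k poly)"
    have "degree p \<le> j" using ij unfolding p_def by (intro degree_diff_le) (auto intro: order.trans[OF degree_monom_le])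
    then have "act p v = (\<Sum>k\<le>j. scale (coeff p k) ((f ^^ k) v))" by (rule act_ge)
    also have "\<dots> = (\<Sum>k\<le>j. (if k = j then (f ^^ j) v else 0) - (if k = i then (f ^^ i) v else 0))"
      using ij by (intro sum.cong) (auto simp: p_def)
    also have "\<dots> = 0" using ij by (simp add: sum_subtractf)
    finally have "act p v = 0" .
    moreover have "coeff p j = 1" using ij by (simp add: p_def)
    then have "p \<noteq> 0" by auto
    ultimately show ?thesis using v by (auto simp: Q_def)
  qed
  then obtain p where p: "Q p" and min: "\<And>q. degree q < degree p \<Longrightarrow> \<not> Q q"
    using exists_least_iff[of "\<lambda>d. \<exists>p. Q p \<and> degree p = d"] by auto
  obtain x where x: "x \<in> V" "x \<noteq> 0" "act p x = 0" and p0: "p \<noteq> 0" using p by (auto simp: Q_def)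
  have "degree p > 0"
  proof (rule ccontr)
    assume "\<not> degree p > 0"
    then obtain c where c: "p = [:c:]" by (metis degree_eq_zeroE gr0I)
    then have "scale c x = 0" using x by (simp add: act_def)
    then show False using c p0 x by simp
  qed
  then obtain a where "poly p a = 0" using alg_closed_imp_poly_has_root by blast
  then obtain q where q: "p = [:-a, 1:] * q" using poly_eq_0_iff_dvd dvdE by blast
  have q0: "q \<noteq> 0" using p0 q by auto
  have "degree p = Suc (degree q)"
    unfolding q using q0 by (subst degree_mult_eq) auto
  then have "\<not> Q q" by (intro min) simp
  then have "act q x \<noteq> 0" using q0 x by (auto simp: Q_def)
  moreover have "f (act q x) = scale a (act q x)"
    using act_linear[OF x(1), of a q] x q by simp
  ultimately show ?thesis using act_V[OF x(1)] by blast
qed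

text \<open>
  If \<open>K\<close> is a positive diagonal matrix over the rationals and \<open>M\<^sup>T K M t = 0\<close> for a rational vector
  \<open>t\<close>, then \<open>(M t)\<^sup>T K (M t) = 0\<close> and hence \<open>M t = 0\<close>. The same holds for vectors over a field of
  characteristic \<open>0\<close>, which need not carry an order: apply a \<open>\<rat>\<close>-linear functional of the field
  to all entries.
\<close>

lemma rational_gram_kernel:
  fixes t :: "'w \<Rightarrow> 'k::field_char_0" and m :: "'i \<Rightarrow> 'w \<Rightarrow> int" and \<kappa> :: "'i \<Rightarrow> rat"
  assumes I: "finite I" and \<Omega>: "finite \<Omega>" and pos: "\<And>i. i \<in> I \<Longrightarrow> \<kappa> i > 0"
    and v: "\<And>i. i \<in> I \<Longrightarrow> v i = (\<Sum>\<omega>\<in>\<Omega>. of_int (m i \<omega>) * t \<omega>)"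
    and gram: "\<And>\<omega>. \<omega> \<in> \<Omega> \<Longrightarrow> (\<Sum>i\<in>I. of_rat (\<kappa> i) * of_int (m i \<omega>) * v i) = 0"
    and j: "j \<in> I"
  shows "v j = 0"
proof (rule ccontr)
  assume ne: "v j \<noteq> 0"
  let ?s = "\<lambda>(q::rat) (x::'k). of_rat q * x"
  interpret Q: vector_space ?s
    by unfold_locales (simp_all add: algebra_simps of_rat_add of_rat_mult)
  interpret Q1: vector_space "(*) :: rat \<Rightarrow> rat \<Rightarrow> rat"
    by unfold_locales (simp_all add: algebra_simps)
  interpret QQ: vector_space_pair ?s "(*) :: rat \<Rightarrow> rat \<Rightarrow> rat" ..
  have "Q.independent {v j}" using ne by simp
  then obtain \<psi> where lin: "Vector_Spaces.linear ?s (*) \<psi>" and one: "\<psi> (v j) = (1::rat)"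
    using QQ.linear_independent_extend[of "{v j}" "\<lambda>_. 1"] by auto
  interpret \<psi>: Vector_Spaces.linear ?s "(*) :: rat \<Rightarrow> rat \<Rightarrow> rat" \<psi> by (rule lin)
  have \<psi>q: "\<psi> (of_rat q * x) = q * \<psi> x" for q x
    by (rule \<psi>.scale)
  have \<psi>i: "\<psi> (of_int z * x) = of_int z * \<psi> x" for z x
    using \<psi>q[of "of_int z" x] by simp
  have rel: "(\<Sum>i\<in>I. \<kappa> i * of_int (m i \<omega>) * \<psi> (v i)) = 0" if "\<omega> \<in> \<Omega>" for \<omega>
  proof -
    have "(\<Sum>i\<in>I. \<kappa> i * of_int (m i \<omega>) * \<psi> (v i)) = \<psi> (\<Sum>i\<in>I. of_rat (\<kappa> i) * of_int (m i \<omega>) * v i)"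
      unfolding \<psi>.sum mult.assoc \<psi>q \<psi>i ..
    then show ?thesis using gram[OF that] by simp
  qed
  have "(\<Sum>i\<in>I. \<kappa> i * (\<psi> (v i))\<^sup>2) = (\<Sum>i\<in>I. \<kappa> i * \<psi> (v i) * (\<Sum>\<omega>\<in>\<Omega>. of_int (m i \<omega>) * \<psi> (t \<omega>)))"
  proof (rule sum.cong[OF refl])
    fix i assume "i \<in> I"
    have "\<psi> (v i) = (\<Sum>\<omega>\<in>\<Omega>. of_int (m i \<omega>) * \<psi> (t \<omega>))"
      unfolding v[OF \<open>i \<in> I\<close>] \<psi>.sum \<psi>i ..
    then show "\<kappa> i * (\<psi> (v i))\<^sup>2 = \<kappa> i * \<psi> (v i) * (\<Sum>\<omega>\<in>\<Omega>. of_int (m i \<omega>) * \<psi> (t \<omega>))"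
      by (simp add: power2_eq_square)
  qed
  also have "\<dots> = (\<Sum>\<omega>\<in>\<Omega>. \<psi> (t \<omega>) * (\<Sum>i\<in>I. \<kappa> i * of_int (m i \<omega>) * \<psi> (v i)))"
    unfolding sum_distrib_left by (subst sum.swap) (intro sum.cong refl, simp only: mult_ac)
  also have "\<dots> = 0" by (simp add: rel)
  finally have "(\<Sum>i\<in>I. \<kappa> i * (\<psi> (v i))\<^sup>2) = 0" .
  then have "\<kappa> j * (\<psi> (v j))\<^sup>2 = 0"
    using sum_nonneg_eq_0_iff[OF I, of "\<lambda>i. \<kappa> i * (\<psi> (v i))\<^sup>2"] pos j by (auto simp: less_imp_le)
  then show False using pos[OF j] one by simp
qed

section \<open>Semisimple algebras\<close>

text \<open>
  Rules that prove linearity of a term in one variable by following its structure; identities in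
  Sweedler notation are justified by multilinearity throughout.
\<close>

named_theorems lin_intros

lemma lin_id [lin_intros]: "lin s s (\<lambda>x. x)"
  by (simp add: lin_on_def)

lemma lin_field_mult_left [lin_intros]:
  fixes f :: "'a::ab_group_add \<Rightarrow> 'k::comm_ring_1"
  shows "lin s (*) f \<Longrightarrow> lin s (*) (\<lambda>x. c * f x)"
  by (simp add: lin_on_def algebra_simps)

lemma lin_field_mult_right [lin_intros]:
  fixes f :: "'a::ab_group_add \<Rightarrow> 'k::comm_ring_1"
  shows "lin s (*) f \<Longrightarrow> lin s (*) (\<lambda>x. f x * c)"
  by (simp add: lin_on_def algebra_simps)

lemma lin_comp: "lin s2 s3 g \<Longrightarrow> lin s1 s2 f \<Longrightarrow> lin s1 s3 (\<lambda>x. g (f x))"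
  by (simp add: lin_on_def)

locale k_algebra = vspace scale
  for scale :: "'k::field \<Rightarrow> 'h::ring_1 \<Rightarrow> 'h" +
  assumes scale_mult_l: "scale c x * y = scale c (x * y)"
    and scale_mult_r: "x * scale c y = scale c (x * y)"
begin

lemma lin_mult_left [lin_intros]: "lin s scale f \<Longrightarrow> lin s scale (\<lambda>x. c * f x)"
  by (simp add: lin_on_def algebra_simps scale_mult_r)

lemma lin_mult_right [lin_intros]: "lin s scale f \<Longrightarrow> lin s scale (\<lambda>x. f x * c)"
  by (simp add: lin_on_def algebra_simps scale_mult_l)

lemma lin_scale_right [lin_intros]: "lin s scale f \<Longrightarrow> lin s scale (\<lambda>x. scale c (f x))"
  by (simp add: lin_on_def scale_right_distrib mult.commute)

lemma lin_scale_left [lin_intros]: "lin s (*) f \<Longrightarrow> lin s scale (\<lambda>x. scale (f x) v)"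
  by (simp add: lin_on_def scale_left_distrib)

definition left_ideal :: "'h set \<Rightarrow> bool" where
  "left_ideal L \<longleftrightarrow> subspace L \<and> (\<forall>h. \<forall>x\<in>L. h * x \<in> L)"

lemma left_idealI:
  assumes "0 \<in> L" "\<And>x y. x \<in> L \<Longrightarrow> y \<in> L \<Longrightarrow> x + y \<in> L" "\<And>h x. x \<in> L \<Longrightarrow> h * x \<in> L"
  shows "left_ideal L"
proof -
  have "scale c x \<in> L" if "x \<in> L" for c x
    using assms(3)[OF that, of "scale c 1"] by (simp add: scale_mult_l)
  then show ?thesis using assms by (auto simp: left_ideal_def intro: subspaceI)
qed

lemma algebra_module_left_ideal: "left_ideal L \<Longrightarrow> algebra_module scale scale L (*)"
  using vector_space_axioms
  by (auto simp: algebra_module_def left_ideal_def algebra_simps scale_mult_l scale_mult_r)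

end

locale semisimple_alg = k_algebra scale
  for scale :: "'k::field_char_0 \<Rightarrow> 'h::ring_1 \<Rightarrow> 'h" +
  assumes fin: "fin_dim UNIV" and semisimple: "semisimple_algebra scale"
begin

abbreviation Tr :: "('h \<Rightarrow> 'h) \<Rightarrow> 'k" where "Tr \<equiv> trace_on scale UNIV"

lemma Tr_commute: "lin scale scale f \<Longrightarrow> lin scale scale g \<Longrightarrow> Tr (\<lambda>x. g (f x)) = Tr (\<lambda>x. f (g x))"
  by (rule trace_commute[OF fin fin]) auto

lemma Tr_sum:
  "(\<And>i. i \<in> I \<Longrightarrow> lin scale scale (f i)) \<Longrightarrow>
    Tr (\<lambda>x. \<Sum>i\<in>I. scale (c i) (f i x)) = (\<Sum>i\<in>I. c i * Tr (f i))"
  by (rule trace_sum[OF fin]) auto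

lemma Tr_add: "lin scale scale f \<Longrightarrow> lin scale scale g \<Longrightarrow> Tr (\<lambda>x. f x + g x) = Tr f + Tr g"
  by (rule trace_add[OF fin]) auto

lemma Tr_scale: "lin scale scale f \<Longrightarrow> Tr (\<lambda>x. scale c (f x)) = c * Tr f"
  by (rule trace_scale[OF fin]) auto

lemma Tr_rank_one: "lin scale (*) \<phi> \<Longrightarrow> Tr (\<lambda>x. scale (\<phi> x) v) = \<phi> v"
  by (rule trace_rank_one[OF fin]) auto

lemma lin_Tr:
  assumes f: "\<And>h. lin scale scale (f h)" and l: "\<And>x. lin scale scale (\<lambda>h. f h x)"
  shows "lin scale (*) (\<lambda>h. Tr (f h))"
proof (rule lin_onI)
  fix x y
  have "f (x + y) = (\<lambda>z. f x z + f y z)" using lin_on_add[OF l] by auto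
  then show "Tr (f (x + y)) = Tr (f x) + Tr (f y)" using Tr_add[OF f f] by simp
next
  fix c x
  have "f (scale c x) = (\<lambda>z. scale c (f x z))" using lin_on_scale[OF l] by auto
  then show "Tr (f (scale c x)) = c * Tr (f x)" using Tr_scale[OF f] by simp
qed

lemma finite_basis:
  obtains B where "finite B" "independent B" "span B = UNIV" "card B = dim UNIV"
  by (rule fin_dim_basis[OF fin])

lemma linear_conv: "lin scale scale f \<Longrightarrow> Vector_Spaces.linear scale scale f"
  using vector_space_axioms by (simp add: Vector_Spaces.linear_iff lin_on_def)

lemma injective_imp_surjective:
  assumes "lin scale scale f" "\<And>x. f x = 0 \<Longrightarrow> x = 0"
  shows "surj f"
proof -
  obtain B where B: "finite B" "independent B" "span B = UNIV" by (rule finite_basis)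
  interpret F: finite_dimensional_vector_space scale B
    using B by unfold_locales auto
  have "inj f" using linear_conv[OF assms(1)] assms
    by (intro injI) (metis eq_iff_diff_eq_0 UNIV_I lin_on_diff)
  then show ?thesis by (rule F.linear_inj_imp_surj[OF linear_conv[OF assms(1)]])
qed

lemma surjective_imp_injective:
  assumes "lin scale scale f" "surj f" shows "inj f"
proof -
  obtain B where B: "finite B" "independent B" "span B = UNIV" by (rule finite_basis)
  interpret F: finite_dimensional_vector_space scale B
    using B by unfold_locales auto
  show ?thesis by (rule F.linear_surj_imp_inj[OF linear_conv[OF assms(1)] assms(2)])
qed

text \<open>The map sending \<open>c\<close> to the functional \<open>h \<mapsto> \<tau>(h c)\<close> is injective, hence surjective by dimension.\<close>

lemma functional_representable:
  assumes \<tau>: "lin scale (*) \<tau>" and nondeg: "\<And>c. (\<And>h. \<tau> (h * c) = 0) \<Longrightarrow> c = 0"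
    and f: "lin scale (*) f"
  shows "\<exists>c. \<forall>h. f h = \<tau> (h * c)"
proof -
  obtain B where B: "finite B" "independent B" "span B = UNIV" by (rule finite_basis)
  have eqI: "g h = g' h" if g: "lin scale (*) g" "lin scale (*) g'" and eq: "\<And>b. b \<in> B \<Longrightarrow> g b = g' b"
    for g g' h
  proof -
    have h: "h = (\<Sum>b\<in>B. scale (representation B h b) b)"
      using B by (subst sum_representation_eq) auto
    have "g h = (\<Sum>b\<in>B. representation B h b * g b)"
      by (subst h, subst lin_sum[OF g(1)]) (simp add: lin_on_scale[OF g(1)])
    also have "\<dots> = (\<Sum>b\<in>B. representation B h b * g' b)" using eq by simp
    also have "\<dots> = g' h"
      by (subst (2) h, subst lin_sum[OF g(2)]) (simp add: lin_on_scale[OF g(2)])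
    finally show ?thesis .
  qed
  have lin_\<tau>: "lin scale (*) (\<lambda>c. \<tau> (h * c))" "lin scale (*) (\<lambda>h. \<tau> (h * c))" for h c
    by (auto intro!: lin_comp[OF \<tau>] lin_intros)
  define M where "M c = (\<Sum>b\<in>B. scale (\<tau> (b * c)) b)" for c
  have "surj M"
  proof (rule injective_imp_surjective)
    show "lin scale scale M"
      unfolding M_def
      by (intro lin_onI) (simp_all add: lin_on_add[OF lin_\<tau>(1)] lin_on_scale[OF lin_\<tau>(1)]
          scale_left_distrib sum.distrib scale_sum_right)
    show "c = 0" if "M c = 0" for c
    proof (rule nondeg)
      have "\<tau> (b * c) = 0" if "b \<in> B" for b
        using independentD[OF B(2,1) subset_refl, of "\<lambda>b. \<tau> (b * c)" b] \<open>M c = 0\<close> that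
        by (simp add: M_def)
      then show "\<tau> (h * c) = 0" for h
        using eqI[OF lin_\<tau>(2), of "\<lambda>_. 0"] by (simp add: lin_on_def)
    qed
  qed
  then obtain c where "(\<Sum>b\<in>B. scale (f b) b) = M c" by (metis surjD)
  then have sum0: "(\<Sum>b\<in>B. scale (f b - \<tau> (b * c)) b) = 0"
    by (simp add: M_def scale_left_diff_distrib sum_subtractf)
  have "f b = \<tau> (b * c)" if "b \<in> B" for b
    using independentD[OF B(2,1) subset_refl sum0 that] by simp
  then have "f h = \<tau> (h * c)" for h by (rule eqI[OF f lin_\<tau>(2)])
  then show ?thesis by blast
qed

text \<open>The component of \<open>1\<close> in a left ideal, along a complement, is a right identity.\<close>

lemma left_ideal_right_identity:
  assumes L: "left_ideal L" shows "\<exists>l\<in>L. \<forall>x\<in>L. x * l = x"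
proof -
  have "submodule scale (*) L UNIV" using L by (simp add: submodule_def left_ideal_def)
  then obtain L' where L': "submodule scale (*) L' UNIV" "L \<inter> L' = {0}"
    and "{w + w' | w w'. w \<in> L \<and> w' \<in> L'} = UNIV"
    using semisimple unfolding semisimple_algebra_def semisimple_module_def by meson
  then obtain l l' where l: "l \<in> L" "l' \<in> L'" "1 = l + l'" by blast
  have "x * l = x" if x: "x \<in> L" for x
  proof -
    have eq: "x - x * l = x * l'" using l(3) by (metis add_diff_cancel_left' mult_1_right distrib_left)
    have "x - x * l \<in> L" using L x l by (auto simp: left_ideal_def intro: subspace_diff)
    moreover have "x * l' \<in> L'" using L' l by (auto simp: submodule_def)
    ultimately have "x - x * l = 0" using L'(2) eq by auto
    then show ?thesis by simp
  qed
  then show ?thesis using l by blast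
qed

text \<open>
  A right identity \<open>l\<close> of a two-sided ideal \<open>I\<close> is also a left identity: the elements
  \<open>x - l x\<close> lie in the left ideal of those \<open>y \<in> I\<close> with \<open>I y = 0\<close>. The right identity \<open>n\<close> of
  that left ideal lies in it, so that \<open>y = y n = 0\<close>.
\<close>

lemma ideal_central_identity:
  assumes I: "left_ideal I" and right: "\<And>x h. x \<in> I \<Longrightarrow> x * h \<in> I"
  shows "\<exists>l\<in>I. (\<forall>h. l * h = h * l) \<and> (\<forall>x\<in>I. l * x = x \<and> x * l = x)"
proof -
  obtain l where l: "l \<in> I" "\<And>x. x \<in> I \<Longrightarrow> x * l = x" using left_ideal_right_identity[OF I] by blast
  define N where "N = {y\<in>I. \<forall>x\<in>I. x * y = 0}"
  have sub: "subspace I" and mult: "\<And>h x. x \<in> I \<Longrightarrow> h * x \<in> I"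
    using I by (auto simp: left_ideal_def)
  have "left_ideal N"
    using sub mult right
    by (intro left_idealI) (auto simp: N_def distrib_left mult.assoc[symmetric] intro: subspace_0 subspace_add)
  then obtain n where n: "n \<in> N" "\<And>y. y \<in> N \<Longrightarrow> y * n = y"
    using left_ideal_right_identity by blast
  have N0: "y = 0" if "y \<in> N" for y using n that by (force simp: N_def)
  have left: "l * x = x" if x: "x \<in> I" for x
  proof -
    have "x - l * x \<in> N"
      using x sub mult l
      by (auto simp: N_def right_diff_distrib mult.assoc[symmetric] intro: subspace_diff)
    then show ?thesis using N0 by force
  qed
  have "l * h = h * l" for h
    using left[OF mult[OF l(1), of h]] l(2)[OF right[OF l(1), of h]] by (simp add: mult.assoc)
  then show ?thesis using l left by blast
qed

definition chi_reg :: "'h \<Rightarrow> 'k" where "chi_reg h = Tr (\<lambda>x. h * x)"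

lemma lin_chi_reg: "lin scale (*) chi_reg"
  unfolding chi_reg_def by (intro lin_Tr lin_intros)

lemma chi_reg_commute: "chi_reg (a * b) = chi_reg (b * a)"
proof -
  have "Tr (\<lambda>x. a * (b * x)) = Tr (\<lambda>x. b * (a * x))" by (rule Tr_commute) (intro lin_intros)+
  then show ?thesis by (simp add: chi_reg_def mult.assoc)
qed

lemma chi_reg_idempotent:
  assumes "e * e = e" shows "chi_reg e = of_nat (dim (range ((*) e)))"
  unfolding chi_reg_def using assms
  by (subst trace_idempotent[OF fin]) (auto simp: mult.assoc[symmetric] intro: lin_intros)

lemma dim_idempotent_pos:
  assumes "e * e = e" "e \<noteq> 0" shows "0 < dim (range ((*) e))"
proof (rule ccontr)
  assume "\<not> 0 < dim (range ((*) e))"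
  moreover have "fin_dim (range ((*) e))" by (rule fin_dim_image[OF fin]) (auto intro: lin_intros)
  ultimately have "range ((*) e) = {0}" using fin_dim_dim_0 by blast
  then show False using assms by (metis rangeI singletonD)
qed

text \<open>
  The radical of the form is a left ideal, and its right identity is an idempotent of trace \<open>0\<close>,
  hence of rank \<open>0\<close> in characteristic \<open>0\<close>.
\<close>

lemma chi_reg_nondegenerate:
  assumes "\<And>h. chi_reg (h * c) = 0" shows "c = 0"
proof -
  define J where "J = {c. \<forall>h. chi_reg (h * c) = 0}"
  have "left_ideal J"
  proof (rule left_idealI)
    show "0 \<in> J" by (simp add: J_def lin_on_zero[OF lin_chi_reg])
    show "x + y \<in> J" if "x \<in> J" "y \<in> J" for x y
      using that by (simp add: J_def distrib_left lin_on_add[OF lin_chi_reg])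
    show "h * x \<in> J" if "x \<in> J" for h x using that by (simp add: J_def mult.assoc[symmetric])
  qed
  then obtain l where l: "l \<in> J" "\<And>x. x \<in> J \<Longrightarrow> x * l = x"
    using left_ideal_right_identity by blast
  have "chi_reg (1 * l) = 0" using l(1) unfolding J_def by blast
  then have "dim (range ((*) l)) = 0" using chi_reg_idempotent[of l] l by simp
  then have "l = 0" using dim_idempotent_pos[of l] l by fastforce
  moreover have "c \<in> J" using assms by (simp add: J_def)
  ultimately show ?thesis using l(2)[of c] by simp
qed

lemma minimal_left_ideal_exists:
  assumes "left_ideal L" "L \<noteq> {0}"
  shows "\<exists>M. left_ideal M \<and> M \<subseteq> L \<and> M \<noteq> {0} \<and>
    (\<forall>N. left_ideal N \<and> N \<subseteq> M \<longrightarrow> N = {0} \<or> N = M)"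
proof -
  let ?Q = "\<lambda>M. left_ideal M \<and> M \<subseteq> L \<and> M \<noteq> {0}"
  obtain M where M: "?Q M" and min: "\<And>N. ?Q N \<Longrightarrow> dim M \<le> dim N"
    using assms exists_least_iff[of "\<lambda>d. \<exists>M. ?Q M \<and> dim M = d"] by (metis linorder_not_less order_refl)
  have "N = {0} \<or> N = M" if N: "left_ideal N" "N \<subseteq> M" for N
  proof (cases "N = {0}")
    case False
    then have "dim M \<le> dim N" using N M by (intro min) auto
    moreover have "fin_dim M" using M by (intro fin_dim_sub[OF fin]) (auto simp: left_ideal_def)
    ultimately show ?thesis using N fin_dim_dim_eq[of M N] by (auto simp: left_ideal_def)
  qed simp
  then show ?thesis using M by blast
qed

end

lemma isomorphic_modules_common:
  assumes "isomorphic_modules s0 M \<mu> s1 V \<rho>" "isomorphic_modules s0 M \<mu> s2 W \<sigma>"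
    and closed: "\<And>x y. x \<in> M \<Longrightarrow> y \<in> M \<Longrightarrow> x + y \<in> M" "\<And>c x. x \<in> M \<Longrightarrow> s0 c x \<in> M" "\<And>h x. x \<in> M \<Longrightarrow> \<mu> h x \<in> M"
  shows "isomorphic_modules s1 V \<rho> s2 W \<sigma>"
proof -
  obtain f where f: "bij_betw f M V" "\<forall>v\<in>M. \<forall>w\<in>M. f (v + w) = f v + f w"
    "\<forall>c. \<forall>v\<in>M. f (s0 c v) = s1 c (f v)" "\<forall>h. \<forall>v\<in>M. f (\<mu> h v) = \<rho> h (f v)"
    using assms(1) unfolding isomorphic_modules_def by auto
  obtain g where g: "bij_betw g M W" "\<forall>v\<in>M. \<forall>w\<in>M. g (v + w) = g v + g w"
    "\<forall>c. \<forall>v\<in>M. g (s0 c v) = s2 c (g v)" "\<forall>h. \<forall>v\<in>M. g (\<mu> h v) = \<sigma> h (g v)"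
    using assms(2) unfolding isomorphic_modules_def by auto
  define k where "k = inv_into M f"
  have k: "k v \<in> M" "f (k v) = v" if "v \<in> V" for v
    using f(1) that unfolding k_def bij_betw_def by (metis inv_into_into, metis f_inv_into_f)
  have kf: "k (f x) = x" if "x \<in> M" for x
    using f(1) that unfolding k_def bij_betw_def by (metis inv_into_f_f)
  have "bij_betw k V M" unfolding k_def by (rule bij_betw_inv_into[OF f(1)])
  then have "bij_betw (\<lambda>v. g (k v)) V W" using bij_betw_trans[OF _ g(1)] by (simp add: comp_def)
  moreover have "g (k (v + w)) = g (k v) + g (k w)" if "v \<in> V" "w \<in> V" for v w
  proof -
    have "k (v + w) = k (f (k v + k w))" using that k f(2) by simp
    then show ?thesis using kf closed k that g by simp
  qed
  moreover have "g (k (s1 c v)) = s2 c (g (k v))" if "v \<in> V" for c v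
  proof -
    have "k (s1 c v) = k (f (s0 c (k v)))" using that k f(3) by simp
    then show ?thesis using kf closed k that g by simp
  qed
  moreover have "g (k (\<rho> h v)) = \<sigma> h (g (k v))" if "v \<in> V" for h v
  proof -
    have "k (\<rho> h v) = k (f (\<mu> h (k v)))" using that k f(4) by simp
    then show ?thesis using kf closed k that g by simp
  qed
  ultimately show ?thesis
    unfolding isomorphic_modules_def by (intro exI[of _ "\<lambda>v. g (k v)"] conjI ballI allI)
qed


section \<open>Simple modules, blocks and characters\<close>

locale simple_family = semisimple_alg scale
  for scale :: "'k::{alg_closed_field, field_char_0} \<Rightarrow> 'h::ring_1 \<Rightarrow> 'h" +
  fixes scaleV :: "'k \<Rightarrow> 'v::ab_group_add \<Rightarrow> 'v" and n :: nat
    and V :: "nat \<Rightarrow> 'v set" and \<rho> :: "nat \<Rightarrow> 'h \<Rightarrow> 'v \<Rightarrow> 'v"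
    and e :: "nat \<Rightarrow> 'h" and \<chi> :: "nat \<Rightarrow> 'h \<Rightarrow> 'k" and d :: "nat \<Rightarrow> nat"
  assumes simples: "complete_simple_modules scale scaleV n V \<rho>"
    and n_pos: "0 < n"
    and idempotents: "\<forall>i<n. central_primitive_idempotent (e i) \<and> (\<forall>v\<in>V i. \<rho> i (e i) v = v)"
    and characters: "\<forall>i<n. \<chi> i = module_character scaleV (V i) (\<rho> i)"
    and dimensions: "\<forall>i<n. d i = vector_space.dim scaleV (V i)"
begin

lemma simple_V: "i < n \<Longrightarrow> simple_module scale scaleV (V i) (\<rho> i)"
  using simples by (simp add: complete_simple_modules_def)

sublocale V: vspace scaleV
  using simple_V[OF n_pos] by (simp add: vspace_def simple_module_def algebra_module_def)

lemma
  assumes "i < n"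
  shows subspace_V: "V.subspace (V i)" and V_nonzero: "V i \<noteq> {0}"
    and \<rho>_closed: "\<And>h v. v \<in> V i \<Longrightarrow> \<rho> i h v \<in> V i"
    and lin_\<rho>: "\<And>h. lin_on scaleV scaleV (V i) (\<rho> i h)"
    and lin_\<rho>_left: "\<And>v. v \<in> V i \<Longrightarrow> lin scale scaleV (\<lambda>h. \<rho> i h v)"
    and \<rho>_one: "\<And>v. v \<in> V i \<Longrightarrow> \<rho> i 1 v = v"
    and \<rho>_mult: "\<And>h h' v. v \<in> V i \<Longrightarrow> \<rho> i (h * h') v = \<rho> i h (\<rho> i h' v)"
  using simple_V[OF assms] by (auto simp: simple_module_def algebra_module_def lin_on_def)

lemma V_irreducible:
  "i < n \<Longrightarrow> submodule scaleV (\<rho> i) W (V i) \<Longrightarrow> W = {0} \<or> W = V i"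
  using simple_V by (auto simp: simple_module_def)

lemma \<rho>_image: "i < n \<Longrightarrow> \<rho> i h ` V i \<subseteq> V i"
  using \<rho>_closed by auto

lemma \<rho>_sum: "i < n \<Longrightarrow> v \<in> V i \<Longrightarrow> \<rho> i (\<Sum>j\<in>A. g j) v = (\<Sum>j\<in>A. \<rho> i (g j) v)"
  using lin_sum[OF lin_\<rho>_left] by auto

lemma \<rho>_scale: "i < n \<Longrightarrow> v \<in> V i \<Longrightarrow> \<rho> i (scale c h) v = scaleV c (\<rho> i h v)"
  using lin_on_scale[OF lin_\<rho>_left] by auto

lemma \<rho>_zero: "i < n \<Longrightarrow> v \<in> V i \<Longrightarrow> \<rho> i 0 v = 0"
  using lin_on_zero[OF lin_\<rho>_left] by auto

lemma \<rho>_zero_right: "i < n \<Longrightarrow> \<rho> i h 0 = 0"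
  using lin_on_zero[OF lin_\<rho>] V.subspace_0[OF subspace_V] by auto

lemma obtain_nonzero:
  assumes "i < n" obtains v where "v \<in> V i" "v \<noteq> 0"
  using V_nonzero[OF assms] V.subspace_0[OF subspace_V[OF assms]] by blast

text \<open>
  The orbit maps \<open>h \<mapsto> h v\<close> present \<open>V\<^sub>i\<close> as a quotient of \<open>H\<close>; this bounds its dimension, and
  restricted to left ideals it is how simple left ideals are compared with the \<open>V\<^sub>i\<close>.
\<close>

lemma orbit_map:
  assumes "v \<in> V i" "i < n"
  shows "Vector_Spaces.linear scale scaleV (\<lambda>h. \<rho> i h v)"
  using lin_\<rho>_left[OF assms(2,1)] vector_space_axioms V.vector_space_axioms
  by (auto simp: Vector_Spaces.linear_iff lin_on_def)

lemma orbit_submodule: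
  assumes i: "i < n" and v: "v \<in> V i" and L: "left_ideal L"
  shows "submodule scaleV (\<rho> i) ((\<lambda>h. \<rho> i h v) ` L) (V i)"
proof -
  interpret m: Vector_Spaces.linear scale scaleV "\<lambda>h. \<rho> i h v" by (rule orbit_map[OF v i])
  have "V.subspace ((\<lambda>h. \<rho> i h v) ` L)"
    using L by (intro m.subspace_image) (auto simp: left_ideal_def)
  then show ?thesis
    using L \<rho>_closed[OF i v] by (auto simp: submodule_def left_ideal_def \<rho>_mult[OF i v, symmetric])
qed

lemma left_ideal_UNIV: "left_ideal UNIV"
  by (auto simp: left_ideal_def)

lemma orbit_eq:
  assumes i: "i < n" and v: "v \<in> V i" "v \<noteq> 0"
  shows "range (\<lambda>h. \<rho> i h v) = V i"
proof -
  have "v \<in> range (\<lambda>h. \<rho> i h v)" using \<rho>_one[OF i v(1)] by (metis rangeI)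
  then show ?thesis using V_irreducible[OF i orbit_submodule[OF i v(1) left_ideal_UNIV]] v by auto
qed

lemma fin_dim_V: assumes i: "i < n" shows "V.fin_dim (V i)"
proof -
  obtain v where v: "v \<in> V i" "v \<noteq> 0" by (rule obtain_nonzero[OF i])
  obtain B where B: "finite B" "span B = UNIV" by (rule finite_basis)
  interpret m: Vector_Spaces.linear scale scaleV "\<lambda>h. \<rho> i h v" by (rule orbit_map[OF v(1) i])
  have "V.span ((\<lambda>h. \<rho> i h v) ` B) = V i" using m.span_image[of B] B orbit_eq[OF i v] by simp
  then show ?thesis using B subspace_V[OF i] by (auto simp: V.fin_dim_def)
qed

lemma d_pos: assumes "i < n" shows "0 < d i"
  using dimensions V.fin_dim_dim_0[OF fin_dim_V[OF assms]] V_nonzero[OF assms] assms by auto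

text \<open>An eigenspace of \<open>T\<close> is a submodule.\<close>

lemma Schur:
  assumes i: "i < n" and T: "lin_on scaleV scaleV (V i) T" "T ` V i \<subseteq> V i"
    and comm: "\<And>h v. v \<in> V i \<Longrightarrow> T (\<rho> i h v) = \<rho> i h (T v)"
  shows "\<exists>c. \<forall>v\<in>V i. T v = scaleV c v"
proof -
  obtain v c where v: "v \<in> V i" "v \<noteq> 0" "T v = scaleV c v"
    using eigenvector_exists[OF V.vector_space_axioms fin_dim_V[OF i] V_nonzero[OF i] T] by blast
  let ?W = "{v \<in> V i. T v = scaleV c v}"
  note sV = subspace_V[OF i]
  have "V.subspace ?W"
    using sV lin_on_zero[OF T(1)] lin_on_add[OF T(1)] lin_on_scale[OF T(1)]
    by (intro V.subspaceI)
      (auto simp: V.subspace_0 V.subspace_add V.subspace_scale V.scale_right_distrib mult.commute)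
  then have "submodule scaleV (\<rho> i) ?W (V i)"
    using \<rho>_closed[OF i] by (auto simp: submodule_def comm lin_on_scale[OF lin_\<rho>[OF i]])
  then have "?W = V i" using V_irreducible[OF i] v by blast
  then show ?thesis by blast
qed

lemma central_acts_as_scalar:
  assumes i: "i < n" and z: "\<And>h. z * h = h * z"
  shows "\<exists>c. \<forall>v\<in>V i. \<rho> i z v = scaleV c v"
  using z by (intro Schur[OF i lin_\<rho>[OF i] \<rho>_image[OF i]]) (metis \<rho>_mult[OF i])

lemma scalar_eqD:
  assumes i: "i < n" and eq: "\<And>v. v \<in> V i \<Longrightarrow> scaleV a v = scaleV b v" shows "a = b"
  using obtain_nonzero[OF i] eq V.scale_cancel_right by metis

lemma annihilator_identity:
  assumes i: "i < n"
  shows "\<exists>l. (\<forall>h. l * h = h * l) \<and> (\<forall>v\<in>V i. \<rho> i l v = 0) \<and>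
    (\<forall>x. (\<forall>v\<in>V i. \<rho> i x v = 0) \<longrightarrow> l * x = x)"
proof -
  let ?I = "{x. \<forall>v\<in>V i. \<rho> i x v = 0}"
  have "left_ideal ?I"
    by (rule left_idealI)
      (auto simp: \<rho>_zero[OF i] \<rho>_mult[OF i] \<rho>_zero_right[OF i] lin_on_add[OF lin_\<rho>_left[OF i]])
  moreover have "x * h \<in> ?I" if "x \<in> ?I" for x h using that by (auto simp: \<rho>_mult[OF i] \<rho>_closed[OF i])
  ultimately have "\<exists>l\<in>?I. (\<forall>h. l * h = h * l) \<and> (\<forall>x\<in>?I. l * x = x \<and> x * l = x)"
    by (rule ideal_central_identity)
  then show ?thesis by blast
qed

text \<open>
  The common annihilator of the simple modules is a two-sided ideal with an identity \<open>l\<close>. A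
  minimal left ideal inside it is isomorphic to one of the \<open>V\<^sub>i\<close>, so \<open>l\<close> acts on it both as \<open>0\<close>
  and as the identity.
\<close>

lemma faithful:
  assumes "\<And>i v. i < n \<Longrightarrow> v \<in> V i \<Longrightarrow> \<rho> i a v = \<rho> i b v" shows "a = b"
proof (rule ccontr)
  assume "a \<noteq> b"
  let ?I = "{x. \<forall>i<n. \<forall>v\<in>V i. \<rho> i x v = 0}"
  have I: "left_ideal ?I"
    by (rule left_idealI)
      (auto simp: \<rho>_zero \<rho>_mult \<rho>_zero_right lin_on_add[OF lin_\<rho>_left])
  moreover have "x * h \<in> ?I" if "x \<in> ?I" for x h using that by (auto simp: \<rho>_mult \<rho>_closed)
  ultimately have "\<exists>l\<in>?I. (\<forall>h. l * h = h * l) \<and> (\<forall>x\<in>?I. l * x = x \<and> x * l = x)"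
    by (rule ideal_central_identity)
  then obtain l where l: "l \<in> ?I" "\<And>x. x \<in> ?I \<Longrightarrow> l * x = x" by blast
  have "a - b \<in> ?I" using assms by (auto simp: lin_on_diff[OF lin_\<rho>_left])
  moreover have "a - b \<notin> {0}" using \<open>a \<noteq> b\<close> by simp
  ultimately have ne: "?I \<noteq> {0}" by metis
  from minimal_left_ideal_exists[OF I ne] obtain M where
    M: "left_ideal M" "M \<subseteq> ?I" "M \<noteq> {0}"
    and min: "\<forall>N. left_ideal N \<and> N \<subseteq> M \<longrightarrow> N = {0} \<or> N = M"
    by (elim exE conjE)
  have "simple_module scale scale M (*)"
    unfolding simple_module_def
  proof (intro conjI allI impI)
    show "algebra_module scale scale M (*)" by (rule algebra_module_left_ideal[OF M(1)])
    show "N = {0} \<or> N = M" if "submodule scale (*) N M" for N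
      by (rule min[rule_format]) (use that in \<open>auto simp: submodule_def left_ideal_def\<close>)
  qed (rule M(3))
  then obtain i where i: "i < n" "isomorphic_modules scale M (*) scaleV (V i) (\<rho> i)"
    using simples unfolding complete_simple_modules_def by blast
  then obtain f where f: "bij_betw f M (V i)" "\<forall>h. \<forall>v\<in>M. f (h * v) = \<rho> i h (f v)"
    unfolding isomorphic_modules_def by blast
  have M0: "0 \<in> M" using M(1) by (auto simp: left_ideal_def subspace_0)
  have "x = 0" if x: "x \<in> M" for x
  proof -
    have fx: "f x \<in> V i" "f 0 \<in> V i" using f(1) x M0 by (auto simp: bij_betw_def)
    have "f (l * x) = 0" using f(2) x l(1) i(1) fx by auto
    moreover have "f (0 * x) = 0" using f(2) x fx \<rho>_zero[OF i(1)] by metis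
    ultimately have "f x = f 0" using l(2)[of x] M(2) x by auto
    then show ?thesis using f(1) x M0 by (auto simp: bij_betw_def inj_on_def)
  qed
  then show False using M(3) M0 by blast
qed

lemma e_central: "i < n \<Longrightarrow> e i * h = h * e i" and e_idem: "i < n \<Longrightarrow> e i * e i = e i"
  and e_nonzero: "i < n \<Longrightarrow> e i \<noteq> 0"
  and e_acts: "i < n \<Longrightarrow> v \<in> V i \<Longrightarrow> \<rho> i (e i) v = v"
  using idempotents unfolding central_primitive_idempotent_def central_idempotent_def by blast+

lemma e_primitive:
  assumes i: "i < n" and l: "l * l = l" "\<And>h. l * h = h * l"
  shows "e i * l = 0 \<or> e i * l = e i"
proof -
  have el: "e i * (e i * l) = e i * l" "e i * l * l = e i * l"
    using e_idem[OF i] by (simp add: mult.assoc[symmetric]) (simp add: mult.assoc l(1))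
  have com: "e i * l * h = h * (e i * l)" for h
  proof -
    have "e i * l * h = e i * h * l" by (simp add: mult.assoc l(2))
    also have "\<dots> = h * e i * l" by (simp only: e_central[OF i, of h])
    also have "\<dots> = h * (e i * l)" by (rule mult.assoc)
    finally show ?thesis .
  qed
  have le: "e i * l * e i = e i * l" using com[of "e i"] el(1) by simp
  have "e i * l * (e i * l) = e i * l * e i * l" by (simp only: mult.assoc)
  then have idem: "e i * l * (e i * l) = e i * l" by (simp only: le el(2))
  have "central_idempotent (e i * l)"
    unfolding central_idempotent_def using idem com by blast
  moreover have "central_idempotent (e i - e i * l)"
    unfolding central_idempotent_def
  proof (intro conjI allI)
    show "(e i - e i * l) * (e i - e i * l) = e i - e i * l"
      using idem le el(1) e_idem[OF i] by (simp add: left_diff_distrib right_diff_distrib)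
    show "(e i - e i * l) * h = h * (e i - e i * l)" for h
      unfolding left_diff_distrib right_diff_distrib com e_central[OF i, of h] by (rule refl)
  qed
  moreover have "(e i * l) * (e i - e i * l) = 0"
    using idem le by (simp add: right_diff_distrib)
  moreover have "e i = e i * l + (e i - e i * l)" by simp
  ultimately have "e i * l = 0 \<or> e i - e i * l = 0"
    using idempotents i unfolding central_primitive_idempotent_def by blast
  then show ?thesis by auto
qed

lemma minimal_left_ideal_isomorphic:
  assumes i: "i < n" and v: "v \<in> V i" and M: "left_ideal M"
    "\<And>N. left_ideal N \<Longrightarrow> N \<subseteq> M \<Longrightarrow> N = {0} \<or> N = M"
    and x: "x \<in> M" "\<rho> i x v \<noteq> 0"
  shows "isomorphic_modules scale M (*) scaleV (V i) (\<rho> i)"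
proof -
  let ?f = "\<lambda>h. \<rho> i h v" and ?N = "{h \<in> M. \<rho> i h v = 0}"
  have sM: "subspace M" using M(1) by (simp add: left_ideal_def)
  have "left_ideal ?N"
    using M(1) v by (intro left_idealI)
      (auto simp: left_ideal_def subspace_0 subspace_add \<rho>_zero[OF i] \<rho>_mult[OF i]
        \<rho>_zero_right[OF i] lin_on_add[OF lin_\<rho>_left[OF i]])
  then have N: "?N = {0}" using M(2)[of ?N] x by auto
  have "inj_on ?f M"
  proof (rule inj_onI)
    fix a b assume ab: "a \<in> M" "b \<in> M" "\<rho> i a v = \<rho> i b v"
    then have "a - b \<in> ?N"
      using subspace_diff[OF sM] lin_on_diff[OF lin_\<rho>_left[OF i v]] by auto
    then show "a = b" using N by auto
  qed
  moreover have "?f ` M = V i" using V_irreducible[OF i orbit_submodule[OF i v M(1)]] x by auto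
  ultimately have "bij_betw ?f M (V i)" by (simp add: bij_betw_def)
  then show ?thesis
    unfolding isomorphic_modules_def using v
    by (intro exI[of _ ?f]) (auto simp: \<rho>_scale[OF i] \<rho>_mult[OF i] lin_on_add[OF lin_\<rho>_left[OF i]])
qed

text \<open>
  Suppose that \<open>e\<^sub>i\<close> acts nontrivially on \<open>V\<^sub>j\<close> with \<open>j \<noteq> i\<close>. Primitivity then makes \<open>e\<^sub>i\<close> orthogonal
  to the identities of the annihilators of \<open>V\<^sub>i\<close> and of \<open>V\<^sub>j\<close>, that is, \<open>H e\<^sub>i\<close> acts faithfully on
  both modules. A minimal left ideal of \<open>H e\<^sub>i\<close> is thus isomorphic to both.
\<close>

lemma e_acts_zero:
  assumes i: "i < n" and j: "j < n" and ij: "i \<noteq> j" and w: "w \<in> V j"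
  shows "\<rho> j (e i) w = 0"
proof (rule ccontr)
  assume ne: "\<rho> j (e i) w \<noteq> 0"
  obtain c where c: "\<And>v. v \<in> V j \<Longrightarrow> \<rho> j (e i) v = scaleV c v"
    using central_acts_as_scalar[OF j e_central[OF i]] by blast
  have kill: "e i * l = 0" if k: "k < n" and u: "u \<in> V k" "\<rho> k (e i) u \<noteq> 0"
    and l: "\<And>h. l * h = h * l" "\<And>v. v \<in> V k \<Longrightarrow> \<rho> k l v = 0" "l * l = l" for k l u
  proof -
    have "\<rho> k (e i * l) u = 0" using u l(2) \<rho>_zero_right k by (simp add: \<rho>_mult)
    then show ?thesis using e_primitive[OF i l(3) l(1)] u by auto
  qed
  obtain l where l: "\<And>h. l * h = h * l" "\<And>v. v \<in> V i \<Longrightarrow> \<rho> i l v = 0"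
    "\<And>x. (\<And>v. v \<in> V i \<Longrightarrow> \<rho> i x v = 0) \<Longrightarrow> l * x = x"
    using annihilator_identity[OF i] by metis
  obtain l' where l': "\<And>h. l' * h = h * l'" "\<And>v. v \<in> V j \<Longrightarrow> \<rho> j l' v = 0"
    "\<And>x. (\<And>v. v \<in> V j \<Longrightarrow> \<rho> j x v = 0) \<Longrightarrow> l' * x = x"
    using annihilator_identity[OF j] by metis
  obtain v0 where v0: "v0 \<in> V i" "v0 \<noteq> 0" by (rule obtain_nonzero[OF i])
  then have "\<rho> i (e i) v0 \<noteq> 0" using e_acts[OF i] by simp
  then have el: "e i * l = 0" using kill[OF i v0(1) _ l(1,2) l(3)[OF l(2)]] by blast
  have el': "e i * l' = 0" by (rule kill[OF j w ne l'(1,2) l'(3)[OF l'(2)]])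
  let ?L = "range (\<lambda>h. h * e i)"
  have L: "left_ideal ?L"
    by (intro left_idealI) (auto simp: image_iff intro: exI[of _ 0] exI[of _ "_ * _"] distrib_right[symmetric] mult.assoc[symmetric])
  have ne_L: "?L \<noteq> {0}" using e_nonzero[OF i] by (metis mult_1 rangeI singletonD)
  from minimal_left_ideal_exists[OF L ne_L] obtain M where
    M: "left_ideal M" "M \<subseteq> ?L" "M \<noteq> {0}"
    and min: "\<forall>N. left_ideal N \<and> N \<subseteq> M \<longrightarrow> N = {0} \<or> N = M"
    by (elim exE conjE)
  have "0 \<in> M" using M(1) by (auto simp: left_ideal_def subspace_0)
  then obtain x where x: "x \<in> M" "x \<noteq> 0" using M(3) by blast
  then obtain h where xh: "x = h * e i" using M(2) by blast
  have "\<exists>u\<in>V i. \<rho> i x u \<noteq> 0"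
  proof (rule ccontr)
    assume "\<not> ?thesis"
    then have "l * x = x" using l(3)[of x] by simp
    moreover have "l * x = h * (e i * l)" unfolding l(1) xh by (rule mult.assoc)
    ultimately show False using el x by simp
  qed
  then obtain u where u: "u \<in> V i" "\<rho> i x u \<noteq> 0" by blast
  have "\<exists>u\<in>V j. \<rho> j x u \<noteq> 0"
  proof (rule ccontr)
    assume "\<not> ?thesis"
    then have "l' * x = x" using l'(3)[of x] by simp
    moreover have "l' * x = h * (e i * l')" unfolding l'(1) xh by (rule mult.assoc)
    ultimately show False using el' x by simp
  qed
  then obtain u' where u': "u' \<in> V j" "\<rho> j x u' \<noteq> 0" by blast
  have "isomorphic_modules scaleV (V i) (\<rho> i) scaleV (V j) (\<rho> j)"
    using M(1) by (intro isomorphic_modules_common[OF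
        minimal_left_ideal_isomorphic[OF i u(1) M(1) min[rule_format] x(1) u(2)]
        minimal_left_ideal_isomorphic[OF j u'(1) M(1) min[rule_format] x(1) u'(2)]])
      (auto simp: left_ideal_def subspace_add subspace_scale)
  then show False using simples i j ij unfolding complete_simple_modules_def by blast
qed

lemma e_orth:
  assumes i: "i < n" and j: "j < n" and ij: "i \<noteq> j" shows "e i * e j = 0"
proof (rule faithful)
  fix k v assume k: "k < n" and v: "v \<in> V k"
  have "\<rho> k (e i) (\<rho> k (e j) v) = 0"
  proof (cases "k = j")
    case True
    then show ?thesis using e_acts_zero[OF i k _ \<rho>_closed[OF k v]] ij by simp
  next
    case False
    then show ?thesis using e_acts_zero[OF j k _ v] \<rho>_zero_right[OF k] by simp
  qed
  then show "\<rho> k (e i * e j) v = \<rho> k 0 v" by (simp add: \<rho>_mult[OF k v] \<rho>_zero[OF k v])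
qed

lemma combination_acts:
  assumes j: "j < n" and v: "v \<in> V j"
  shows "\<rho> j (\<Sum>i<n. scale (c i) (e i)) v = scaleV (c j) v"
proof -
  have "\<rho> j (\<Sum>i<n. scale (c i) (e i)) v = (\<Sum>i<n. scaleV (c i) (\<rho> j (e i) v))"
    using j v by (simp add: \<rho>_sum \<rho>_scale)
  also have "\<dots> = (\<Sum>i<n. if i = j then scaleV (c j) v else 0)"
    using j v by (intro sum.cong) (auto simp: e_acts e_acts_zero)
  finally have "\<rho> j (\<Sum>i<n. scale (c i) (e i)) v = \<dots>" .
  then show ?thesis using j by simp
qed

lemma combinationI:
  assumes "\<And>i v. i < n \<Longrightarrow> v \<in> V i \<Longrightarrow> \<rho> i z v = scaleV (c i) v"
  shows "z = (\<Sum>i<n. scale (c i) (e i))"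
  using assms combination_acts by (intro faithful) simp

lemma central_decomposition:
  assumes z: "\<And>h. z * h = h * z" shows "\<exists>c. z = (\<Sum>i<n. scale (c i) (e i))"
proof -
  have "\<forall>i. \<exists>c. i < n \<longrightarrow> (\<forall>v\<in>V i. \<rho> i z v = scaleV c v)"
    using central_acts_as_scalar[OF _ z] by blast
  then obtain c where "\<forall>i. i < n \<longrightarrow> (\<forall>v\<in>V i. \<rho> i z v = scaleV (c i) v)" by metis
  then show ?thesis using combinationI by blast
qed

lemma combination_mult_e:
  assumes "j < n" shows "(\<Sum>i<n. scale (c i) (e i)) * e j = scale (c j) (e j)"
proof -
  have "(\<Sum>i<n. scale (c i) (e i)) * e j = (\<Sum>i<n. scale (c i) (e i * e j))"
    by (simp add: sum_distrib_right scale_mult_l)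
  also have "\<dots> = (\<Sum>i<n. if i = j then scale (c j) (e j) else 0)"
    using assms by (intro sum.cong) (auto simp: e_idem e_orth)
  finally have "(\<Sum>i<n. scale (c i) (e i)) * e j = \<dots>" .
  then show ?thesis using assms by simp
qed

lemma \<chi>_eq: "i < n \<Longrightarrow> \<chi> i h = trace_on scaleV (V i) (\<rho> i h)"
  using characters by (simp add: module_character_def)

lemma lin_\<chi>: assumes i: "i < n" shows "lin scale (*) (\<chi> i)"
proof (rule lin_onI)
  fix x y
  have "\<chi> i (x + y) = trace_on scaleV (V i) (\<lambda>v. \<rho> i x v + \<rho> i y v)"
    unfolding \<chi>_eq[OF i]
    by (rule V.trace_cong[OF fin_dim_V[OF i] lin_\<rho>[OF i] \<rho>_image[OF i]])
      (simp add: lin_on_add[OF lin_\<rho>_left[OF i]])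
  also have "\<dots> = \<chi> i x + \<chi> i y"
    unfolding \<chi>_eq[OF i] by (rule V.trace_add[OF fin_dim_V[OF i] lin_\<rho>[OF i] \<rho>_image[OF i] lin_\<rho>[OF i] \<rho>_image[OF i]])
  finally show "\<chi> i (x + y) = \<chi> i x + \<chi> i y" .
next
  fix c x
  have "\<chi> i (scale c x) = trace_on scaleV (V i) (\<lambda>v. scaleV c (\<rho> i x v))"
    unfolding \<chi>_eq[OF i]
    by (rule V.trace_cong[OF fin_dim_V[OF i] lin_\<rho>[OF i] \<rho>_image[OF i]])
      (simp add: \<rho>_scale[OF i])
  also have "\<dots> = c * \<chi> i x"
    unfolding \<chi>_eq[OF i] by (rule V.trace_scale[OF fin_dim_V[OF i] lin_\<rho>[OF i] \<rho>_image[OF i]])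
  finally show "\<chi> i (scale c x) = c * \<chi> i x" .
qed

lemma \<chi>_mult: "i < n \<Longrightarrow> \<chi> i (a * b) = trace_on scaleV (V i) (\<lambda>v. \<rho> i a (\<rho> i b v))"
  unfolding \<chi>_eq
  by (rule V.trace_cong[OF fin_dim_V lin_\<rho> \<rho>_image]) (auto simp: \<rho>_mult)

lemma \<chi>_commute: "i < n \<Longrightarrow> \<chi> i (a * b) = \<chi> i (b * a)"
  unfolding \<chi>_mult
  by (rule V.trace_commute[OF fin_dim_V fin_dim_V lin_\<rho> \<rho>_image lin_\<rho> \<rho>_image])

lemma trace_scalar_V: "i < n \<Longrightarrow> trace_on scaleV (V i) (\<lambda>v. scaleV c v) = c * of_nat (d i)"
  using V.trace_scale[OF fin_dim_V, of i "\<lambda>v. v" c] V.trace_id[OF fin_dim_V] dimensions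
  by (simp add: lin_on_def)

lemma \<chi>_scalar:
  assumes i: "i < n" and h: "\<And>v. v \<in> V i \<Longrightarrow> \<rho> i h v = scaleV c v"
  shows "\<chi> i h = c * of_nat (d i)"
  unfolding \<chi>_eq[OF i] trace_scalar_V[OF i, symmetric]
  by (rule V.trace_cong[OF fin_dim_V[OF i] lin_\<rho>[OF i] \<rho>_image[OF i] h])

lemma \<chi>_one: "i < n \<Longrightarrow> \<chi> i 1 = of_nat (d i)"
  using \<chi>_scalar[of i 1 1] by (simp add: \<rho>_one)

lemma \<chi>_mult_e:
  assumes i: "i < n" and j: "j < n" shows "\<chi> i (h * e j) = (if i = j then \<chi> i h else 0)"
proof (cases "i = j")
  case True
  have "\<chi> i (h * e i) = \<chi> i h"
    unfolding \<chi>_eq[OF i]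
    by (rule V.trace_cong[OF fin_dim_V[OF i] lin_\<rho>[OF i] \<rho>_image[OF i]])
      (simp add: \<rho>_mult[OF i] e_acts[OF i])
  then show ?thesis using True by simp
next
  case False
  then show ?thesis
    using \<chi>_scalar[OF i, of "h * e j" 0] e_acts_zero[OF j i] by (simp add: \<rho>_mult[OF i] \<rho>_zero_right[OF i])
qed

lemma \<chi>_e: "i < n \<Longrightarrow> j < n \<Longrightarrow> \<chi> i (e j) = (if i = j then of_nat (d i) else 0)"
  using \<chi>_mult_e[of i j 1] by (simp add: \<chi>_one)

text \<open>
  A trace function is represented, through the regular character, by a central element, that
  is, by a combination of the \<open>e\<^sub>i\<close>; the element representing \<open>\<chi>\<^sub>i\<close> is a multiple of \<open>e\<^sub>i\<close>.
\<close>

lemma trace_function_represented: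
  assumes f: "lin scale (*) f" and tr: "\<And>a b. f (a * b) = f (b * a)"
  shows "\<exists>c. \<forall>h. f h = chi_reg (h * (\<Sum>i<n. scale (c i) (e i)))"
proof -
  obtain z where z: "\<And>h. f h = chi_reg (h * z)"
    using functional_representable[OF lin_chi_reg chi_reg_nondegenerate f] by blast
  have "z * k = k * z" for k
  proof -
    have "chi_reg (h * (z * k - k * z)) = 0" for h
    proof -
      have "chi_reg (h * (z * k)) = f (k * h)"
        using chi_reg_commute[of "h * z" k] by (simp add: z mult.assoc)
      moreover have "chi_reg (h * (k * z)) = f (h * k)" by (simp add: z mult.assoc)
      ultimately show ?thesis
        by (simp add: right_diff_distrib lin_on_diff[OF lin_chi_reg] tr)
    qed
    then have "z * k - k * z = 0" by (rule chi_reg_nondegenerate)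
    then show ?thesis by simp
  qed
  then show ?thesis using central_decomposition[of z] z by blast
qed

lemma chi_reg_mult_e:
  assumes i: "i < n" shows "\<exists>c. \<forall>h. chi_reg (h * e i) = c * \<chi> i h"
proof -
  obtain c where c: "\<And>h. \<chi> i h = chi_reg (h * (\<Sum>j<n. scale (c j) (e j)))"
    using trace_function_represented[OF lin_\<chi>[OF i] \<chi>_commute[OF i]] by blast
  have "\<chi> i h = c i * chi_reg (h * e i)" for h
  proof -
    have "\<chi> i h = \<chi> i (h * e i)" using \<chi>_mult_e[OF i i] by simp
    also have "\<dots> = chi_reg (h * ((\<Sum>j<n. scale (c j) (e j)) * e i))"
      using e_central[OF i] by (simp add: c mult.assoc)
    also have "\<dots> = c i * chi_reg (h * e i)"
      by (simp add: combination_mult_e[OF i] scale_mult_r lin_on_scale[OF lin_chi_reg])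
    finally show ?thesis .
  qed
  note * = this
  have "c i \<noteq> 0" using *[of 1] \<chi>_one[OF i] d_pos[OF i] by auto
  then have "chi_reg (h * e i) = inverse (c i) * \<chi> i h" for h using * by (simp add: field_simps)
  then show ?thesis by blast
qed

text \<open>Hence the irreducible characters span the trace functions.\<close>

lemma trace_function_expansion:
  assumes f: "lin scale (*) f" and tr: "\<And>a b. f (a * b) = f (b * a)"
  shows "f a = (\<Sum>i<n. f (e i) / of_nat (d i) * \<chi> i a)"
proof -
  obtain c where c: "\<And>h. f h = chi_reg (h * (\<Sum>i<n. scale (c i) (e i)))"
    using trace_function_represented[OF f tr] by blast
  obtain b where b: "\<And>i h. i < n \<Longrightarrow> chi_reg (h * e i) = b i * \<chi> i h"
    using chi_reg_mult_e by metis
  have exp: "f h = (\<Sum>i<n. c i * b i * \<chi> i h)" for h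
    unfolding c
    by (simp add: sum_distrib_left scale_mult_r lin_sum[OF lin_chi_reg] lin_on_scale[OF lin_chi_reg] b
        mult.assoc)
  have "f (e j) = c j * b j * of_nat (d j)" if j: "j < n" for j
  proof -
    have "f (e j) = (\<Sum>i<n. if i = j then c j * b j * of_nat (d j) else 0)"
      unfolding exp using j by (intro sum.cong) (auto simp: \<chi>_e)
    then show ?thesis using j by simp
  qed
  then have "f (e j) / of_nat (d j) = c j * b j" if "j < n" for j
    using that d_pos[OF that] by simp
  then show ?thesis by (simp add: exp)
qed

text \<open>
  The dimension of the block \<open>H e\<^sub>i\<close> relative to that of \<open>End(V\<^sub>i)\<close>. These numbers are the
  coefficients of a quadratic form whose positivity on rational vectors is decisive below.
\<close>

definition block_weight :: "nat \<Rightarrow> rat" where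
  "block_weight i = of_nat (dim (range ((*) (e i)))) / (of_nat (d i))\<^sup>2"

lemma block_weight_pos: "i < n \<Longrightarrow> 0 < block_weight i"
  using dim_idempotent_pos[OF e_idem e_nonzero] d_pos by (simp add: block_weight_def)

text \<open>
  The left-hand side is a trace function of \<open>a\<close> and of \<open>b\<close>, so its values at the pairs
  \<open>(e\<^sub>i, e\<^sub>j)\<close> determine it; for \<open>i \<noteq> j\<close> these vanish because \<open>e\<^sub>i x e\<^sub>j = e\<^sub>i e\<^sub>j x = 0\<close>.
\<close>

lemma bimodule_trace:
  "Tr (\<lambda>x. a * x * b) = (\<Sum>i<n. of_rat (block_weight i) * \<chi> i a * \<chi> i b)"
proof -
  define \<beta> where "\<beta> a b = Tr (\<lambda>x. a * x * b)" for a b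
  have lin: "lin scale (*) (\<lambda>a. \<beta> a b)" "lin scale (*) (\<lambda>b. \<beta> a b)" for a b
    unfolding \<beta>_def by (intro lin_Tr lin_intros)+
  have tr1: "\<beta> (a * a') b = \<beta> (a' * a) b" for a a' b
  proof -
    have "Tr (\<lambda>x. a * (a' * x * b)) = Tr (\<lambda>x. a' * (a * x) * b)"
      by (rule Tr_commute) (intro lin_intros)+
    then show ?thesis by (simp only: \<beta>_def mult.assoc)
  qed
  have tr2: "\<beta> a (b * b') = \<beta> a (b' * b)" for a b b'
  proof -
    have "Tr (\<lambda>x. a * x * b * b') = Tr (\<lambda>x. a * (x * b') * b)"
      by (rule Tr_commute) (intro lin_intros)+
    then show ?thesis by (simp only: \<beta>_def mult.assoc)
  qed
  have ee: "\<beta> (e i) (e j) = (if i = j then of_nat (dim (range ((*) (e i)))) else 0)"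
    if i: "i < n" and j: "j < n" for i j
  proof -
    have "e i * x * e j = e i * e j * x" for x using e_central[OF j] by (metis mult.assoc)
    then have "\<beta> (e i) (e j) = chi_reg (e i * e j)" by (simp add: \<beta>_def chi_reg_def)
    then show ?thesis
      using i j chi_reg_idempotent[OF e_idem[OF i]]
      by (cases "i = j") (simp_all add: e_orth e_idem lin_on_zero[OF lin_chi_reg])
  qed
  have *: "\<beta> (e i) b = of_nat (dim (range ((*) (e i)))) / of_nat (d i) * \<chi> i b" if i: "i < n" for i
  proof -
    have "\<beta> (e i) b = (\<Sum>j<n. \<beta> (e i) (e j) / of_nat (d j) * \<chi> j b)"
      by (rule trace_function_expansion[OF lin(2) tr2])
    also have "\<dots> = (\<Sum>j<n. if j = i then of_nat (dim (range ((*) (e i)))) / of_nat (d i) * \<chi> i b else 0)"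
      using i by (intro sum.cong) (auto simp: ee)
    finally show ?thesis using i by simp
  qed
  have "\<beta> a b = (\<Sum>i<n. \<beta> (e i) b / of_nat (d i) * \<chi> i a)"
    by (rule trace_function_expansion[OF lin(1) tr1])
  also have "\<dots> = (\<Sum>i<n. of_rat (block_weight i) * \<chi> i a * \<chi> i b)"
    by (intro sum.cong) (auto simp: * block_weight_def of_rat_divide of_rat_mult power2_eq_square)
  finally show ?thesis by (simp add: \<beta>_def)
qed

end

section \<open>Calculus with Sweedler notation\<close>

lemma lin_ext_superset:
  assumes vs: "vector_space sc" and K: "finite K" "Poly_Mapping.keys t \<subseteq> K"
  shows "lin_ext sc f t = (\<Sum>p\<in>K. sc (Poly_Mapping.lookup t p) (f p))"
proof -
  interpret vector_space sc by (rule vs)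
  show ?thesis
    unfolding lin_ext_def using K by (intro sum.mono_neutral_left) (auto simp: in_keys_iff)
qed

lemma lin_lin_ext:
  fixes sc :: "'k::field \<Rightarrow> 'w::ab_group_add \<Rightarrow> 'w" and f :: "'p \<Rightarrow> 'w"
  assumes vs: "vector_space sc" shows "lin free_scale sc (lin_ext sc f)"
proof (rule lin_onI)
  interpret vector_space sc by (rule vs)
  fix t u :: "'p \<Rightarrow>\<^sub>0 'k"
  let ?K = "Poly_Mapping.keys t \<union> Poly_Mapping.keys u"
  have "lin_ext sc f (t + u) = (\<Sum>p\<in>?K. sc (Poly_Mapping.lookup (t + u) p) (f p))"
    using Poly_Mapping.keys_add[of t u] by (intro lin_ext_superset[OF vs]) auto
  also have "\<dots> = lin_ext sc f t + lin_ext sc f u"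
    by (simp add: lookup_add scale_left_distrib sum.distrib lin_ext_superset[OF vs, of ?K])
  finally show "lin_ext sc f (t + u) = lin_ext sc f t + lin_ext sc f u" .
next
  interpret vector_space sc by (rule vs)
  fix c and t :: "'p \<Rightarrow>\<^sub>0 'k"
  have "Poly_Mapping.keys (free_scale c t) \<subseteq> Poly_Mapping.keys t"
    by (auto simp: in_keys_iff lookup_free_scale)
  then have "lin_ext sc f (free_scale c t) =
      (\<Sum>p\<in>Poly_Mapping.keys t. sc (Poly_Mapping.lookup (free_scale c t) p) (f p))"
    by (intro lin_ext_superset[OF vs]) auto
  then show "lin_ext sc f (free_scale c t) = sc c (lin_ext sc f t)"
    by (simp add: lookup_free_scale lin_ext_def scale_sum_right)
qed

lemma lin_ext_gen:
  assumes "vector_space sc" shows "lin_ext sc f (free_gen p) = f p"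
proof -
  interpret vector_space sc by fact
  show ?thesis by (simp add: lin_ext_def)
qed

lemma lin_ext_lin:
  assumes "lin sc1 sc2 g" shows "g (lin_ext sc1 f t) = lin_ext sc2 (\<lambda>p. g (f p)) t"
  by (simp add: lin_ext_def lin_sum[OF assms] lin_on_scale[OF assms])

text \<open>The universal property of the tensor powers: the relations go to \<open>0\<close> by multilinearity.\<close>

lemma lin_ext_respects:
  assumes vs: "vector_space sc" and f: "\<And>q. q \<in> slots \<Longrightarrow> lin scale sc (\<lambda>x. f (q x))"
    and eq: "tensor_eq scale slots t u"
  shows "lin_ext sc f t = lin_ext sc f u"
proof -
  interpret vector_space sc by (rule vs)
  interpret F: vector_space "free_scale :: 'a \<Rightarrow> ('d \<Rightarrow>\<^sub>0 'a) \<Rightarrow> _" by (rule vector_space_free_scale)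
  note lin = lin_lin_ext[OF vs, of f]
  have "r \<in> F.span
     ({free_gen (q (x + y)) - free_gen (q x) - free_gen (q y) | q x y. q \<in> slots} \<union>
      {free_gen (q (scale c x)) - free_scale c (free_gen (q x)) | q c x. q \<in> slots})
     \<Longrightarrow> lin_ext sc f r = 0" for r
  proof (induction rule: F.span_induct_alt)
    case base
    then show ?case by (simp add: lin_on_zero[OF lin])
  next
    case (step c x y)
    have "lin_ext sc f x = 0"
      using step(1) f by (auto simp: lin_on_diff[OF lin] lin_on_scale[OF lin] lin_ext_gen[OF vs]
          lin_on_add[OF f] lin_on_scale[OF f])
    then show ?case using step(2) by (simp add: lin_on_add[OF lin] lin_on_scale[OF lin])
  qed
  then have "lin_ext sc f (t - u) = 0"
    using eq by (simp add: tensor_eq_def multilinear_relations_def)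
  then show ?thesis by (simp add: lin_on_diff[OF lin])
qed

locale hopf = hopf_algebra scale \<Delta> \<epsilon> S
  for scale :: "'k::field \<Rightarrow> 'h::ring_1 \<Rightarrow> 'h" and \<Delta> \<epsilon> S
begin

sublocale k_algebra scale
  by unfold_locales (rule scale_mult_left scale_mult_right)+

abbreviation sw :: "('k \<Rightarrow> 'w::ab_group_add \<Rightarrow> 'w) \<Rightarrow> ('h \<Rightarrow> 'h \<Rightarrow> 'w) \<Rightarrow> 'h \<Rightarrow> 'w" where
  "sw sc F a \<equiv> sweedler sc \<Delta> F a"

lemma vs_scale [lin_intros]: "vector_space scale" by (rule vector_space_axioms)

lemma vs_field [lin_intros]: "vector_space ((*) :: 'k \<Rightarrow> 'k \<Rightarrow> 'k)"
  by unfold_locales (simp_all add: algebra_simps)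

lemma lin_\<epsilon> [lin_intros]: "lin s scale f \<Longrightarrow> lin s (*) (\<lambda>x. \<epsilon> (f x))"
  using counit_linear by (auto simp: Vector_Spaces.linear_iff lin_on_def)

lemma lin_S [lin_intros]: "lin s scale f \<Longrightarrow> lin s scale (\<lambda>x. S (f x))"
  using antipode_linear by (auto simp: Vector_Spaces.linear_iff lin_on_def)

lemma sw_eq: "sw sc F a = (\<Sum>p\<in>Poly_Mapping.keys (\<Delta> a). sc (Poly_Mapping.lookup (\<Delta> a) p) (F (fst p) (snd p)))"
  by (simp add: sweedler_def lin_ext_def case_prod_unfold)

lemma sw_lin: "lin sc1 sc2 g \<Longrightarrow> g (sw sc1 F a) = sw sc2 (\<lambda>x y. g (F x y)) a"
  unfolding sweedler_def by (subst lin_ext_lin) (auto simp: case_prod_unfold)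

lemma lin_sw_param [lin_intros]:
  assumes "vector_space sc" and F: "\<And>u v. lin s sc (\<lambda>x. F x u v)"
  shows "lin s sc (\<lambda>x. sw sc (F x) a)"
proof -
  interpret W: vector_space sc by fact
  show ?thesis
    unfolding sw_eq
    by (rule lin_onI) (simp_all add: lin_on_add[OF F] lin_on_scale[OF F] sum.distrib
        W.scale_right_distrib W.scale_sum_right mult.commute)
qed

lemma slots2_lin:
  assumes "\<And>y. lin scale sc (\<lambda>x. F x y)" "\<And>x. lin scale sc (\<lambda>y. F x y)" "q \<in> slots2"
  shows "lin scale sc (\<lambda>x. (case q x of (u, v) \<Rightarrow> F u v))"
  using assms by (auto simp: slots2_def)

lemma sw_respects:
  assumes vs: "vector_space sc" and F: "\<And>y. lin scale sc (\<lambda>x. F x y)" "\<And>x. lin scale sc (\<lambda>y. F x y)"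
    and eq: "tensor_eq scale slots2 t u"
  shows "lin_ext sc (\<lambda>(x, y). F x y) t = lin_ext sc (\<lambda>(x, y). F x y) u"
  using slots2_lin[of sc F] F by (intro lin_ext_respects[OF vs _ eq]) auto

lemma lin_sw [lin_intros]:
  assumes vs: "vector_space sc" and F: "\<And>y. lin scale sc (\<lambda>x. F x y)" "\<And>x. lin scale sc (\<lambda>y. F x y)"
    and f: "lin s scale f"
  shows "lin s sc (\<lambda>x. sw sc F (f x))"
proof (rule lin_onI)
  show "sw sc F (f (x + y)) = sw sc F (f x) + sw sc F (f y)" for x y
    using sw_respects[OF vs F comult_add]
    by (simp add: lin_on_add[OF f] sweedler_def lin_on_add[OF lin_lin_ext[OF vs]])
  show "sw sc F (f (s c x)) = sc c (sw sc F (f x))" for c x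
    using sw_respects[OF vs F comult_scale]
    by (simp add: lin_on_scale[OF f] sweedler_def lin_on_scale[OF lin_lin_ext[OF vs]])
qed

lemma sw_one:
  assumes vs: "vector_space sc" and F: "\<And>y. lin scale sc (\<lambda>x. F x y)" "\<And>x. lin scale sc (\<lambda>y. F x y)"
  shows "sw sc F 1 = F 1 1"
  unfolding sweedler_def sw_respects[OF vs F comult_one] by (simp add: lin_ext_gen[OF vs])

lemma sw_mult:
  assumes vs: "vector_space sc" and F: "\<And>y. lin scale sc (\<lambda>x. F x y)" "\<And>x. lin scale sc (\<lambda>y. F x y)"
  shows "sw sc F (a * b) = sw sc (\<lambda>x y. sw sc (\<lambda>u v. F (x * u) (y * v)) b) a"
  unfolding sweedler_def sw_respects[OF vs F comult_mult] tensor_mult_def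
  by (simp add: lin_ext_lin[OF lin_lin_ext[OF vs]] case_prod_unfold lin_ext_gen[OF vs])

lemma sw_coassoc:
  assumes vs: "vector_space sc"
    and F: "\<And>y z. lin scale sc (\<lambda>x. F x y z)" "\<And>x z. lin scale sc (\<lambda>y. F x y z)"
      "\<And>x y. lin scale sc (\<lambda>z. F x y z)"
  shows "sw sc (\<lambda>p z. sw sc (\<lambda>x y. F x y z) p) a = sw sc (\<lambda>x p. sw sc (\<lambda>y z. F x y z) p) a"
proof -
  have "lin_ext sc (\<lambda>(x, y, z). F x y z)
      (sw free_scale (\<lambda>a1 a2. sw free_scale (\<lambda>b1 b2. free_gen (b1, b2, a2)) a1) a) =
    lin_ext sc (\<lambda>(x, y, z). F x y z)
      (sw free_scale (\<lambda>a1 a2. sw free_scale (\<lambda>b1 b2. free_gen (a1, b1, b2)) a2) a)"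
    by (rule lin_ext_respects[OF vs _ coassoc]) (auto simp: slots3_def F)
  then show ?thesis
    by (simp add: sw_lin[OF lin_lin_ext[OF vs]] lin_ext_gen[OF vs])
qed

lemma sw_swap:
  assumes "vector_space sc"
  shows "sw sc (\<lambda>x y. sw sc (\<lambda>u v. F x y u v) b) a = sw sc (\<lambda>u v. sw sc (\<lambda>x y. F x y u v) a) b"
proof -
  interpret W: vector_space sc by fact
  show ?thesis
    unfolding sw_eq W.scale_sum_right by (subst sum.swap) (simp add: mult.commute)
qed

lemma sw_counit_left:
  assumes f: "lin scale sc f" shows "sw sc (\<lambda>x y. sc (\<epsilon> x) (f y)) a = f a"
  using sw_lin[OF f, of "\<lambda>x y. scale (\<epsilon> x) y" a] by (simp add: counit_left lin_on_scale[OF f])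

lemma sw_counit_right:
  assumes f: "lin scale sc f" shows "sw sc (\<lambda>x y. sc (\<epsilon> y) (f x)) a = f a"
  using sw_lin[OF f, of "\<lambda>x y. scale (\<epsilon> y) x" a] by (simp add: counit_right lin_on_scale[OF f])

lemma sw_antipode_left:
  assumes f: "lin scale sc f" shows "sw sc (\<lambda>x y. f (S x * y)) a = sc (\<epsilon> a) (f 1)"
  using sw_lin[OF f, of "\<lambda>x y. S x * y" a] by (simp add: antipode_left lin_on_scale[OF f])

lemma sw_antipode_right:
  assumes f: "lin scale sc f" shows "sw sc (\<lambda>x y. f (x * S y)) a = sc (\<epsilon> a) (f 1)"
  using sw_lin[OF f, of "\<lambda>x y. x * S y" a] by (simp add: antipode_right lin_on_scale[OF f])

text \<open>
  Iterated coproducts are written by splitting the right factor. The next two lemmas are the form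
  in which the antipode cancels adjacent factors inside such an expression.
\<close>

lemma cancel_antipode_left:
  assumes vs: "vector_space sc" and F: "\<And>y. lin scale sc (\<lambda>x. F x y)" "\<And>x. lin scale sc (\<lambda>y. F x y)"
  shows "sw sc (\<lambda>x p. sw sc (\<lambda>y z. F (S x * y) z) p) a = F 1 a"
proof -
  have "sw sc (\<lambda>x p. sw sc (\<lambda>y z. F (S x * y) z) p) a = sw sc (\<lambda>p z. sw sc (\<lambda>x y. F (S x * y) z) p) a"
    by (rule sw_coassoc[symmetric]) (intro lin_intros vs lin_comp[OF F(1)] F(2))+
  also have "\<dots> = sw sc (\<lambda>p z. sc (\<epsilon> p) (F 1 z)) a" by (simp add: sw_antipode_left[OF F(1)])
  also have "\<dots> = F 1 a" by (rule sw_counit_left[OF F(2)])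
  finally show ?thesis .
qed

lemma cancel_antipode_right:
  assumes vs: "vector_space sc" and F: "\<And>y. lin scale sc (\<lambda>x. F x y)" "\<And>x. lin scale sc (\<lambda>y. F x y)"
  shows "sw sc (\<lambda>x p. sw sc (\<lambda>y z. F (x * S y) z) p) a = F 1 a"
proof -
  have "sw sc (\<lambda>x p. sw sc (\<lambda>y z. F (x * S y) z) p) a = sw sc (\<lambda>p z. sw sc (\<lambda>x y. F (x * S y) z) p) a"
    by (rule sw_coassoc[symmetric]) (intro lin_intros vs lin_comp[OF F(1)] F(2))+
  also have "\<dots> = sw sc (\<lambda>p z. sc (\<epsilon> p) (F 1 z)) a" by (simp add: sw_antipode_right[OF F(1)])
  also have "\<dots> = F 1 a" by (rule sw_counit_left[OF F(2)])
  finally show ?thesis .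
qed

lemma S_one: "S 1 = 1"
proof -
  have "sw scale (\<lambda>x y. S x * y) 1 = S 1 * 1" by (rule sw_one) (intro lin_intros)+
  then show ?thesis by (simp add: antipode_left counit_one)
qed

text \<open>
  Both sides are equal to \<open>S(a\<^sub>1 b\<^sub>1) a\<^sub>2 b\<^sub>2 S(b\<^sub>3) S(a\<^sub>3)\<close>, because both maps are convolution
  inverses of the multiplication.
\<close>

lemma S_mult: "S (a * b) = S b * S a"
proof -
  let ?X = "sw scale (\<lambda>a1 r. sw scale (\<lambda>b1 t. sw scale (\<lambda>a2 a3. sw scale (\<lambda>b2 b3.
      S (a1 * b1) * a2 * b2 * S b3 * S a3) t) r) b) a"
  have 1: "sw scale (\<lambda>a2 a3. sw scale (\<lambda>b2 b3. S (a1 * b1) * a2 * b2 * S b3 * S a3) t) r =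
      scale (\<epsilon> t) (scale (\<epsilon> r) (S (a1 * b1)))" for a1 b1 r t
  proof -
    have "sw scale (\<lambda>b2 b3. S (a1 * b1) * a2 * (b2 * S b3) * S a3) t =
        scale (\<epsilon> t) (S (a1 * b1) * a2 * 1 * S a3)" for a2 a3
      by (rule sw_antipode_right) (intro lin_intros)
    moreover have "sw scale (\<lambda>a2 a3. scale (\<epsilon> t) (S (a1 * b1) * (a2 * S a3))) r =
        scale (\<epsilon> r) (scale (\<epsilon> t) (S (a1 * b1) * 1))"
      by (rule sw_antipode_right) (intro lin_intros)
    ultimately show ?thesis by (simp add: mult.assoc scale_left_commute mult.commute)
  qed
  have "sw scale (\<lambda>b1 t. scale (\<epsilon> t) (scale (\<epsilon> r) (S (a1 * b1)))) b = scale (\<epsilon> r) (S (a1 * b))" for a1 r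
    by (rule sw_counit_right) (intro lin_intros)
  moreover have "sw scale (\<lambda>a1 r. scale (\<epsilon> r) (S (a1 * b))) a = S (a * b)"
    by (rule sw_counit_right) (intro lin_intros)
  ultimately have X1: "?X = S (a * b)" unfolding 1 by simp
  have "?X = sw scale (\<lambda>a1 r. sw scale (\<lambda>a2 a3. sw scale (\<lambda>b1 t. sw scale (\<lambda>b2 b3.
      S (a1 * b1) * a2 * b2 * S b3 * S a3) t) b) r) a"
    by (subst sw_swap[OF vs_scale]) (rule refl)
  also have "\<dots> = sw scale (\<lambda>a1 r. sw scale (\<lambda>a2 a3. sw scale (\<lambda>q b3. sw scale (\<lambda>b1 b2.
      S (a1 * b1) * a2 * b2 * S b3 * S a3) q) b) r) a"
    by (subst sw_coassoc) (intro lin_intros refl)+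
  also have "\<dots> = sw scale (\<lambda>p a3. sw scale (\<lambda>a1 a2. sw scale (\<lambda>q b3. sw scale (\<lambda>b1 b2.
      S (a1 * b1) * a2 * b2 * S b3 * S a3) q) b) p) a"
    by (rule sw_coassoc[symmetric]) (intro lin_intros)+
  also have "\<dots> = sw scale (\<lambda>p a3. sw scale (\<lambda>q b3. sw scale (\<lambda>a1 a2. sw scale (\<lambda>b1 b2.
      S (a1 * b1) * a2 * b2 * S b3 * S a3) q) p) b) a"
    by (subst sw_swap[OF vs_scale]) (rule refl)
  also have "\<dots> = sw scale (\<lambda>p a3. sw scale (\<lambda>q b3. scale (\<epsilon> p) (scale (\<epsilon> q) (S b3 * S a3))) b) a"
  proof -
    have "sw scale (\<lambda>a1 a2. sw scale (\<lambda>b1 b2. S (a1 * b1) * (a2 * b2) * (S b3 * S a3)) q) p =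
        sw scale (\<lambda>x y. S x * y * (S b3 * S a3)) (p * q)" for p q a3 b3
      by (rule sw_mult[symmetric]) (intro lin_intros)+
    moreover have "sw scale (\<lambda>x y. S x * y * (S b3 * S a3)) (p * q) =
        scale (\<epsilon> (p * q)) (1 * (S b3 * S a3))" for p q a3 b3
      by (rule sw_antipode_left) (intro lin_intros)
    ultimately show ?thesis by (simp add: mult.assoc counit_mult)
  qed
  also have "\<dots> = S b * S a"
  proof -
    have "sw scale (\<lambda>q b3. scale (\<epsilon> q) (scale (\<epsilon> p) (S b3 * S a3))) b = scale (\<epsilon> p) (S b * S a3)" for p a3
      by (rule sw_counit_left) (intro lin_intros)
    moreover have "sw scale (\<lambda>p a3. scale (\<epsilon> p) (S b * S a3)) a = S b * S a"
      by (rule sw_counit_left) (intro lin_intros)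
    ultimately show ?thesis by (simp add: scale_left_commute mult.commute)
  qed
  finally show ?thesis using X1 by simp
qed

text \<open>
  Dually, both sides are convolution inverses of the comultiplication, and the common value is
  \<open>S(a\<^sub>1)\<^sub>1 a\<^sub>2 S(a\<^sub>5) \<otimes> S(a\<^sub>1)\<^sub>2 a\<^sub>3 S(a\<^sub>4)\<close>.
\<close>

lemma S_comult:
  assumes vs: "vector_space sc" and F: "\<And>y. lin scale sc (\<lambda>x. F x y)" "\<And>x. lin scale sc (\<lambda>y. F x y)"
  shows "sw sc F (S a) = sw sc (\<lambda>x y. F (S y) (S x)) a"
proof -
  note F_lin = lin_comp[OF F(1)] lin_comp[OF F(2)]
  let ?G = "\<lambda>b p q. sw sc (\<lambda>u v. F (u * p) (v * q)) (S b)"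
  have G: "lin scale sc (\<lambda>p. ?G (f p) x y)" if "lin scale scale f" for f x y
    using that by (intro lin_intros vs F_lin)
  (* r1 S(r4) (x) r2 S(r3) = eps(r) 1 (x) 1, cancelling from the inside *)
  have split4: "sw sc (\<lambda>p t. sw sc (\<lambda>x y. sw sc (\<lambda>u v. K (x * S v) (y * S u)) t) p) r = sc (\<epsilon> r) (K 1 1)"
    if K: "\<And>y. lin scale sc (\<lambda>x. K x y)" "\<And>x. lin scale sc (\<lambda>y. K x y)" for K r
  proof -
    note K_lin = lin_comp[OF K(1)] lin_comp[OF K(2)]
    have "sw sc (\<lambda>p t. sw sc (\<lambda>x y. sw sc (\<lambda>u v. K (x * S v) (y * S u)) t) p) r =
        sw sc (\<lambda>x p. sw sc (\<lambda>y t. sw sc (\<lambda>u v. K (x * S v) (y * S u)) t) p) r"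
      by (rule sw_coassoc) (intro lin_intros vs K_lin)+
    also have "\<dots> = sw sc (\<lambda>x p. K (x * S p) 1) r"
    proof -
      have "sw sc (\<lambda>y t. sw sc (\<lambda>u v. K (x * S v) (y * S u)) t) p = K (x * S p) 1" for x p
        by (rule cancel_antipode_right[OF vs, of "\<lambda>w v. K (x * S v) w"]) (intro lin_intros K_lin)+
      then show ?thesis by simp
    qed
    also have "\<dots> = sc (\<epsilon> r) (K 1 1)" by (rule sw_antipode_right[OF K(1)])
    finally show ?thesis .
  qed
  have "sw sc F (S a) = sw sc (\<lambda>b r. sc (\<epsilon> r) (?G b 1 1)) a"
    using sw_counit_right[OF G[OF lin_id, of 1 1], of a] by simp
  also have "\<dots> = sw sc (\<lambda>b r. sw sc (\<lambda>p t. sw sc (\<lambda>x y. sw sc (\<lambda>u v. ?G b (x * S v) (y * S u)) t) p) r) a"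
    by (subst split4) (intro lin_intros vs F_lin refl)+
  also have "\<dots> = sw sc (\<lambda>w t. sw sc (\<lambda>b p. sw sc (\<lambda>x y. sw sc (\<lambda>u v. ?G b (x * S v) (y * S u)) t) p) w) a"
    by (rule sw_coassoc[symmetric]) (intro lin_intros vs F_lin)+
  also have "\<dots> = sw sc (\<lambda>w t. sc (\<epsilon> w) (sw sc (\<lambda>u v. F (S v) (S u)) t)) a"
  proof -
    have "sw sc (\<lambda>b p. sw sc (\<lambda>x y. sw sc (\<lambda>u v. ?G b (x * S v) (y * S u)) t) p) w =
        sc (\<epsilon> w) (sw sc (\<lambda>u v. F (S v) (S u)) t)" for w t
    proof -
      let ?H = "\<lambda>x y. sw sc (\<lambda>u v. F (x * S v) (y * S u)) t"
      have H: "lin scale sc (\<lambda>x. ?H x y)" "lin scale sc (\<lambda>y. ?H x y)" for x y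
        by (intro lin_intros vs F_lin)+
      have "sw sc (\<lambda>x y. sw sc (\<lambda>u v. ?G b (x * S v) (y * S u)) t) p = sw sc ?H (S b * p)" for b p
      proof -
        have "sw sc ?H (S b * p) = sw sc (\<lambda>g h. sw sc (\<lambda>x y. ?H (g * x) (h * y)) p) (S b)"
          by (rule sw_mult[OF vs H])
        also have "\<dots> = sw sc (\<lambda>x y. sw sc (\<lambda>g h. ?H (g * x) (h * y)) (S b)) p"
          by (rule sw_swap[OF vs])
        also have "\<dots> = sw sc (\<lambda>x y. sw sc (\<lambda>u v. ?G b (x * S v) (y * S u)) t) p"
          by (subst sw_swap[OF vs]) (simp add: mult.assoc)
        finally show ?thesis ..
      qed
      moreover have "sw sc (\<lambda>b p. sw sc ?H (S b * p)) w = sc (\<epsilon> w) (sw sc ?H 1)"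
        by (rule sw_antipode_left) (intro lin_intros vs H)
      ultimately show ?thesis using sw_one[OF vs H] by simp
    qed
    then show ?thesis by simp
  qed
  also have "\<dots> = sw sc (\<lambda>x y. F (S y) (S x)) a"
    by (rule sw_counit_left) (intro lin_intros vs F_lin)
  finally show ?thesis .
qed

end

section \<open>Integrals of a semisimple Hopf algebra\<close>

locale semisimple_hopf = hopf scale \<Delta> \<epsilon> S + semisimple_alg scale
  for scale :: "'k::field_char_0 \<Rightarrow> 'h::ring_1 \<Rightarrow> 'h" and \<Delta> \<epsilon> S +
  fixes \<Lambda> :: 'h
  assumes integral: "idempotent_integral scale \<epsilon> \<Lambda>"
begin

lemma \<Lambda>_left: "h * \<Lambda> = scale (\<epsilon> h) \<Lambda>" and \<Lambda>_nonzero: "\<Lambda> \<noteq> 0" and \<Lambda>_idem: "\<Lambda> * \<Lambda> = \<Lambda>"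
  using integral by (auto simp: idempotent_integral_def)

lemma \<epsilon>_\<Lambda>: "\<epsilon> \<Lambda> = 1"
  using \<Lambda>_left[of \<Lambda>] \<Lambda>_idem \<Lambda>_nonzero by (metis scale_cancel_right scale_one)

text \<open>The left integrals form a two-sided ideal, and \<open>\<Lambda>\<close> is its identity.\<close>

lemma \<Lambda>_central: "\<Lambda> * h = h * \<Lambda>"
proof -
  let ?I = "{x. \<forall>h. h * x = scale (\<epsilon> h) x}"
  have "left_ideal ?I"
    by (rule left_idealI)
      (simp, simp add: distrib_left scale_right_distrib, simp add: mult.assoc[symmetric] counit_mult scale_mult_r mult.commute)
  moreover have "x * h \<in> ?I" if "x \<in> ?I" for x h
    using that by (simp add: mult.assoc[symmetric] scale_mult_l)
  ultimately have "\<exists>l\<in>?I. (\<forall>h. l * h = h * l) \<and> (\<forall>x\<in>?I. l * x = x \<and> x * l = x)"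
    by (rule ideal_central_identity)
  then obtain l where l: "\<Lambda> * l = scale (\<epsilon> \<Lambda>) l" "l * h = h * l" "\<Lambda> * l = \<Lambda>"
    using \<Lambda>_left by blast
  then have "\<Lambda> = l" by (simp add: \<epsilon>_\<Lambda>)
  then show ?thesis using l by simp
qed

lemma \<Lambda>_right: "\<Lambda> * h = scale (\<epsilon> h) \<Lambda>"
  using \<Lambda>_central \<Lambda>_left by simp

text \<open>
  \<open>h \<Lambda>\<^sub>1 \<otimes> S(\<Lambda>\<^sub>2) = h\<^sub>1 \<Lambda>\<^sub>1 \<otimes> S(h\<^sub>2 \<Lambda>\<^sub>2) h\<^sub>3 = \<Lambda>\<^sub>1 \<otimes> S(\<Lambda>\<^sub>2) h\<close>, so averaging with
  \<open>\<Lambda>\<^sub>1 \<otimes> S(\<Lambda>\<^sub>2)\<close> produces \<open>H\<close>-linear maps and central elements.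
\<close>

lemma casimir:
  assumes vs: "vector_space sc" and F: "\<And>y. lin scale sc (\<lambda>x. F x y)" "\<And>x. lin scale sc (\<lambda>y. F x y)"
  shows "sw sc (\<lambda>x y. F (h * x) (S y)) \<Lambda> = sw sc (\<lambda>x y. F x (S y * h)) \<Lambda>"
proof -
  note F_lin = lin_comp[OF F(1)] lin_comp[OF F(2)]
  let ?G = "\<lambda>z. sw sc (\<lambda>x y. F x (S y * z))"
  have G: "lin scale sc (?G z)" for z by (intro lin_intros vs F_lin)
  have "sw sc (\<lambda>x y. F x (S y * h)) \<Lambda> = sw sc (\<lambda>h1 h2. sc (\<epsilon> h1) (?G h2 \<Lambda>)) h"
    by (rule sw_counit_left[symmetric]) (intro lin_intros vs F_lin)
  also have "\<dots> = sw sc (\<lambda>h1 h2. ?G h2 (h1 * \<Lambda>)) h"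
    by (simp add: \<Lambda>_left lin_on_scale[OF G])
  also have "\<dots> = sw sc (\<lambda>h1 h2. sw sc (\<lambda>p q. sw sc (\<lambda>x y. F (p * x) (S y * (S q * h2))) \<Lambda>) h1) h"
  proof -
    have "?G h2 (h1 * \<Lambda>) = sw sc (\<lambda>p q. sw sc (\<lambda>x y. F (p * x) (S (q * y) * h2)) \<Lambda>) h1" for h1 h2
      by (rule sw_mult) (intro lin_intros vs F_lin)+
    then show ?thesis by (simp add: S_mult mult.assoc)
  qed
  also have "\<dots> = sw sc (\<lambda>p r. sw sc (\<lambda>q h2. sw sc (\<lambda>x y. F (p * x) (S y * (S q * h2))) \<Lambda>) r) h"
    by (rule sw_coassoc) (intro lin_intros vs F_lin)+
  also have "\<dots> = sw sc (\<lambda>p r. sc (\<epsilon> r) (sw sc (\<lambda>x y. F (p * x) (S y * 1)) \<Lambda>)) h"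
  proof -
    have "sw sc (\<lambda>q h2. sw sc (\<lambda>x y. F (p * x) (S y * (S q * h2))) \<Lambda>) r =
        sc (\<epsilon> r) (sw sc (\<lambda>x y. F (p * x) (S y * 1)) \<Lambda>)" for p r
      by (rule sw_antipode_left) (intro lin_intros vs F_lin)
    then show ?thesis by simp
  qed
  also have "\<dots> = sw sc (\<lambda>x y. F (h * x) (S y * 1)) \<Lambda>"
    by (rule sw_counit_right) (intro lin_intros vs F_lin)
  finally show ?thesis by simp
qed

subsection \<open>Functionals and traces\<close>

lemma functional_ext:
  assumes "\<And>f. lin scale (*) f \<Longrightarrow> f a = f b" shows "a = b"
proof -
  obtain B where B: "finite B" "independent B" "span B = UNIV" by (rule finite_basis)
  have "representation B a c = representation B b c" for c
    using lin_on_representation[OF B(2)] B(3) by (intro assms) simp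
  then have "(\<Sum>c\<in>B. scale (representation B a c) c) = (\<Sum>c\<in>B. scale (representation B b c) c)"
    by simp
  moreover have "(\<Sum>c\<in>B. scale (representation B v c) c) = v" for v
    using B by (intro sum_representation_eq) auto
  ultimately show ?thesis by simp
qed

lemma Tr_sw:
  assumes "\<And>u v. lin scale scale (F u v)"
  shows "Tr (\<lambda>x. sw scale (\<lambda>u v. F u v x) h) = sw (*) (\<lambda>u v. Tr (F u v)) h"
  unfolding sw_eq by (rule Tr_sum) (rule assms)

text \<open>The antirepresentation of the dual algebra that is transposed to its left regular representation.\<close>

definition act :: "('h \<Rightarrow> 'k) \<Rightarrow> 'h \<Rightarrow> 'h" where
  "act f a = sw scale (\<lambda>x y. scale (f x) y) a"

lemma lin_act: "lin scale (*) f \<Longrightarrow> lin s scale g \<Longrightarrow> lin s scale (\<lambda>x. act f (g x))"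
  unfolding act_def by (intro lin_intros) (rule lin_comp, assumption, rule lin_id)

lemma act_linear: "lin scale scale g \<Longrightarrow> g (act f a) = sw scale (\<lambda>x y. scale (f x) (g y)) a"
  unfolding act_def by (subst sw_lin) (simp_all add: lin_on_scale)

text \<open>The functional of Larson and Radford, written \<open>\<lambda>\<close> in the comments.\<close>

definition lam :: "'h \<Rightarrow> 'k" where
  "lam h = Tr (\<lambda>x. h * S (S x))"

lemma lin_lam [lin_intros]: assumes "lin s scale f" shows "lin s (*) (\<lambda>x. lam (f x))"
proof (rule lin_comp[OF _ assms])
  show "lin scale (*) lam" unfolding lam_def[abs_def] by (rule lin_Tr) (intro lin_intros)+
qed

lemma sw_sum:
  assumes "vector_space sc"
  shows "(\<Sum>b\<in>B. sw sc (F b) a) = sw sc (\<lambda>x y. \<Sum>b\<in>B. F b x y) a"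
proof -
  interpret W: vector_space sc by fact
  show ?thesis unfolding sw_eq W.scale_sum_right by (rule sum.swap)
qed

text \<open>
  Since
  \<open>S\<^sup>2(x\<^sub>2) S(x\<^sub>1) = S(x\<^sub>1 S(x\<^sub>2))\<close>, one has
  \<open>f(h\<^sub>1) h\<^sub>2 S\<^sup>2(x) = f(h\<^sub>1 S\<^sup>2(x\<^sub>2) S(x\<^sub>1)) h\<^sub>2 S\<^sup>2(x\<^sub>3)\<close>. Expanding \<open>S(x\<^sub>1)\<close> in a basis exhibits the
  operator as a sum of products of three operators, and moving the first to the end, which does
  not change the trace, turns the argument of \<open>f\<close> into \<open>x\<^sub>1 S(x\<^sub>2)\<close>. Thus \<open>\<lambda>\<close> is an integral of
  the dual algebra.
\<close>

lemma lam_integral_functional: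
  assumes f: "lin scale (*) f"
  shows "sw (*) (\<lambda>u v. f u * lam v) h = f 1 * lam h"
proof -
  obtain B where B: "finite B" "independent B" "span B = UNIV" by (rule finite_basis)
  define c where "c b q = representation B q b" for b q
  have c: "lin scale (*) (c b)" for b
    unfolding c_def using lin_on_representation[OF B(2)] B(3) by simp
  have expand: "(\<Sum>b\<in>B. c b q * f (p * b)) = f (p * q)" for p q
  proof -
    have q: "(\<Sum>b\<in>B. scale (c b q) b) = q"
      unfolding c_def using B by (intro sum_representation_eq) auto
    have "lin scale (*) (\<lambda>z. f (p * z))" by (intro lin_comp[OF f] lin_intros)
    then have "f (p * (\<Sum>b\<in>B. scale (c b q) b)) = (\<Sum>b\<in>B. c b q * f (p * b))"
      by (simp add: lin_sum[of scale "(*)" "\<lambda>z. f (p * z)"] lin_on_scale[of scale "(*)" UNIV "\<lambda>z. f (p * z)"])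
    then show ?thesis by (simp add: q)
  qed
  note lins = lin_intros lin_comp[OF f] lin_comp[OF c]
  define fb where "fb b z = f (z * b)" for b z
  define cb where "cb b z = c b (S z)" for b z
  have lin_fb: "lin scale (*) (fb b)" and lin_cb: "lin scale (*) (cb b)" for b
    unfolding fb_def[abs_def] cb_def[abs_def] by (intro lins)+
  define T where "T x = h * S (S x)" for x
  have lin_T: "lin s scale g \<Longrightarrow> lin s scale (\<lambda>x. T (g x))" for s :: "'k \<Rightarrow> 'h \<Rightarrow> 'h" and g
    unfolding T_def by (intro lin_intros)
  have 1: "sw scale (\<lambda>u v. scale (f u) (v * S (S x))) h = (\<Sum>b\<in>B. act (fb b) (T (act (cb b) x)))" for x
  proof -
    have inner: "act (fb b) (h * S (S y)) =
        sw scale (\<lambda>u v. sw scale (\<lambda>p q. scale (f (u * S (S p) * b)) (v * S (S q))) y) h" for b y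
    proof -
      have "act (fb b) (h * S (S y)) =
          sw scale (\<lambda>u v. sw scale (\<lambda>p q. scale (f (u * p * b)) (v * q)) (S (S y))) h"
        unfolding act_def fb_def by (rule sw_mult) (intro lins)+
      also have "\<dots> = sw scale (\<lambda>u v. sw scale (\<lambda>p q. scale (f (u * S q * b)) (v * S p)) (S y)) h"
        by (subst S_comult) (intro lins refl)+
      also have "\<dots> = sw scale (\<lambda>u v. sw scale (\<lambda>p q. scale (f (u * S (S p) * b)) (v * S (S q))) y) h"
        by (subst S_comult) (intro lins refl)+
      finally show ?thesis .
    qed
    have "(\<Sum>b\<in>B. act (fb b) (T (act (cb b) x))) =
        (\<Sum>b\<in>B. sw scale (\<lambda>x1 x2. scale (c b (S x1)) (act (fb b) (h * S (S x2)))) x)"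
    proof (rule sum.cong[OF refl])
      fix b
      have "lin scale scale (\<lambda>y. act (fb b) (T y))" by (intro lin_act lin_fb lin_T lin_id)
      from act_linear[OF this]
      show "act (fb b) (T (act (cb b) x)) =
          sw scale (\<lambda>x1 x2. scale (c b (S x1)) (act (fb b) (h * S (S x2)))) x"
        by (simp add: T_def cb_def)
    qed
    also have "\<dots> = sw scale (\<lambda>x1 x2. \<Sum>b\<in>B. scale (c b (S x1)) (act (fb b) (h * S (S x2)))) x"
      by (rule sw_sum[OF vs_scale])
    also have "\<dots> = sw scale (\<lambda>x1 x2. sw scale (\<lambda>u v. sw scale (\<lambda>p q.
        scale (f (u * S (S p) * S x1)) (v * S (S q))) x2) h) x"
    proof -
      have "(\<Sum>b\<in>B. scale (c b (S x1)) (act (fb b) (h * S (S x2)))) =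
          sw scale (\<lambda>u v. sw scale (\<lambda>p q. scale (f (u * S (S p) * S x1)) (v * S (S q))) x2) h" for x1 x2
      proof -
        have "scale (c b (S x1)) (act (fb b) (h * S (S x2))) =
            sw scale (\<lambda>u v. sw scale (\<lambda>p q.
              scale (c b (S x1) * f (u * S (S p) * b)) (v * S (S q))) x2) h" for b
          unfolding inner by (simp add: sw_lin[OF lin_scale_right[OF lin_id]])
        then have "(\<Sum>b\<in>B. scale (c b (S x1)) (act (fb b) (h * S (S x2)))) =
            sw scale (\<lambda>u v. sw scale (\<lambda>p q.
              \<Sum>b\<in>B. scale (c b (S x1) * f (u * S (S p) * b)) (v * S (S q))) x2) h"
          by (simp add: sw_sum[OF vs_scale])
        then show ?thesis by (simp add: scale_sum_left[symmetric] expand)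
      qed
      then show ?thesis by simp
    qed
    also have "\<dots> = sw scale (\<lambda>u v. sw scale (\<lambda>x1 x2. sw scale (\<lambda>p q.
        scale (f (u * S (x1 * S p))) (v * S (S q))) x2) x) h"
      by (subst sw_swap[OF vs_scale]) (simp add: S_mult mult.assoc)
    also have "\<dots> = sw scale (\<lambda>u v. scale (f (u * S 1)) (v * S (S x))) h"
    proof -
      have "sw scale (\<lambda>x1 x2. sw scale (\<lambda>p q. scale (f (u * S (x1 * S p))) (v * S (S q))) x2) x =
          scale (f (u * S 1)) (v * S (S x))" for u v
        by (rule cancel_antipode_right[where F = "\<lambda>z q. scale (f (u * S z)) (v * S (S q))"]) (intro lins)+
      then show ?thesis by simp
    qed
    finally show ?thesis by (simp add: S_one)
  qed
  have 2: "(\<Sum>b\<in>B. act (cb b) (act (fb b) x)) = scale (f 1) x" for x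
  proof -
    have "(\<Sum>b\<in>B. act (cb b) (act (fb b) x)) =
        (\<Sum>b\<in>B. sw scale (\<lambda>x1 r. sw scale (\<lambda>y1 y2. scale (c b (S y1) * f (x1 * b)) y2) r) x)"
    proof (rule sum.cong[OF refl])
      fix b
      have "lin scale scale (act (cb b))" using lin_act[OF lin_cb lin_id] .
      from act_linear[OF this, of "fb b" x]
      show "act (cb b) (act (fb b) x) =
          sw scale (\<lambda>x1 r. sw scale (\<lambda>y1 y2. scale (c b (S y1) * f (x1 * b)) y2) r) x"
        by (simp add: act_def cb_def fb_def sw_lin[OF lin_scale_right[OF lin_id]] mult.commute)
    qed
    also have "\<dots> = sw scale (\<lambda>x1 r. sw scale (\<lambda>y1 y2. scale (f (x1 * S y1)) y2) r) x"
      by (simp add: sw_sum[OF vs_scale] scale_sum_left[symmetric] expand)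
    also have "\<dots> = scale (f 1) x"
      by (rule cancel_antipode_right[where F = "\<lambda>z y. scale (f z) y"]) (intro lins)+
    finally show ?thesis .
  qed
  have lin1: "lin scale scale (\<lambda>x. act (fb b) (T (act (cb b) x)))"
    "lin scale scale (\<lambda>x. T (act (cb b) x))" "lin scale scale (act (fb b))"
    "lin scale scale (\<lambda>x. T (act (cb b) (act (fb b) x)))" for b
    by (intro lin_act lin_T lin_fb lin_cb lin_id lin_act[OF lin_fb lin_id])+
  have "sw (*) (\<lambda>u v. f u * lam v) h = Tr (\<lambda>x. sw scale (\<lambda>u v. scale (f u) (v * S (S x))) h)"
    unfolding lam_def by (subst Tr_sw) (intro lin_intros, subst Tr_scale, (intro lin_intros refl)+)
  also have "\<dots> = (\<Sum>b\<in>B. Tr (\<lambda>x. act (fb b) (T (act (cb b) x))))"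
    unfolding 1 using Tr_sum[of B "\<lambda>b x. act (fb b) (T (act (cb b) x))" "\<lambda>_. 1"] lin1 by simp
  also have "\<dots> = (\<Sum>b\<in>B. Tr (\<lambda>x. T (act (cb b) (act (fb b) x))))"
    using Tr_commute[OF lin1(2) lin1(3)] by simp
  also have "\<dots> = Tr (\<lambda>x. \<Sum>b\<in>B. T (act (cb b) (act (fb b) x)))"
    using Tr_sum[of B "\<lambda>b x. T (act (cb b) (act (fb b) x))" "\<lambda>_. 1"] lin1 by simp
  also have "\<dots> = Tr (\<lambda>x. scale (f 1) (T x))"
  proof -
    have "(\<Sum>b\<in>B. T (act (cb b) (act (fb b) x))) = scale (f 1) (T x)" for x
      using lin_sum[OF lin_T[OF lin_id], of "\<lambda>b. act (cb b) (act (fb b) x)" B]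
      by (simp add: 2 lin_on_scale[OF lin_T[OF lin_id]])
    then show ?thesis by simp
  qed
  also have "\<dots> = f 1 * lam h"
    unfolding lam_def T_def by (rule Tr_scale) (intro lin_intros)
  finally show ?thesis .
qed

lemma lam_integral:
  assumes g: "lin scale sc g" shows "sw sc (\<lambda>u v. sc (lam v) (g u)) h = sc (lam h) (g 1)"
proof -
  have "sw scale (\<lambda>u v. scale (lam v) u) h = scale (lam h) 1"
  proof (rule functional_ext)
    fix f assume f: "lin scale (*) f"
    show "f (sw scale (\<lambda>u v. scale (lam v) u) h) = f (scale (lam h) 1)"
      using lam_integral_functional[OF f, of h]
      by (simp add: sw_lin[OF f] lin_on_scale[OF f] mult.commute)
  qed
  then have "g (sw scale (\<lambda>u v. scale (lam v) u) h) = g (scale (lam h) 1)" by simp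
  then show ?thesis by (simp add: sw_lin[OF g] lin_on_scale[OF g])
qed

lemma \<epsilon>_S: "\<epsilon> (S a) = \<epsilon> a"
proof -
  have "sw (*) (\<lambda>x y. \<epsilon> y * \<epsilon> (S x)) a = \<epsilon> (S a)" by (rule sw_counit_right) (intro lin_intros)
  moreover have "sw (*) (\<lambda>x y. \<epsilon> (S x * y)) a = \<epsilon> a * \<epsilon> 1" by (rule sw_antipode_left) (intro lin_intros)
  ultimately show ?thesis by (simp add: counit_mult counit_one mult.commute)
qed

lemma lam_\<Lambda>: "lam \<Lambda> = 1"
proof -
  have "lin scale (*) \<epsilon>" using lin_\<epsilon>[OF lin_id] .
  then show ?thesis
    by (simp add: lam_def \<Lambda>_right \<epsilon>_S Tr_rank_one \<epsilon>_\<Lambda>)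
qed

lemma lam_nakayama: "lam (a * b) = lam (b * S (S a))"
proof -
  have "Tr (\<lambda>x. a * (b * S (S x))) = Tr (\<lambda>x. b * S (S (a * x)))"
    by (rule Tr_commute) (intro lin_intros)+
  then show ?thesis by (simp add: lam_def S_mult mult.assoc)
qed

lemma lam_SS: "lam (S (S h)) = lam h"
  using lam_nakayama[of h 1] by simp

text \<open>\<open>a\<^sub>1 \<lambda>(b a\<^sub>2) = S(b\<^sub>1) b\<^sub>2 a\<^sub>1 \<lambda>(b\<^sub>3 a\<^sub>2) = S(b\<^sub>1) \<lambda>(b\<^sub>2 a)\<close>, as \<open>\<lambda>\<close> is an integral.\<close>

lemma lam_shift:
  assumes vs: "vector_space sc" and g: "lin scale sc g"
  shows "sw sc (\<lambda>a1 a2. sc (lam (b * a2)) (g a1)) a = sw sc (\<lambda>b1 b2. sc (lam (b2 * a)) (g (S b1))) b"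
proof -
  interpret W: vector_space sc by (rule vs)
  have lin_lam_left: "lin s sc (\<lambda>x. sc (lam (f x)) v)" if "lin s scale f" for s :: "'k \<Rightarrow> 'h \<Rightarrow> 'h" and f v
    using lin_lam[OF that] by (simp add: lin_on_def W.scale_left_distrib)
  have lin_right: "lin s sc (\<lambda>x. sc k (g (f x)))" if "lin s scale f" for s :: "'k \<Rightarrow> 'h \<Rightarrow> 'h" and f k
    using lin_comp[OF g that] by (simp add: lin_on_def W.scale_right_distrib mult.commute)
  note lins = lin_intros vs lin_lam_left lin_right lin_comp[OF g]
  let ?K = "\<lambda>z q. sw sc (\<lambda>x y. sc (lam (q * y)) (g (z * x))) a"
  have "sc (lam (b2 * a)) (g (S b1)) = sw sc (\<lambda>p q. ?K (S b1 * p) q) b2" for b1 b2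
  proof -
    have "sc (lam (b2 * a)) (g (S b1 * 1)) = sw sc (\<lambda>x y. sc (lam y) (g (S b1 * x))) (b2 * a)"
      by (rule lam_integral[symmetric]) (intro lins)
    also have "\<dots> = sw sc (\<lambda>p q. sw sc (\<lambda>x y. sc (lam (q * y)) (g (S b1 * (p * x)))) a) b2"
      by (rule sw_mult) (intro lins)+
    finally show ?thesis by (simp add: mult.assoc)
  qed
  then have "sw sc (\<lambda>b1 b2. sc (lam (b2 * a)) (g (S b1))) b =
      sw sc (\<lambda>b1 b2. sw sc (\<lambda>p q. ?K (S b1 * p) q) b2) b" by simp
  also have "\<dots> = ?K 1 b" by (rule cancel_antipode_left[OF vs]) (intro lins)+
  finally show ?thesis by simp
qed

text \<open>
  The case \<open>b = \<Lambda>\<close> of the preceding identity. It yields both the nondegeneracy of \<open>\<lambda>\<close> and the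
  surjectivity of the antipode.
\<close>

lemma lam_dual_bases: "sw scale (\<lambda>x y. scale (lam (y * a)) (S x)) \<Lambda> = a"
  using lam_shift[OF vs_scale lin_id, of \<Lambda> a]
  by (simp add: \<Lambda>_right lin_on_scale[OF lin_lam[OF lin_id]] lam_\<Lambda> counit_right)

lemma lam_nondegenerate: "(\<And>h. lam (h * c) = 0) \<Longrightarrow> c = 0"
  using lam_dual_bases[of c] by (simp add: sw_eq)

lemma S_surj: "surj S"
proof (rule surjI)
  show "S (sw scale (\<lambda>x y. scale (lam (y * a)) x) \<Lambda>) = a" for a
    using lam_dual_bases[of a] lin_S[OF lin_id]
    by (subst sw_lin[of scale scale]) (auto simp: lin_on_scale[OF lin_S[OF lin_id]])
qed

lemma S_inj: "inj S"
  by (rule surjective_imp_injective[OF lin_S[OF lin_id] S_surj])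

lemma lam_S_integral:
  assumes g: "lin scale sc g" shows "sw sc (\<lambda>x y. sc (lam (S x)) (g y)) h = sc (lam (S h)) (g 1)"
proof -
  have "S (sw scale (\<lambda>x y. scale (lam (S x)) y) h) = sw scale (\<lambda>x y. scale (lam (S x)) (S y)) h"
    by (simp add: sw_lin[OF lin_S[OF lin_id]] lin_on_scale[OF lin_S[OF lin_id]])
  also have "\<dots> = sw scale (\<lambda>x y. scale (lam y) x) (S h)"
    by (rule S_comult[symmetric]) (intro lin_intros)+
  also have "\<dots> = scale (lam (S h)) 1" by (rule lam_integral[OF lin_id])
  also have "\<dots> = S (scale (lam (S h)) 1)"
    by (simp add: lin_on_scale[OF lin_S[OF lin_id]] S_one)
  finally have "sw scale (\<lambda>x y. scale (lam (S x)) y) h = scale (lam (S h)) 1"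
    using S_inj by (simp add: inj_eq)
  then have "g (sw scale (\<lambda>x y. scale (lam (S x)) y) h) = g (scale (lam (S h)) 1)" by simp
  then show ?thesis by (simp add: sw_lin[OF g] lin_on_scale[OF g])
qed

lemma lam_nondegenerate_right: assumes "\<And>h. lam (c * h) = 0" shows "c = 0"
proof -
  have "S (S c) = 0" using assms by (intro lam_nondegenerate) (simp add: lam_nakayama[symmetric])
  then show ?thesis using S_inj lin_on_zero[OF lin_S[OF lin_id]] by (metis UNIV_I inj_eq)
qed

subsection \<open>The distinguished group-like element\<close>

text \<open>
  The element that represents \<open>\<lambda> \<circ> S\<close> through \<open>\<lambda>\<close>. It turns out to be group-like and to measure
  how far \<open>\<lambda>\<close> is from a right integral; it is written \<open>g\<close> in the comments.
\<close>

definition gl :: 'h where "gl = (SOME g. \<forall>a. lam (S a) = lam (g * a))"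

lemma lam_S: "lam (S a) = lam (gl * a)"
proof -
  have "lin scale (*) lam" "lin scale (*) (\<lambda>a. lam (S a))"
    using lin_lam[OF lin_id] lin_lam[OF lin_S[OF lin_id]] by auto
  from functional_representable[OF this(1) lam_nondegenerate this(2)]
  obtain c where c: "\<And>a. lam (S a) = lam (a * c)" by blast
  obtain g where "c = S (S g)" using S_surj by (metis surjD)
  then have "\<forall>a. lam (S a) = lam (g * a)" using c lam_nakayama by simp
  then have "\<forall>a. lam (S a) = lam (gl * a)" unfolding gl_def by (rule someI)
  then show ?thesis by blast
qed

text \<open>
  Evaluate \<open>\<lambda>(S(a\<^sub>1)) \<lambda>(b a\<^sub>2)\<close> in two ways: \<open>\<lambda> \<circ> S\<close> is an integral on the other side, which gives
  \<open>\<lambda>(S(a)) \<lambda>(b) = \<lambda>(g a) \<lambda>(b)\<close>, while \<open>lam_shift\<close> gives \<open>\<lambda>(b\<^sub>1) \<lambda>(b\<^sub>2 a)\<close>.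
\<close>

lemma lam_right: "sw scale (\<lambda>x y. scale (lam x) y) b = scale (lam b) gl"
proof -
  have "lam ((sw scale (\<lambda>x y. scale (lam x) y) b - scale (lam b) gl) * a) = 0" for a
  proof -
    have L: "lin scale (*) (\<lambda>z. lam (z * a))" "lin scale (*) (\<lambda>z. lam (S z))" "lin scale (*) (\<lambda>z. lam (b * z))"
      by (intro lin_intros)+
    have "lam (sw scale (\<lambda>x y. scale (lam x) y) b * a) = sw (*) (\<lambda>x y. lam (y * a) * lam (S (S x))) b"
      by (subst sw_lin[OF L(1)]) (simp add: lin_on_scale[OF L(1)] lam_SS mult.commute)
    also have "\<dots> = sw (*) (\<lambda>a1 a2. lam (b * a2) * lam (S a1)) a"
      by (rule lam_shift[OF vs_field L(2), symmetric])
    also have "\<dots> = lam (S a) * lam (b * 1)"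
      using lam_S_integral[OF L(3), of a] by (simp add: mult.commute)
    also have "\<dots> = lam (scale (lam b) gl * a)"
      by (simp add: lam_S lin_on_scale[OF L(1)] mult.commute)
    finally show ?thesis by (simp add: lin_on_diff[OF L(1)] left_diff_distrib lin_on_diff[OF lin_lam[OF lin_id]])
  qed
  then have "sw scale (\<lambda>x y. scale (lam x) y) b - scale (lam b) gl = 0" by (rule lam_nondegenerate_right)
  then show ?thesis by simp
qed

lemma gl_eq: "gl = sw scale (\<lambda>x y. scale (lam x) y) \<Lambda>"
  by (simp add: lam_right lam_\<Lambda>)

lemma \<epsilon>_gl: "\<epsilon> gl = 1"
proof -
  have E: "lin scale (*) \<epsilon>" by (rule lin_\<epsilon>[OF lin_id])
  have "\<epsilon> gl = sw (*) (\<lambda>x y. \<epsilon> y * lam x) \<Lambda>"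
    by (subst gl_eq) (simp add: sw_lin[OF E] lin_on_scale[OF E] mult.commute)
  also have "\<dots> = lam \<Lambda>" by (rule sw_counit_right[OF lin_lam[OF lin_id]])
  finally show ?thesis by (simp add: lam_\<Lambda>)
qed

text \<open>
  By \<open>lam_right\<close> and coassociativity,
  \<open>\<Delta>(g) = \<lambda>(\<Lambda>\<^sub>1) \<Lambda>\<^sub>2 \<otimes> \<Lambda>\<^sub>3 = \<lambda>(\<Lambda>\<^sub>1) g \<otimes> \<Lambda>\<^sub>2 = g \<otimes> g\<close>.
\<close>

lemma sw_gl:
  assumes vs: "vector_space sc" and F: "\<And>y. lin scale sc (\<lambda>x. F x y)" "\<And>x. lin scale sc (\<lambda>y. F x y)"
  shows "sw sc F gl = F gl gl"
proof -
  interpret W: vector_space sc by (rule vs)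
  note F_lin = lin_comp[OF F(1)] lin_comp[OF F(2)]
  have lin_lam_left: "lin s sc (\<lambda>x. sc (lam (f x)) v)" if "lin s scale f" for s :: "'k \<Rightarrow> 'h \<Rightarrow> 'h" and f v
    using lin_lam[OF that] by (simp add: lin_on_def W.scale_left_distrib)
  have lin_right: "lin s sc (\<lambda>x. sc k (f x))" if "lin s sc f" for s :: "'k \<Rightarrow> 'h \<Rightarrow> 'h" and f k
    using that by (simp add: lin_on_def W.scale_right_distrib mult.commute)
  have lin_sc: "lin sc sc (\<lambda>w. sc k w)" for k
    by (simp add: lin_on_def W.scale_right_distrib mult.commute)
  have lsw: "lin scale sc (sw sc F)" by (intro lin_intros vs F_lin)
  have "sw sc F gl = sw sc (\<lambda>x r. sw sc (\<lambda>u v. sc (lam x) (F u v)) r) \<Lambda>"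
    by (subst gl_eq)
      (simp add: sw_lin[OF lsw] lin_on_scale[OF lsw] sw_lin[OF lin_sc])
  also have "\<dots> = sw sc (\<lambda>p v. sw sc (\<lambda>x u. sc (lam x) (F u v)) p) \<Lambda>"
    by (rule sw_coassoc[symmetric]) (intro lin_intros vs F_lin lin_lam_left lin_right)+
  also have "\<dots> = sw sc (\<lambda>p v. sc (lam p) (F gl v)) \<Lambda>"
  proof -
    have "sw sc (\<lambda>x u. sc (lam x) (F u v)) p = sc (lam p) (F gl v)" for p v
      using arg_cong[OF lam_right[of p], of "\<lambda>z. F z v"]
      by (simp add: sw_lin[OF F(1)] lin_on_scale[OF F(1)])
    then show ?thesis by simp
  qed
  also have "\<dots> = F gl gl"
    using arg_cong[OF gl_eq, of "F gl"] by (simp add: sw_lin[OF F(2)] lin_on_scale[OF F(2)])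
  finally show ?thesis .
qed

lemma S_gl: "S gl * gl = 1" "gl * S gl = 1"
proof -
  have "sw scale (\<lambda>x y. S x * y) gl = S gl * gl" by (rule sw_gl) (intro lin_intros)+
  then show "S gl * gl = 1" by (simp add: antipode_left \<epsilon>_gl)
  have "sw scale (\<lambda>x y. x * S y) gl = gl * S gl" by (rule sw_gl) (intro lin_intros)+
  then show "gl * S gl = 1" by (simp add: antipode_right \<epsilon>_gl)
qed

lemma SS_gl: "S (S gl) = gl"
proof -
  have "S (S gl) * S gl = 1" by (metis S_gl(2) S_mult S_one)
  then show ?thesis by (metis S_gl(1) mult.assoc mult_1 mult_1_right)
qed

text \<open>
  Radford's formula for \<open>S\<^sup>4\<close>: evaluate \<open>\<lambda>(S(h k))\<close> by the definition of \<open>g\<close> and by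
  antimultiplicativity of the antipode.
\<close>

lemma S_fourth: "gl * S (S (S (S k))) = k * gl"
proof -
  have "lam (h * (k * gl - gl * S (S (S (S k))))) = 0" for h
  proof -
    have "lam (h * (k * gl)) = lam (S (h * k))"
      using lam_nakayama[of gl "h * k"] by (simp add: lam_S SS_gl mult.assoc)
    also have "\<dots> = lam (S (S (S k) * h))"
      using lam_nakayama[of "S k" "S h"] by (simp add: S_mult)
    also have "\<dots> = lam (gl * S (S k) * h)" by (simp only: lam_S mult.assoc)
    also have "\<dots> = lam (h * (gl * S (S (S (S k)))))"
      using lam_nakayama[of "gl * S (S k)" h] by (simp add: S_mult SS_gl)
    finally show ?thesis
      by (simp add: right_diff_distrib lin_on_diff[OF lin_lam[OF lin_id]])
  qed
  then have "k * gl - gl * S (S (S (S k))) = 0" by (rule lam_nondegenerate)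
  then show ?thesis by simp
qed

lemma sw_gl_power:
  assumes vs: "vector_space sc" and F: "\<And>y. lin scale sc (\<lambda>x. F x y)" "\<And>x. lin scale sc (\<lambda>y. F x y)"
  shows "sw sc F (gl ^ j) = F (gl ^ j) (gl ^ j)"
  using F
proof (induction j arbitrary: F)
  case 0
  then show ?case using sw_one[OF vs] by simp
next
  case (Suc j)
  note F_lin = lin_comp[OF Suc.prems(1)] lin_comp[OF Suc.prems(2)]
  have "sw sc F (gl * gl ^ j) = sw sc (\<lambda>x y. sw sc (\<lambda>u v. F (x * u) (y * v)) (gl ^ j)) gl"
    by (rule sw_mult[OF vs Suc.prems])
  also have "\<dots> = sw sc (\<lambda>x y. F (x * gl ^ j) (y * gl ^ j)) gl"
    by (subst Suc.IH) (intro lin_intros vs F_lin refl)+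
  also have "\<dots> = F (gl * gl ^ j) (gl * gl ^ j)"
    by (rule sw_gl) (intro lin_intros vs F_lin)+
  finally show ?case by simp
qed

lemma \<epsilon>_gl_power: "\<epsilon> (gl ^ j) = 1"
  by (induction j) (simp_all add: counit_one counit_mult \<epsilon>_gl)

lemma act_gl_power:
  assumes f: "lin scale (*) f" shows "act f (gl ^ j) = scale (f (gl ^ j)) (gl ^ j)"
  unfolding act_def by (rule sw_gl_power) (intro lin_intros lin_comp[OF f])+

text \<open>The integral property at a group-like element; \<open>\<lambda>\<close> vanishes there unless the element is \<open>1\<close>.\<close>

lemma lam_gl_power: "scale (lam (gl ^ j)) (gl ^ j) = scale (lam (gl ^ j)) 1"
proof -
  have "sw scale (\<lambda>u v. scale (lam v) u) (gl ^ j) = scale (lam (gl ^ j)) (gl ^ j)"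
    by (rule sw_gl_power) (intro lin_intros)+
  then show ?thesis using lam_integral[OF lin_id, of "gl ^ j"] by simp
qed

text \<open>
  Group-like elements are common eigenvectors of the operators \<open>act f\<close>, and their eigenvalues,
  which are the values of \<open>f\<close>, separate them.
\<close>

lemma gl_powers_independent:
  assumes "finite J" "inj_on (\<lambda>j. gl ^ j) J" shows "independent ((\<lambda>j. gl ^ j) ` J)"
  using assms
proof (induction J rule: finite_induct)
  case (insert j J)
  let ?G = "(\<lambda>j. gl ^ j) ` J"
  have ind: "independent ?G" and fin: "finite ?G" using insert by (auto simp: inj_on_insert)
  have "gl ^ j \<notin> span ?G"
  proof
    assume "gl ^ j \<in> span ?G"
    then obtain u where u: "gl ^ j = (\<Sum>x\<in>?G. scale (u x) x)" using span_finite[OF fin] by auto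
    have "u x * f (gl ^ j) = u x * f x" if x: "x \<in> ?G" and f: "lin scale (*) f" for x f
    proof -
      have A: "lin scale scale (act f)" by (rule lin_act[OF f lin_id])
      have "(\<Sum>x\<in>?G. scale (u x * f (gl ^ j)) x) = scale (f (gl ^ j)) (\<Sum>x\<in>?G. scale (u x) x)"
        by (simp add: scale_sum_right mult.commute)
      also have "\<dots> = act f (\<Sum>x\<in>?G. scale (u x) x)"
        unfolding u[symmetric] by (rule act_gl_power[OF f, symmetric])
      also have "\<dots> = (\<Sum>x\<in>?G. scale (u x) (act f x))"
        by (simp only: lin_sum[OF A] lin_on_scale[OF A] UNIV_I)
      also have "\<dots> = (\<Sum>x\<in>?G. scale (u x * f x) x)"
        by (intro sum.cong) (auto simp: act_gl_power[OF f])
      finally have "(\<Sum>x\<in>?G. scale (u x * f (gl ^ j) - u x * f x) x) = 0"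
        by (simp add: scale_left_diff_distrib sum_subtractf)
      then show ?thesis using independentD[OF ind fin subset_refl _ x] by fastforce
    qed
    note eq = this
    have "gl ^ j \<noteq> 0" using \<epsilon>_gl_power[of j] lin_on_zero[OF lin_\<epsilon>[OF lin_id]] by force
    then obtain x where x: "x \<in> ?G" "u x \<noteq> 0" using u by (metis (no_types, lifting) scale_zero_left sum.neutral)
    have "gl ^ j = x" by (rule functional_ext) (use eq[OF x(1)] x(2) in auto)
    then show False using x(1) insert by (auto simp: inj_on_insert)
  qed
  then show ?case using ind by (simp add: independent_insert)
qed (simp add: independent_empty)

lemma gl_finite_order: "\<exists>N>0. gl ^ N = 1"
proof -
  have "\<not> inj_on (\<lambda>j. gl ^ j) {..dim UNIV}"
  proof
    assume inj: "inj_on (\<lambda>j. gl ^ j) {..dim UNIV}"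
    obtain B where B: "finite B" "independent B" "span B = UNIV" "card B = dim UNIV" by (rule finite_basis)
    have "card ((\<lambda>j. gl ^ j) ` {..dim UNIV}) \<le> card B"
      using independent_span_bound[OF B(1) gl_powers_independent[OF _ inj]] B by auto
    then show False using inj B by (simp add: card_image)
  qed
  then obtain i j where ij: "i < j" "gl ^ i = gl ^ j"
    unfolding inj_on_def by (metis linorder_neqE_nat)
  have cancel: "(S gl) ^ m * gl ^ m = 1" for m
    by (induction m) (simp, metis S_gl(1) mult.assoc mult_1_right power_Suc power_Suc2)
  have "gl ^ j = gl ^ i * gl ^ (j - i)" using ij by (metis power_add le_add_diff_inverse less_imp_le)
  then have "(S gl) ^ i * gl ^ i = (S gl) ^ i * gl ^ i * gl ^ (j - i)"
    using ij by (simp add: mult.assoc)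
  then have "gl ^ (j - i) = 1" by (simp add: cancel)
  then show ?thesis using ij by (intro exI[of _ "j - i"]) simp
qed

end

section \<open>The antipode is an involution\<close>

locale hopf_family =
  semisimple_hopf scale \<Delta> \<epsilon> S \<Lambda> + simple_family scale scaleV n V \<rho> e \<chi> d
  for scale :: "'k::{alg_closed_field, field_char_0} \<Rightarrow> 'h::ring_1 \<Rightarrow> 'h" and \<Delta> \<epsilon> S \<Lambda>
    and scaleV :: "'k \<Rightarrow> 'v::ab_group_add \<Rightarrow> 'v" and n V \<rho> e \<chi> d
begin

lemma square_root_exists: "\<exists>y. y * y = (x::'k)"
proof -
  have "degree [:- x, 0, 1:] = 2" by simp
  then obtain y where "poly [:- x, 0, 1:] y = 0" using alg_closed_imp_poly_has_root[of "[:- x, 0, 1:]"] by auto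
  then show ?thesis by (auto simp: algebra_simps)
qed

text \<open>Compare \<open>\<lambda>(h k) = \<lambda>(k S\<^sup>2(h))\<close> with the symmetry of the regular character.\<close>

lemma antipode_square_inner: "\<exists>w. (\<forall>h. w * h = S (S h) * w) \<and> (\<forall>h. lam h = chi_reg (h * w))"
proof -
  obtain w where w: "\<And>h. lam h = chi_reg (h * w)"
    using functional_representable[OF lin_chi_reg chi_reg_nondegenerate lin_lam[OF lin_id]] by blast
  have "w * h = S (S h) * w" for h
  proof -
    have "chi_reg (k * (w * h - S (S h) * w)) = 0" for k
    proof -
      have "chi_reg (k * (w * h)) = lam (h * k)"
        using chi_reg_commute[of "k * w" h] by (simp add: w mult.assoc)
      moreover have "chi_reg (k * (S (S h) * w)) = lam (k * S (S h))" by (simp add: w mult.assoc)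
      ultimately show ?thesis
        by (simp add: right_diff_distrib lin_on_diff[OF lin_chi_reg] lam_nakayama[symmetric])
    qed
    then have "w * h - S (S h) * w = 0" by (rule chi_reg_nondegenerate)
    then show ?thesis by simp
  qed
  then show ?thesis using w by blast
qed

text \<open>
  By Radford's formula \<open>g w\<^sup>2\<close> is central when \<open>S\<^sup>2\<close> is conjugation by \<open>w\<close>; dividing \<open>w\<close> by a
  central square root normalizes it.
\<close>

lemma antipode_square_normalized:
  "\<exists>w. (\<forall>h. w * h = S (S h) * w) \<and> gl * (w * w) = 1"
proof -
  obtain w where w: "\<And>h. w * h = S (S h) * w" and lam_w: "\<And>h. lam h = chi_reg (h * w)"
    using antipode_square_inner by blast
  define z where "z = gl * (w * w)"
  have z: "z * k = k * z" for k
  proof -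
    have "w * (w * k) = w * S (S k) * w" by (simp only: w[of k] mult.assoc)
    also have "\<dots> = S (S (S (S k))) * (w * w)" by (simp only: w[of "S (S k)"] mult.assoc)
    finally have "z * k = gl * S (S (S (S k))) * (w * w)" by (simp add: z_def mult.assoc)
    then show ?thesis by (simp add: S_fourth z_def mult.assoc)
  qed
  obtain c where c: "z = (\<Sum>i<n. scale (c i) (e i))" using central_decomposition[OF z] by blast
  have c_ne: "c i \<noteq> 0" if i: "i < n" for i
  proof
    assume "c i = 0"
    then have "z * e i = 0" using combination_mult_e[OF i] c by simp
    then have "S gl * gl * (w * w * e i) = 0" by (simp add: z_def mult.assoc)
    then have "w * w * e i = 0" by (simp add: S_gl)
    then have "lam (h * (e i * w)) = 0" for h
      using e_central[OF i] by (simp add: lam_w mult.assoc lin_on_zero[OF lin_chi_reg])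
    then have "e i * w = 0" by (rule lam_nondegenerate)
    then have "lam (h * e i) = 0" for h by (simp add: lam_w mult.assoc lin_on_zero[OF lin_chi_reg])
    then have "e i = 0" by (rule lam_nondegenerate)
    then show False using e_nonzero[OF i] by simp
  qed
  define b where "b i = (SOME y. y * y = inverse (c i))" for i
  have b: "b i * b i = inverse (c i)" for i
    unfolding b_def by (rule someI_ex[OF square_root_exists])
  define y where "y = (\<Sum>i<n. scale (b i) (e i))"
  have y: "y * k = k * y" for k
    unfolding y_def sum_distrib_right sum_distrib_left
    by (intro sum.cong) (auto simp: scale_mult_l scale_mult_r e_central)
  have yyz: "y * y * z = 1"
  proof (rule faithful)
    fix i v assume i: "i < n" and v: "v \<in> V i"
    have yv: "\<rho> i y u = scaleV (b i) u" and zv: "\<rho> i z u = scaleV (c i) u" if "u \<in> V i" for u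
      unfolding y_def c using combination_acts[OF i that] by auto
    show "\<rho> i (y * y * z) v = \<rho> i 1 v"
      using v c_ne[OF i] V.subspace_scale[OF subspace_V[OF i]] b[of i]
      by (simp add: \<rho>_mult[OF i] \<rho>_one[OF i] yv zv mult.assoc[symmetric])
  qed
  have "y * w * h = S (S h) * (y * w)" for h
  proof -
    have "y * w * h = y * S (S h) * w" by (simp add: mult.assoc w)
    also have "\<dots> = S (S h) * y * w" by (simp only: y)
    finally show ?thesis by (simp only: mult.assoc)
  qed
  moreover have "gl * (y * w * (y * w)) = 1"
  proof -
    have "gl * (y * w * (y * w)) = gl * y * (w * y) * w" by (simp only: mult.assoc)
    also have "\<dots> = y * gl * (y * w) * w" by (simp only: y)
    also have "\<dots> = y * (gl * y) * (w * w)" by (simp only: mult.assoc)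
    also have "\<dots> = y * (y * gl) * (w * w)" by (simp only: y)
    also have "\<dots> = y * y * z" by (simp only: z_def mult.assoc)
    finally show ?thesis by (simp only: yyz)
  qed
  ultimately show ?thesis by blast
qed

text \<open>The remaining sign in each block is chosen arbitrarily.\<close>

definition w :: 'h where "w = (SOME w. (\<forall>h. w * h = S (S h) * w) \<and> gl * (w * w) = 1)"

lemma w_mult: "w * h = S (S h) * w" and gl_w_w: "gl * (w * w) = 1"
  using someI_ex[OF antipode_square_normalized] unfolding w_def[symmetric] by blast+

lemma w_gl: "w * gl = gl * w"
  by (simp add: w_mult SS_gl)

lemma SS_eq: "S (S x) = w * x * (gl * w)"
proof -
  have "w * (gl * w) = 1" by (metis gl_w_w mult.assoc w_gl)
  then show ?thesis by (simp add: w_mult mult.assoc)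
qed

lemma lam_characters: "lam h = (\<Sum>i<n. of_rat (block_weight i) * \<chi> i (h * w) * \<chi> i (gl * w))"
  unfolding bimodule_trace[symmetric] lam_def by (simp add: SS_eq mult.assoc)

text \<open>
  If \<open>\<lambda>(1) = 0\<close> then \<open>\<lambda>\<close> vanishes on all powers of \<open>g\<close>
  and hence on its spectral idempotents \<open>E\<^sub>\<omega>\<close>. As \<open>w\<^sup>2 = g\<inverse>\<close>, up to a square root of \<open>\<omega>\<close> the
  element \<open>E\<^sub>\<omega> w\<close> is an involution on the image of \<open>E\<^sub>\<omega>\<close>, with integer traces. The equations
  \<open>\<lambda>(E\<^sub>\<omega>) = 0\<close> say that the vector of the \<open>\<chi>\<^sub>i(g w)\<close>, which lies in the span of the integer
  vectors formed by these traces, is orthogonal to them with respect to the block weights. So it is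
  \<open>0\<close>, and with it \<open>\<lambda>\<close>.
\<close>

lemma lam_one_nonzero: "lam 1 \<noteq> 0"
proof
  assume lam1: "lam 1 = 0"
  have lam_pow: "lam (gl ^ j) = 0" for j
  proof (rule ccontr)
    assume ne: "lam (gl ^ j) \<noteq> 0"
    then have "gl ^ j = 1" using lam_gl_power[of j] by simp
    then show False using ne lam1 by simp
  qed
  obtain N where N: "N > 0" "gl ^ N = 1" using gl_finite_order by blast
  define \<Omega> where "\<Omega> = {\<omega>::'k. \<omega> ^ N = 1}"
  have finite: "finite \<Omega>"
  proof -
    have "monom 1 N - (1::'k poly) \<noteq> 0"
    proof
      assume "monom 1 N - (1::'k poly) = 0"
      then have "coeff (monom 1 N) N = coeff (1 :: 'k poly) N" by simp
      then show False using N by simp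
    qed
    from poly_roots_finite[OF this] show ?thesis by (simp add: \<Omega>_def poly_monom)
  qed
  have \<Omega>: "\<omega> \<noteq> 0" "\<omega> ^ N = 1" if "\<omega> \<in> \<Omega>" for \<omega> using that N by (auto simp: \<Omega>_def power_0_left)
  define E where "E \<omega> = (\<Sum>j<N. scale (inverse (of_nat N) * inverse \<omega> ^ j) (gl ^ j))" for \<omega> :: 'k
  (* cyclic shift of the summation index, as the Nth summand equals the 0th *)
  have gl_E: "gl * E \<omega> = scale \<omega> (E \<omega>)" if "\<omega> \<in> \<Omega>" for \<omega>
  proof -
    define F where "F j = scale (inverse (of_nat N) * inverse \<omega> ^ j) (gl ^ j)" for j
    have F: "F N = F 0" using N \<Omega>[OF that] by (simp add: F_def power_inverse)
    have "gl * E \<omega> = (\<Sum>j<N. scale (inverse (of_nat N) * inverse \<omega> ^ j) (gl ^ Suc j))"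
      by (simp add: E_def sum_distrib_left scale_mult_r)
    also have "\<dots> = (\<Sum>j<N. scale \<omega> (F (Suc j)))"
      using \<Omega>[OF that] by (intro sum.cong) (auto simp: F_def)
    also have "\<dots> = scale \<omega> (\<Sum>j<N. F (Suc j))" by (simp add: scale_sum_right)
    also have "(\<Sum>j<N. F (Suc j)) = (\<Sum>j<N. F j)"
      using sum.lessThan_Suc[of F N] sum.lessThan_Suc_shift[of F N] F by simp
    finally show ?thesis by (simp add: E_def F_def)
  qed
  have gl_pow_E: "gl ^ j * E \<omega> = scale (\<omega> ^ j) (E \<omega>)" if "\<omega> \<in> \<Omega>" for j \<omega>
    by (induction j) (simp_all add: mult.assoc gl_E[OF that] scale_mult_r mult.commute)
  have comm: "E \<omega> * x = x * E \<omega>" if x: "gl * x = x * gl" for \<omega> x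
  proof -
    have "gl ^ j * x = x * gl ^ j" for j
      using x by (induction j) (simp, metis mult.assoc power_Suc power_Suc2)
    then show ?thesis by (simp add: E_def sum_distrib_left sum_distrib_right scale_mult_l scale_mult_r)
  qed
  have E_mult: "E \<omega> * x = x" if "gl * x = scale \<omega> x" "\<omega> \<in> \<Omega>" for \<omega> x
  proof -
    have "gl ^ j * x = scale (\<omega> ^ j) x" for j
      by (induction j) (simp_all add: mult.assoc that scale_mult_r mult.commute)
    then have "E \<omega> * x = (\<Sum>j<N. scale (inverse (of_nat N)) x)"
      unfolding E_def sum_distrib_right using \<Omega>[OF that(2)]
      by (intro sum.cong) (auto simp: scale_mult_l power_inverse)
    also have "\<dots> = scale (\<Sum>j<N. inverse (of_nat N)) x" by (rule scale_sum_left[symmetric])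
    finally show ?thesis using N by simp
  qed
  have E_idem: "E \<omega> * E \<omega> = E \<omega>" if "\<omega> \<in> \<Omega>" for \<omega> using E_mult[OF gl_E that] that by simp
  have E_gl: "E \<omega> * gl = gl * E \<omega>" for \<omega> by (rule comm) simp
  have E_orth: "E \<omega>' * E \<omega> = 0" if "\<omega> \<in> \<Omega>" "\<omega>' \<in> \<Omega>" "\<omega> \<noteq> \<omega>'" for \<omega> \<omega>'
  proof -
    have "scale \<omega>' (E \<omega>' * E \<omega>) = gl * E \<omega>' * E \<omega>" using gl_E[OF that(2)] by (simp add: scale_mult_l)
    also have "\<dots> = E \<omega>' * (gl * E \<omega>)" by (simp only: E_gl[symmetric] mult.assoc)
    also have "\<dots> = scale \<omega> (E \<omega>' * E \<omega>)" using gl_E[OF that(1)] by (simp add: scale_mult_r)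
    finally show ?thesis using that(3) by simp
  qed
  (* an eigenvector of g in the common kernel of the idempotents would be fixed by one of them *)
  have E_sum: "(\<Sum>\<omega>\<in>\<Omega>. E \<omega>) = 1"
  proof (rule ccontr)
    assume ne: "(\<Sum>\<omega>\<in>\<Omega>. E \<omega>) \<noteq> 1"
    define M where "M = {x. \<forall>\<omega>\<in>\<Omega>. E \<omega> * x = 0}"
    have "subspace M" by (rule subspaceI) (auto simp: M_def distrib_left scale_mult_r)
    then have fin_M: "fin_dim M" by (rule fin_dim_sub[OF fin]) simp
    have "1 - (\<Sum>\<omega>\<in>\<Omega>. E \<omega>) \<in> M"
    proof -
      have "E \<omega> * (\<Sum>\<omega>'\<in>\<Omega>. E \<omega>') = E \<omega>" if \<omega>: "\<omega> \<in> \<Omega>" for \<omega>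
      proof -
        have "E \<omega> * (\<Sum>\<omega>'\<in>\<Omega>. E \<omega>') = (\<Sum>\<omega>'\<in>\<Omega>. E \<omega> * E \<omega>')" by (rule sum_distrib_left)
        also have "\<dots> = (\<Sum>\<omega>'\<in>\<Omega>. if \<omega>' = \<omega> then E \<omega> else 0)"
          using \<omega> by (intro sum.cong) (auto simp: E_idem E_orth)
        finally show ?thesis using \<omega> finite by simp
      qed
      then show ?thesis by (simp add: M_def right_diff_distrib)
    qed
    moreover have "1 - (\<Sum>\<omega>\<in>\<Omega>. E \<omega>) \<noteq> 0" using ne by simp
    ultimately have "M \<noteq> {0}" by blast
    moreover have "(\<lambda>x. gl * x) ` M \<subseteq> M"
    proof -
      have "E \<omega> * (gl * x) = gl * (E \<omega> * x)" for \<omega> x by (simp only: mult.assoc[symmetric] E_gl)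
      then show ?thesis by (auto simp: M_def)
    qed
    moreover have "lin_on scale scale M (\<lambda>x. gl * x)"
      by (rule lin_on_subset[of _ _ UNIV]) (auto intro: lin_intros)
    ultimately obtain x c where x: "x \<in> M" "x \<noteq> 0" "gl * x = scale c x"
      using eigenvector_exists[OF vector_space_axioms fin_M] by blast
    have "gl ^ j * x = scale (c ^ j) x" for j
      by (induction j) (simp_all add: mult.assoc x scale_mult_r mult.commute)
    from this[of N] have "scale (c ^ N) x = scale 1 x" using N by simp
    then have "c ^ N = 1" using x(2) scale_cancel_right by blast
    then have c: "c \<in> \<Omega>" by (simp add: \<Omega>_def)
    then show False using E_mult[OF x(3) c] x(1,2) by (simp add: M_def)
  qed
  define s where "s \<omega> = (SOME y. y * y = inverse \<omega>)" for \<omega> :: 'k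
  have s: "s \<omega> * s \<omega> = inverse \<omega>" for \<omega>
    unfolding s_def by (rule someI_ex[OF square_root_exists])
  have s0: "s \<omega> \<noteq> 0" if "\<omega> \<in> \<Omega>" for \<omega> using s[of \<omega>] \<Omega>[OF that] by auto
  define T where "T \<omega> = scale (inverse (s \<omega>)) (E \<omega> * w)" for \<omega>
  have Ew: "E \<omega> * w = w * E \<omega>" for \<omega> by (rule comm) (simp add: w_gl)
  have TT: "T \<omega> * T \<omega> = E \<omega>" and TE: "T \<omega> * E \<omega> = T \<omega>" and ET: "E \<omega> * T \<omega> = T \<omega>"
    if \<omega>: "\<omega> \<in> \<Omega>" for \<omega>
  proof -
    show ET: "E \<omega> * T \<omega> = T \<omega>"
      by (simp add: T_def scale_mult_r mult.assoc[symmetric] E_idem[OF \<omega>])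
    show "T \<omega> * E \<omega> = T \<omega>"
      by (simp add: T_def scale_mult_l mult.assoc Ew[symmetric])
        (simp add: mult.assoc[symmetric] E_idem[OF \<omega>])
    have "E \<omega> * w * (E \<omega> * w) = E \<omega> * (w * E \<omega>) * w" by (simp only: mult.assoc)
    also have "\<dots> = E \<omega> * E \<omega> * w * w" by (simp only: Ew[symmetric] mult.assoc)
    also have "\<dots> = E \<omega> * (w * w)" by (simp only: E_idem[OF \<omega>] mult.assoc)
    also have "\<dots> = scale (inverse \<omega>) (scale \<omega> (E \<omega>) * (w * w))"
      using \<Omega>[OF \<omega>] by (simp add: scale_mult_l)
    also have "scale \<omega> (E \<omega>) * (w * w) = E \<omega> * (gl * (w * w))"
      by (simp only: gl_E[OF \<omega>, symmetric] E_gl[symmetric] mult.assoc)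
    finally have "E \<omega> * w * (E \<omega> * w) = scale (s \<omega> * s \<omega>) (E \<omega>)" by (simp add: gl_w_w s)
    moreover have "inverse (s \<omega>) * (inverse (s \<omega>) * (s \<omega> * s \<omega>)) = 1"
      using s0[OF \<omega>] by (simp add: field_simps)
    ultimately show "T \<omega> * T \<omega> = E \<omega>" by (simp add: T_def scale_mult_l scale_mult_r)
  qed
  have "\<exists>m. \<chi> i (T \<omega>) = of_int m" if i: "i < n" and \<omega>: "\<omega> \<in> \<Omega>" for i \<omega>
    unfolding \<chi>_eq[OF i]
    by (rule exI, rule trace_involution(4)[OF V.vector_space_axioms fin_dim_V[OF i] lin_\<rho>[OF i]
          \<rho>_image[OF i] lin_\<rho>[OF i] \<rho>_image[OF i], of "T \<omega>" "E \<omega>"])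
      (auto simp: \<rho>_mult[OF i, symmetric] TT[OF \<omega>] TE[OF \<omega>] ET[OF \<omega>] E_idem[OF \<omega>])
  then obtain m where m: "\<And>i \<omega>. i < n \<Longrightarrow> \<omega> \<in> \<Omega> \<Longrightarrow> \<chi> i (T \<omega>) = of_int (m i \<omega>)" by metis
  have \<chi>_Ew: "\<chi> i (E \<omega> * w) = s \<omega> * of_int (m i \<omega>)" if i: "i < n" and \<omega>: "\<omega> \<in> \<Omega>" for i \<omega>
    using m[OF that] s0[OF \<omega>] by (simp add: T_def lin_on_scale[OF lin_\<chi>[OF i]] field_simps)
  have "\<chi> i (gl * w) = 0" if "i < n" for i
  proof (rule rational_gram_kernel[where I = "{..<n}" and \<Omega> = \<Omega> and \<kappa> = block_weight and m = m
        and t = "\<lambda>\<omega>. \<omega> * s \<omega>" and v = "\<lambda>i. \<chi> i (gl * w)"])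
    show "\<chi> i (gl * w) = (\<Sum>\<omega>\<in>\<Omega>. of_int (m i \<omega>) * (\<omega> * s \<omega>))" if "i \<in> {..<n}" for i
    proof -
      have i: "i < n" using that by simp
      have "gl * w = (\<Sum>\<omega>\<in>\<Omega>. E \<omega>) * (gl * w)" by (simp add: E_sum)
      also have "\<dots> = (\<Sum>\<omega>\<in>\<Omega>. scale \<omega> (E \<omega> * w))"
        unfolding sum_distrib_right
        by (intro sum.cong refl) (simp add: mult.assoc[symmetric] E_gl gl_E scale_mult_l)
      finally have "\<chi> i (gl * w) = (\<Sum>\<omega>\<in>\<Omega>. \<omega> * \<chi> i (E \<omega> * w))"
        by (simp add: lin_sum[OF lin_\<chi>[OF i]] lin_on_scale[OF lin_\<chi>[OF i]])
      then show ?thesis using i by (simp add: \<chi>_Ew mult_ac)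
    qed
    show "(\<Sum>i\<in>{..<n}. of_rat (block_weight i) * of_int (m i \<omega>) * \<chi> i (gl * w)) = 0" if \<omega>: "\<omega> \<in> \<Omega>" for \<omega>
    proof -
      have "lam (E \<omega>) = 0"
        unfolding E_def by (simp add: lin_sum[OF lin_lam[OF lin_id]] lin_on_scale[OF lin_lam[OF lin_id]] lam_pow)
      then have "(\<Sum>i<n. s \<omega> * (of_rat (block_weight i) * of_int (m i \<omega>) * \<chi> i (gl * w))) = 0"
        using \<omega> by (simp add: lam_characters \<chi>_Ew mult_ac)
      then show ?thesis using s0[OF \<omega>] by (simp add: sum_distrib_left[symmetric])
    qed
  qed (use finite block_weight_pos that in auto)
  then have "lam \<Lambda> = 0" by (simp add: lam_characters)
  then show False by (simp add: lam_\<Lambda>)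
qed

lemma gl_one: "gl = 1"
proof -
  have "sw scale (\<lambda>x y. scale (lam x) y) 1 = scale (lam 1) 1" by (rule sw_one) (intro lin_intros)+
  then show ?thesis using lam_right[of 1] lam_one_nonzero by simp
qed

lemma SSSS: "S (S (S (S k))) = k"
  using S_fourth[of k] by (simp add: gl_one)

text \<open>
  The transpose of \<open>act f\<close> is left multiplication by \<open>f\<close> in the dual algebra. So the element is the
  regular character of the dual algebra.
\<close>

lemma dual_regular_character: "\<exists>X. \<forall>f. lin scale (*) f \<longrightarrow> f X = Tr (act f)"
proof -
  obtain B where B: "finite B" "independent B" "span B = UNIV" by (rule finite_basis)
  define c where "c b q = representation B q b" for b q
  have c: "lin scale (*) (c b)" for b
    unfolding c_def using lin_on_representation[OF B(2)] B(3) by simp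
  have "f (\<Sum>b\<in>B. sw scale (\<lambda>u v. scale (c b v) u) b) = Tr (act f)" if f: "lin scale (*) f" for f
  proof -
    have "Tr (act f) = (\<Sum>b\<in>B. c b (act f b))"
      unfolding c_def by (rule trace_on_basis[OF B]) (auto intro: lin_act[OF f lin_id])
    also have "\<dots> = (\<Sum>b\<in>B. f (sw scale (\<lambda>u v. scale (c b v) u) b))"
      by (simp add: act_def sw_lin[OF c] sw_lin[OF f] lin_on_scale[OF c] lin_on_scale[OF f] mult.commute)
    finally show ?thesis by (simp add: lin_sum[OF f])
  qed
  then show ?thesis by blast
qed

definition X :: 'h where "X = (SOME X. \<forall>f. lin scale (*) f \<longrightarrow> f X = Tr (act f))"

lemma X: "lin scale (*) f \<Longrightarrow> f X = Tr (act f)"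
  using someI_ex[OF dual_regular_character] unfolding X_def[symmetric] by blast

lemma act_act:
  assumes f: "lin scale (*) f" and f': "lin scale (*) f'"
  shows "act f' (act f a) = act (sw (*) (\<lambda>x y. f x * f' y)) a"
proof -
  note lins = lin_intros lin_comp[OF f] lin_comp[OF f']
  have "act f' (act f a) = sw scale (\<lambda>x r. sw scale (\<lambda>y z. scale (f x * f' y) z) r) a"
    using act_linear[OF lin_act[OF f' lin_id], of f a]
    by (simp add: act_def sw_lin[OF lin_scale_right[OF lin_id]])
  also have "\<dots> = sw scale (\<lambda>p z. sw scale (\<lambda>x y. scale (f x * f' y) z) p) a"
    by (rule sw_coassoc[symmetric]) (intro lins)+
  also have "\<dots> = act (sw (*) (\<lambda>x y. f x * f' y)) a"
  proof -
    have "sw scale (\<lambda>x y. scale (f x * f' y) z) p = scale (sw (*) (\<lambda>x y. f x * f' y) p) z" for z p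
      using sw_lin[OF lin_scale_left[OF lin_id], of "\<lambda>x y. f x * f' y" p z] by simp
    then show ?thesis by (simp add: act_def)
  qed
  finally show ?thesis .
qed

lemma X_cocommutative:
  assumes F: "\<And>y. lin scale (*) (\<lambda>x. F x y)" "\<And>x. lin scale (*) (\<lambda>y. F x y)"
  shows "sw (*) F X = sw (*) (\<lambda>x y. F y x) X"
proof -
  have prod: "sw (*) (\<lambda>x y. f x * f' y) X = sw (*) (\<lambda>x y. f' x * f y) X"
    if f: "lin scale (*) f" and f': "lin scale (*) f'" for f f'
  proof -
    note lins = lin_intros lin_comp[OF f] lin_comp[OF f']
    have "sw (*) (\<lambda>x y. f x * f' y) X = Tr (\<lambda>a. act f' (act f a))"
      unfolding act_act[OF f f'] by (rule X) (intro lins)+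
    also have "\<dots> = Tr (\<lambda>a. act f (act f' a))"
      by (rule Tr_commute[OF lin_act[OF f lin_id] lin_act[OF f' lin_id]])
    also have "\<dots> = sw (*) (\<lambda>x y. f' x * f y) X"
      unfolding act_act[OF f' f] by (rule X[symmetric]) (intro lins)+
    finally show ?thesis .
  qed
  obtain B where B: "finite B" "independent B" "span B = UNIV" by (rule finite_basis)
  define c where "c b q = representation B q b" for b q
  have c: "lin scale (*) (c b)" for b
    unfolding c_def using lin_on_representation[OF B(2)] B(3) by simp
  have exp: "F x y = (\<Sum>b\<in>B. c b x * F b y)" for x y
  proof -
    have "x = (\<Sum>b\<in>B. scale (c b x) b)"
      unfolding c_def using B by (subst sum_representation_eq) auto
    then have "F x y = F (\<Sum>b\<in>B. scale (c b x) b) y" by simp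
    then show ?thesis by (simp add: lin_sum[OF F(1)] lin_on_scale[OF F(1)])
  qed
  have "sw (*) F X = (\<Sum>b\<in>B. sw (*) (\<lambda>x y. c b x * F b y) X)"
    by (subst sw_sum[OF vs_field]) (simp add: exp[symmetric])
  also have "\<dots> = (\<Sum>b\<in>B. sw (*) (\<lambda>x y. c b y * F b x) X)"
    by (intro sum.cong refl) (subst prod[OF c F(2)], simp add: mult.commute)
  also have "\<dots> = sw (*) (\<lambda>x y. F y x) X"
    by (subst sw_sum[OF vs_field]) (simp add: exp[symmetric])
  finally show ?thesis .
qed

text \<open>
  In general \<open>X y = \<epsilon>(y) X\<close> for cocommutative \<open>y\<close>. Indeed \<open>f(b\<^sub>1 y) b\<^sub>2 = f(b\<^sub>1 y\<^sub>1) b\<^sub>2 y\<^sub>2 S(y\<^sub>3)\<close>, and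
  cyclicity of the trace moves the right multiplication by \<open>S(y\<^sub>3)\<close> inside, next to the first
  factor of \<open>y\<close>, where cocommutativity lets the two cancel.
\<close>

lemma X_square: "X * X = scale (of_nat (dim UNIV)) X"
proof (rule functional_ext)
  fix f assume f: "lin scale (*) f"
  note lins = lin_intros lin_comp[OF f]
  have fX: "lin scale (*) (\<lambda>z. f (z * X))" by (intro lins)
  have A: "lin scale scale (act f)" by (rule lin_act[OF f lin_id])
  note lins = lins lin_act[OF f]
  define \<phi> where "\<phi> z = Tr (\<lambda>b. act f (b * z))" for z
  have \<phi>: "lin scale (*) \<phi>" unfolding \<phi>_def[abs_def] by (rule lin_Tr) (intro lins)+
  have act: "act (\<lambda>z. f (z * X)) = (\<lambda>b. sw scale (\<lambda>u v. act f (b * u) * S v) X)"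
  proof (rule ext)
    fix b
    have "sw scale (\<lambda>u v. act f (b * u) * S v) X =
        sw scale (\<lambda>u v. sw scale (\<lambda>x y. sw scale (\<lambda>p q. scale (f (x * p)) (y * q * S v)) u) b) X"
    proof -
      have "act f (b * u) = sw scale (\<lambda>x y. sw scale (\<lambda>p q. scale (f (x * p)) (y * q)) u) b" for u
        unfolding act_def by (rule sw_mult) (intro lins)+
      then show ?thesis
        by (simp add: sw_lin[OF lin_mult_right[OF lin_id]] scale_mult_l)
    qed
    also have "\<dots> = sw scale (\<lambda>x y. sw scale (\<lambda>u v. sw scale (\<lambda>p q. scale (f (x * p)) (y * q * S v)) u) X) b"
      by (rule sw_swap[OF vs_scale])
    also have "\<dots> = sw scale (\<lambda>x y. sw scale (\<lambda>p r. sw scale (\<lambda>q v. scale (f (x * p)) (y * q * S v)) r) X) b"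
      by (subst sw_coassoc) (intro lins refl)+
    also have "\<dots> = sw scale (\<lambda>x y. scale (f (x * X)) (y * 1)) b"
    proof -
      have 1: "sw scale (\<lambda>q v. scale (f (x * p)) (y * (q * S v))) r = scale (\<epsilon> r) (scale (f (x * p)) (y * 1))"
        for x y p r by (rule sw_antipode_right) (intro lins)
      have 2: "sw scale (\<lambda>p r. scale (\<epsilon> r) (scale (f (x * p)) (y * 1))) X = scale (f (x * X)) (y * 1)"
        for x y by (rule sw_counit_right) (intro lins)
      show ?thesis using 1 2 by (simp add: mult.assoc)
    qed
    finally show "act (\<lambda>z. f (z * X)) b = sw scale (\<lambda>u v. act f (b * u) * S v) X"
      by (simp add: act_def)
  qed
  have "f (X * X) = Tr (act (\<lambda>z. f (z * X)))" by (rule X[OF fX])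
  also have "\<dots> = Tr (\<lambda>b. sw scale (\<lambda>u v. act f (b * u) * S v) X)" by (simp only: act)
  also have "\<dots> = sw (*) (\<lambda>u v. Tr (\<lambda>b. act f (b * u) * S v)) X"
    by (rule Tr_sw) (intro lins)
  also have "\<dots> = sw (*) (\<lambda>u v. \<phi> (S v * u)) X"
  proof -
    have "Tr (\<lambda>b. act f (b * u) * S v) = \<phi> (S v * u)" for u v
    proof -
      have "Tr (\<lambda>b. act f (b * u) * S v) = Tr (\<lambda>b. act f (b * S v * u))"
        by (rule Tr_commute) (intro lins)+
      then show ?thesis by (simp add: \<phi>_def mult.assoc)
    qed
    then show ?thesis by simp
  qed
  also have "\<dots> = sw (*) (\<lambda>u v. \<phi> (S u * v)) X"
    by (rule X_cocommutative) (intro lin_comp[OF \<phi>] lin_intros)+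
  also have "\<dots> = \<epsilon> X * \<phi> 1" by (rule sw_antipode_left[OF \<phi>])
  also have "\<phi> 1 = f X" by (simp add: \<phi>_def X[OF f])
  also have "\<epsilon> X = of_nat (dim UNIV)"
  proof -
    have "act \<epsilon> a = a" for a by (simp add: act_def counit_left)
    then have "act \<epsilon> = (\<lambda>a. a)" by auto
    then show ?thesis using X[OF lin_\<epsilon>[OF lin_id]] trace_id[OF fin] by simp
  qed
  finally show "f (X * X) = f (scale (of_nat (dim UNIV)) X)" by (simp add: lin_on_scale[OF f])
qed

lemma SS_X: "S (S X) = X"
proof (rule functional_ext)
  fix f assume f: "lin scale (*) f"
  note lins = lin_intros lin_comp[OF f]
  have act: "act (\<lambda>z. f (S (S z))) = (\<lambda>a. S (S (act f (S (S a)))))"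
  proof (rule ext)
    fix a
    have lSS: "lin scale scale (\<lambda>z. S (S z))" by (intro lin_intros)
    have "act f (S (S a)) = sw scale (\<lambda>x y. scale (f (S y)) (S x)) (S a)"
      unfolding act_def by (rule S_comult) (intro lins)+
    also have "\<dots> = sw scale (\<lambda>x y. scale (f (S (S x))) (S (S y))) a"
      by (rule S_comult) (intro lins)+
    finally have "S (S (act f (S (S a)))) = sw scale (\<lambda>x y. scale (f (S (S x))) (S (S (S (S y))))) a"
      by (simp add: sw_lin[OF lSS] lin_on_scale[OF lSS])
    then show "act (\<lambda>z. f (S (S z))) a = S (S (act f (S (S a))))" by (simp add: act_def SSSS)
  qed
  have "f (S (S X)) = Tr (act (\<lambda>z. f (S (S z))))" by (rule X) (intro lins)
  also have "\<dots> = Tr (\<lambda>a. S (S (act f (S (S a)))))" by (simp only: act)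
  also have "\<dots> = Tr (\<lambda>a. act f (S (S (S (S a)))))"
    using Tr_commute[of "\<lambda>a. act f (S (S a))" "\<lambda>a. S (S a)"] by (simp add: lin_act[OF f] lin_intros)
  also have "\<dots> = f X" by (simp add: SSSS X[OF f])
  finally show "f (S (S X)) = f X" .
qed

lemma lam_X: "lam X = lam 1"
proof -
  have "lam X = Tr (act lam)" by (rule X[OF lin_lam[OF lin_id]])
  also have "act lam = (\<lambda>a. scale (lam a) 1)" by (auto simp: act_def lam_right gl_one)
  also have "Tr \<dots> = lam 1" by (rule Tr_rank_one[OF lin_lam[OF lin_id]])
  finally show ?thesis .
qed

text \<open>
  Larson and Radford: \<open>\<lambda>(1)\<close> is the trace of the involution \<open>S\<^sup>2\<close>, and it is \<open>dim H\<close> times the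
  trace of \<open>S\<^sup>2\<close> on the left multiples of the idempotent \<open>X / dim H\<close>, an integer. So it is a
  nonzero multiple of \<open>dim H\<close>, which forces \<open>S\<^sup>2\<close> to be \<open>1\<close> or \<open>-1\<close>; and \<open>S\<^sup>2(1) = 1\<close>.
\<close>

theorem antipode_involution: "S (S x) = x"
proof -
  let ?D = "dim (UNIV :: 'h set)"
  have D: "?D > 0" using fin_dim_dim_0[OF fin] by (metis UNIV_I gr0I singletonD zero_neq_one)
  define E where "E = scale (inverse (of_nat ?D)) X"
  have E: "E * E = E" using D by (simp add: E_def scale_mult_l scale_mult_r X_square)
  have SSE: "S (S E) = E"
    by (simp add: E_def lin_on_scale[OF lin_S[OF lin_id]] SS_X)
  have lSS: "lin scale scale (\<lambda>x. S (S x))" and lE: "lin scale scale (\<lambda>x. E * x)"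
    and lESS: "lin scale scale (\<lambda>x. E * S (S x))" and lid: "lin scale scale (\<lambda>x. x)"
    by (intro lin_intros)+
  have "lam E = of_int (2 * int (dim (range (\<lambda>x. scale (1/2) (E * S (S x) + E * x)))) -
      int (dim (range (\<lambda>x. E * x))))"
    unfolding lam_def
    by (rule trace_involution(4)[OF vector_space_axioms fin lESS _ lE])
      (auto simp: S_mult SSE SSSS mult.assoc[symmetric] E)
  then obtain m where m: "lam E = of_int m" by blast
  have "lam E = inverse (of_nat ?D) * lam 1"
    by (simp add: E_def lin_on_scale[OF lin_lam[OF lin_id]] lam_X)
  then have lam1: "lam 1 = of_int (int ?D * m)" using D m by (simp add: field_simps)
  (* the projection to the fixed space of the square of the antipode *)
  define P where "P x = scale (1/2) (S (S x) + x)" for x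
  have P: "lin scale scale P" "P (P x) = P x" for x
    unfolding P_def[abs_def]
    using trace_involution(1,3)[OF vector_space_axioms fin lSS _ lid] SSSS by auto
  have "lam 1 = of_int (2 * int (dim (range P)) - int ?D)"
    unfolding lam_def P_def[abs_def]
    using trace_involution(4)[OF vector_space_axioms fin lSS _ lid] SSSS by simp
  then have eq: "2 * int (dim (range P)) - int ?D = int ?D * m"
    unfolding lam1 of_int_eq_iff by simp
  have fin_P: "fin_dim (range P)" by (rule fin_dim_image[OF fin P(1)]) simp
  have le: "dim (range P) \<le> ?D"
    by (rule fin_dim_dim_mono[OF fin fin_dim_subspace[OF fin_P]]) simp
  have "P 1 = scale (1/2 + 1/2) 1" by (simp only: P_def S_one scale_right_distrib scale_left_distrib)
  then have "P 1 = 1" by simp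
  then have "range P \<noteq> {0}" by (metis rangeI singletonD zero_neq_one)
  then have pos: "dim (range P) > 0" using fin_dim_dim_0[OF fin_P] by blast
  have "m \<noteq> 0" using lam1 lam_one_nonzero by auto
  moreover have "m > -1"
  proof (rule ccontr)
    assume "\<not> m > -1"
    then have "int ?D * m \<le> int ?D * (-1)" using D by (intro mult_left_mono) auto
    then show False using eq pos by simp
  qed
  ultimately have "int ?D * 1 \<le> int ?D * m" using D by (intro mult_left_mono) auto
  then have "?D \<le> dim (range P)" using eq by simp
  then have "range P = UNIV"
    by (intro fin_dim_dim_eq[OF fin fin_dim_subspace[OF fin_P]]) auto
  then obtain y where "x = P y" by (metis surjD)
  then have "P x = x" using P(2) by simp
  then have "scale 2 (P x) = scale 2 x" by simp
  then have "S (S x) + x = x + x" by (simp add: P_def flip: scale_left_distrib[of 1 1, simplified])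
  then show ?thesis by simp
qed

end

section \<open>Commutators with the integral\<close>

context hopf_family
begin

lemma sw_antipode_flipped:
  assumes f: "lin scale sc f" shows "sw sc (\<lambda>x y. f (S y * x)) a = sc (\<epsilon> a) (f 1)"
  using sw_antipode_left[OF lin_comp[OF f lin_S[OF lin_id]], of a]
  by (simp add: S_mult antipode_involution S_one)

lemma trace_sw_V:
  assumes i: "i < n" and F: "\<And>u v. lin_on scaleV scaleV (V i) (F u v)" "\<And>u v. F u v ` V i \<subseteq> V i"
  shows "trace_on scaleV (V i) (\<lambda>x. sw scaleV (\<lambda>u v. F u v x) a) =
    sw (*) (\<lambda>u v. trace_on scaleV (V i) (F u v)) a"
  unfolding sw_eq by (rule V.trace_sum[OF fin_dim_V[OF i]]) (use F in auto)

lemma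
  assumes i: "i < n" and F: "\<And>u v. lin_on scaleV scaleV (V i) (F u v)" "\<And>u v. F u v ` V i \<subseteq> V i"
  shows lin_on_sw_V: "lin_on scaleV scaleV (V i) (\<lambda>x. sw scaleV (\<lambda>u v. F u v x) a)"
    and sw_V_closed: "(\<lambda>x. sw scaleV (\<lambda>u v. F u v x) a) ` V i \<subseteq> V i"
proof -
  show "lin_on scaleV scaleV (V i) (\<lambda>x. sw scaleV (\<lambda>u v. F u v x) a)"
    unfolding sw_eq
    by (rule lin_onI) (simp_all add: lin_on_add[OF F(1)] lin_on_scale[OF F(1)] V.scale_right_distrib
        sum.distrib V.scale_sum_right mult.commute)
  show "(\<lambda>x. sw scaleV (\<lambda>u v. F u v x) a) ` V i \<subseteq> V i"
    unfolding sw_eq using F(2) subspace_V[OF i]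
    by (auto intro!: V.subspace_sum V.subspace_scale simp: image_subset_iff)
qed

lemma \<rho>_sw:
  assumes i: "i < n" and F: "\<And>u v. F u v \<in> V i"
  shows "\<rho> i h (sw scaleV F a) = sw scaleV (\<lambda>u v. \<rho> i h (F u v)) a"
  unfolding sw_eq using F subspace_V[OF i]
  by (subst V.lin_on_sum[OF lin_\<rho>[OF i] subspace_V[OF i]])
    (auto intro: V.subspace_scale simp: lin_on_scale[OF lin_\<rho>[OF i]])

lemma lin_\<rho>_comp:
  assumes i: "i < n" and T: "lin_on scaleV scaleV (V i) T" "T ` V i \<subseteq> V i" and v: "v \<in> V i"
    and f: "lin s scale f"
  shows "lin s scaleV (\<lambda>h. T (\<rho> i (f h) v))"
  using T f lin_\<rho>_left[OF i v] \<rho>_closed[OF i v] by (simp add: lin_on_def)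

text \<open>
  Averaging an endomorphism with \<open>\<Lambda>\<^sub>1 \<otimes> S(\<Lambda>\<^sub>2)\<close> gives a scalar by Schur's lemma; the trace
  is unchanged because \<open>S(\<Lambda>\<^sub>2) \<Lambda>\<^sub>1 = 1\<close>, which is where \<open>S\<^sup>2 = id\<close> enters.
\<close>

lemma averaging:
  assumes i: "i < n" and T: "lin_on scaleV scaleV (V i) T" "T ` V i \<subseteq> V i" and v: "v \<in> V i"
  shows "sw scaleV (\<lambda>x y. \<rho> i x (T (\<rho> i (S y) v))) \<Lambda> =
    scaleV (trace_on scaleV (V i) T / of_nat (d i)) v"
proof -
  define F where "F x y v = \<rho> i x (T (\<rho> i (S y) v))" for x y v
  have T_closed: "T u \<in> V i" if "u \<in> V i" for u using T that by auto
  have F_closed: "F x y ` V i \<subseteq> V i" for x y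
    unfolding F_def using \<rho>_closed[OF i] T_closed by auto
  have F_lin: "lin_on scaleV scaleV (V i) (F x y)" for x y
    unfolding F_def using \<rho>_closed[OF i] T_closed
    by (intro lin_onI) (simp_all add: lin_on_add[OF lin_\<rho>[OF i]] lin_on_add[OF T(1)]
        lin_on_scale[OF lin_\<rho>[OF i]] lin_on_scale[OF T(1)])
  define Q where "Q v = sw scaleV (\<lambda>x y. F x y v) \<Lambda>" for v
  have Q: "lin_on scaleV scaleV (V i) Q" "Q ` V i \<subseteq> V i"
    unfolding Q_def by (rule lin_on_sw_V[OF i F_lin F_closed] sw_V_closed[OF i F_lin F_closed])+
  have comm: "Q (\<rho> i h v) = \<rho> i h (Q v)" if v: "v \<in> V i" for h v
  proof -
    note lins = lin_\<rho>_comp[OF i T v lin_id]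
    have "\<rho> i h (Q v) = sw scaleV (\<lambda>x y. \<rho> i (h * x) (T (\<rho> i (S y) v))) \<Lambda>"
      unfolding Q_def using F_closed v T_closed \<rho>_closed[OF i]
      by (subst \<rho>_sw[OF i]) (auto simp: F_def \<rho>_mult[OF i])
    also have "\<dots> = sw scaleV (\<lambda>x y. \<rho> i x (T (\<rho> i (S y * h) v))) \<Lambda>"
    proof (rule casimir[OF V.vector_space_axioms])
      show "lin scale scaleV (\<lambda>x. \<rho> i x (T (\<rho> i y v)))" for y
        using T_closed \<rho>_closed[OF i v] by (intro lin_\<rho>_left[OF i]) auto
      show "lin scale scaleV (\<lambda>y. \<rho> i x (T (\<rho> i y v)))" for x
        using lins T_closed \<rho>_closed[OF i] v
        by (simp add: lin_on_def lin_on_add[OF lin_\<rho>[OF i]] lin_on_scale[OF lin_\<rho>[OF i]])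
    qed
    also have "\<dots> = Q (\<rho> i h v)" using v by (simp add: Q_def F_def \<rho>_mult[OF i])
    finally show ?thesis ..
  qed
  obtain c where c: "\<And>v. v \<in> V i \<Longrightarrow> Q v = scaleV c v" using Schur[OF i Q comm] by blast
  have "c * of_nat (d i) = trace_on scaleV (V i) Q"
    unfolding trace_scalar_V[OF i, symmetric]
    by (rule V.trace_cong[OF fin_dim_V[OF i] Q c, symmetric])
  also have "\<dots> = sw (*) (\<lambda>x y. trace_on scaleV (V i) (F x y)) \<Lambda>"
    unfolding Q_def by (rule trace_sw_V[OF i F_lin F_closed])
  also have "\<dots> = sw (*) (\<lambda>x y. trace_on scaleV (V i) (\<lambda>v. T (\<rho> i (S y * x) v))) \<Lambda>"
  proof -
    have "trace_on scaleV (V i) (F x y) = trace_on scaleV (V i) (\<lambda>v. T (\<rho> i (S y * x) v))" for x y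
    proof -
      let ?G = "\<lambda>v. T (\<rho> i (S y) v)"
      have G: "lin_on scaleV scaleV (V i) ?G" "?G ` V i \<subseteq> V i"
        using lin_on_compose[OF lin_\<rho>[OF i] T(1) \<rho>_image[OF i]] T_closed \<rho>_closed[OF i] by auto
      have "trace_on scaleV (V i) (F x y) = trace_on scaleV (V i) (\<lambda>v. ?G (\<rho> i x v))"
        unfolding F_def by (rule V.trace_commute[OF fin_dim_V[OF i] fin_dim_V[OF i] G lin_\<rho>[OF i] \<rho>_image[OF i]])
      also have "\<dots> = trace_on scaleV (V i) (\<lambda>v. T (\<rho> i (S y * x) v))"
        using lin_on_compose[OF lin_\<rho>[OF i] G(1) \<rho>_image[OF i]] G(2) \<rho>_closed[OF i]
        by (intro V.trace_cong[OF fin_dim_V[OF i]]) (auto simp: \<rho>_mult[OF i])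
      finally show ?thesis .
    qed
    then show ?thesis by simp
  qed
  also have "\<dots> = trace_on scaleV (V i) (\<lambda>v. sw scaleV (\<lambda>x y. T (\<rho> i (S y * x) v)) \<Lambda>)"
    using lin_on_compose[OF lin_\<rho>[OF i] T(1) \<rho>_image[OF i]] T_closed \<rho>_closed[OF i]
    by (intro trace_sw_V[OF i, symmetric]) auto
  also have "\<dots> = trace_on scaleV (V i) T"
  proof (rule sym, rule V.trace_cong[OF fin_dim_V[OF i] T])
    fix v assume v: "v \<in> V i"
    have "sw scaleV (\<lambda>x y. T (\<rho> i (S y * x) v)) \<Lambda> = scaleV (\<epsilon> \<Lambda>) (T (\<rho> i 1 v))"
      by (rule sw_antipode_flipped) (rule lin_\<rho>_comp[OF i T v lin_id])
    then show "T v = sw scaleV (\<lambda>x y. T (\<rho> i (S y * x) v)) \<Lambda>"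
      by (simp add: \<epsilon>_\<Lambda> \<rho>_one[OF i v])
  qed
  finally have "c = trace_on scaleV (V i) T / of_nat (d i)" using d_pos[OF i] by (simp add: field_simps)
  then show ?thesis using c[OF v] by (simp add: Q_def F_def)
qed

text \<open>The character of the adjoint action of \<open>H\<close> on \<open>End(V\<^sub>i) = V\<^sub>i \<otimes> V\<^sub>i\<^sup>*\<close>.\<close>

definition adj :: "nat \<Rightarrow> 'h \<Rightarrow> 'k" where
  "adj i = convolution \<Delta> (\<chi> i) (dual_antipode S (\<chi> i))"

lemma adj_eq: "adj i a = sw (*) (\<lambda>x y. \<chi> i x * \<chi> i (S y)) a"
  by (simp add: adj_def convolution_def dual_antipode_def)

text \<open>
  On \<open>V\<^sub>i\<close> the factor \<open>\<Lambda>\<^sub>1 S(a\<^sub>2) S(\<Lambda>\<^sub>2)\<close> of \<open>{a, \<Lambda>}\<close> is the average of the action of \<open>S(a\<^sub>2)\<close>, that is,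
  the scalar \<open>\<chi>\<^sub>i(S(a\<^sub>2)) / d\<^sub>i\<close>.
\<close>

lemma character_commutator:
  assumes i: "i < n"
  shows "\<chi> i (hopf_commutator scale \<Delta> S a \<Lambda>) = 1 / of_nat (d i) * adj i a"
proof -
  have inner: "sw (*) (\<lambda>x y. \<chi> i (p * x * q * S y)) \<Lambda> = \<chi> i q / of_nat (d i) * \<chi> i p" for p q
  proof -
    let ?F = "\<lambda>x y v. \<rho> i (p * x * q * S y) v"
    have "sw (*) (\<lambda>x y. \<chi> i (p * x * q * S y)) \<Lambda> =
        trace_on scaleV (V i) (\<lambda>v. sw scaleV (\<lambda>x y. ?F x y v) \<Lambda>)"
      unfolding \<chi>_eq[OF i] by (rule trace_sw_V[OF i lin_\<rho>[OF i] \<rho>_image[OF i], symmetric])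
    also have "\<dots> = trace_on scaleV (V i) (\<lambda>v. scaleV (\<chi> i q / of_nat (d i)) (\<rho> i p v))"
    proof (rule V.trace_cong[OF fin_dim_V[OF i] lin_on_sw_V[OF i lin_\<rho>[OF i] \<rho>_image[OF i]]
          sw_V_closed[OF i lin_\<rho>[OF i] \<rho>_image[OF i]]])
      fix v assume v: "v \<in> V i"
      have "sw scaleV (\<lambda>x y. ?F x y v) \<Lambda> = \<rho> i p (sw scaleV (\<lambda>x y. \<rho> i x (\<rho> i q (\<rho> i (S y) v))) \<Lambda>)"
        using v \<rho>_closed[OF i] by (subst \<rho>_sw[OF i]) (auto simp: \<rho>_mult[OF i] mult.assoc)
      also have "\<dots> = \<rho> i p (scaleV (\<chi> i q / of_nat (d i)) v)"
        by (simp add: averaging[OF i lin_\<rho>[OF i] \<rho>_image[OF i] v] \<chi>_eq[OF i])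
      finally show "sw scaleV (\<lambda>x y. ?F x y v) \<Lambda> = scaleV (\<chi> i q / of_nat (d i)) (\<rho> i p v)"
        using v by (simp add: lin_on_scale[OF lin_\<rho>[OF i]])
    qed
    also have "\<dots> = \<chi> i q / of_nat (d i) * \<chi> i p"
      unfolding \<chi>_eq[OF i] by (rule V.trace_scale[OF fin_dim_V[OF i] lin_\<rho>[OF i] \<rho>_image[OF i]])
    finally show ?thesis .
  qed
  have "\<chi> i (hopf_commutator scale \<Delta> S a \<Lambda>) =
      sw (*) (\<lambda>p q. sw (*) (\<lambda>x y. \<chi> i (p * x * S q * S y)) \<Lambda>) a"
    by (simp add: hopf_commutator_def sw_lin[OF lin_\<chi>[OF i]])
  also have "\<dots> = sw (*) (\<lambda>p q. 1 / of_nat (d i) * (\<chi> i p * \<chi> i (S q))) a"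
    unfolding inner by (simp add: mult.commute)
  also have "\<dots> = 1 / of_nat (d i) * adj i a"
    unfolding adj_eq by (rule sw_lin[symmetric]) (intro lin_intros)
  finally show ?thesis .
qed

text \<open>
  Here \<open>z = \<Lambda>\<^sub>1 S(a\<^sub>2) S(\<Lambda>\<^sub>2)\<close> is central, so that left multiplication by it may be replaced by right
  multiplication; under the trace the latter becomes right multiplication by \<open>S(a\<^sub>2)\<close>, again
  because \<open>S(\<Lambda>\<^sub>2) \<Lambda>\<^sub>1 = 1\<close>.
\<close>

lemma regular_character_commutator:
  "Tr (\<lambda>x. hopf_commutator scale \<Delta> S a \<Lambda> * x) = Tr (adjoint_action scale \<Delta> S a)"
proof -
  have inner: "sw (*) (\<lambda>x y. chi_reg (p * x * q * S y)) \<Lambda> = Tr (\<lambda>v. p * v * q)" for p q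
  proof -
    define z where "z = sw scale (\<lambda>x y. x * q * S y) \<Lambda>"
    have z: "h * z = z * h" for h
    proof -
      have "h * z = sw scale (\<lambda>x y. h * x * q * S y) \<Lambda>"
        unfolding z_def by (subst sw_lin[OF lin_mult_left[OF lin_id]]) (simp add: mult.assoc)
      also have "\<dots> = sw scale (\<lambda>x y. x * q * (S y * h)) \<Lambda>"
        by (rule casimir) (intro lin_intros)+
      also have "\<dots> = z * h"
        unfolding z_def by (subst sw_lin[OF lin_mult_right[OF lin_id]]) (simp add: mult.assoc)
      finally show ?thesis .
    qed
    have "sw (*) (\<lambda>x y. chi_reg (p * x * q * S y)) \<Lambda> = chi_reg (p * z)"
      unfolding z_def using lin_comp[OF lin_chi_reg lin_mult_left[OF lin_id]]
      by (subst sw_lin[of scale "(*)" "\<lambda>x. chi_reg (p * x)"]) (simp_all add: mult.assoc)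
    also have "\<dots> = Tr (\<lambda>v. p * v * z)" by (simp add: chi_reg_def mult.assoc z)
    also have "\<dots> = Tr (\<lambda>v. sw scale (\<lambda>x y. p * v * (x * q * S y)) \<Lambda>)"
      unfolding z_def by (simp add: sw_lin[OF lin_mult_left[OF lin_id]])
    also have "\<dots> = sw (*) (\<lambda>x y. Tr (\<lambda>v. p * v * (x * q * S y))) \<Lambda>"
      by (rule Tr_sw) (intro lin_intros)
    also have "\<dots> = sw (*) (\<lambda>x y. Tr (\<lambda>v. p * v * (S y * x) * q)) \<Lambda>"
    proof -
      have "Tr (\<lambda>v. p * v * (x * q * S y)) = Tr (\<lambda>v. p * v * (S y * x) * q)" for x y
      proof -
        have "Tr (\<lambda>v. p * v * x * q * S y) = Tr (\<lambda>v. p * (v * S y) * x * q)"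
          by (rule Tr_commute) (intro lin_intros)+
        then show ?thesis by (simp add: mult.assoc)
      qed
      then show ?thesis by simp
    qed
    also have "\<dots> = \<epsilon> \<Lambda> * Tr (\<lambda>v. p * v * 1 * q)"
      by (rule sw_antipode_flipped) (intro lin_Tr lin_intros)
    finally show ?thesis by (simp add: \<epsilon>_\<Lambda>)
  qed
  have "chi_reg (hopf_commutator scale \<Delta> S a \<Lambda>) =
      sw (*) (\<lambda>p q. sw (*) (\<lambda>x y. chi_reg (p * x * S q * S y)) \<Lambda>) a"
    by (simp add: hopf_commutator_def sw_lin[OF lin_chi_reg])
  also have "\<dots> = Tr (\<lambda>v. sw scale (\<lambda>p q. p * v * S q) a)"
    unfolding inner by (rule Tr_sw[symmetric]) (intro lin_intros)
  finally show ?thesis by (simp add: chi_reg_def adjoint_action_def[abs_def])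
qed

text \<open>
  The value is the dimension of the invariants of \<open>End(V\<^sub>i)\<close>. It comes from the averages of the
  maps \<open>u \<mapsto> b\<^sup>*(u) v\<close> of rank one, applied to the basis vectors \<open>b\<close>.
\<close>

lemma adj_\<Lambda>: assumes i: "i < n" shows "adj i \<Lambda> = 1"
proof -
  obtain B where B: "finite B" "V.independent B" "V.span B = V i"
    by (rule V.fin_dim_basis[OF fin_dim_V[OF i]])
  define c where "c b u = V.representation B u b" for b u
  have c: "lin_on scaleV (*) (V i) (c b)" for b
    unfolding c_def using V.lin_on_representation[OF B(2)] B(3) by simp
  have \<chi>_sum: "\<chi> i h = (\<Sum>b\<in>B. c b (\<rho> i h b))" for h
    unfolding \<chi>_eq[OF i] c_def by (rule V.trace_on_basis[OF B lin_\<rho>[OF i] \<rho>_image[OF i]])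
  have B_V: "b \<in> V i" if "b \<in> B" for b using B V.span_base that by blast
  let ?F = "\<lambda>x y v. scaleV (\<chi> i (S y)) (\<rho> i x v)"
  have F: "lin_on scaleV scaleV (V i) (?F x y)" "?F x y ` V i \<subseteq> V i" for x y
    using \<rho>_closed[OF i] V.subspace_scale[OF subspace_V[OF i]]
    by (auto intro!: lin_onI simp: lin_on_add[OF lin_\<rho>[OF i]] lin_on_scale[OF lin_\<rho>[OF i]]
        V.scale_right_distrib mult.commute)
  have avg: "sw scaleV (\<lambda>x y. ?F x y v) \<Lambda> = scaleV (1 / of_nat (d i)) v" if v: "v \<in> V i" for v
  proof -
    have T: "lin_on scaleV scaleV (V i) (\<lambda>u. scaleV (c b u) v)" "(\<lambda>u. scaleV (c b u) v) ` V i \<subseteq> V i" for b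
      using v V.subspace_scale[OF subspace_V[OF i]]
      by (auto intro!: lin_onI simp: lin_on_add[OF c] lin_on_scale[OF c] V.scale_left_distrib)
    have "sw scaleV (\<lambda>x y. ?F x y v) \<Lambda> =
        sw scaleV (\<lambda>x y. \<Sum>b\<in>B. \<rho> i x (scaleV (c b (\<rho> i (S y) b)) v)) \<Lambda>"
      using v by (simp add: \<chi>_sum V.scale_sum_left lin_on_scale[OF lin_\<rho>[OF i]])
    also have "\<dots> = (\<Sum>b\<in>B. sw scaleV (\<lambda>x y. \<rho> i x (scaleV (c b (\<rho> i (S y) b)) v)) \<Lambda>)"
      by (rule sw_sum[OF V.vector_space_axioms, symmetric])
    also have "\<dots> = (\<Sum>b\<in>B. scaleV (1 / of_nat (d i)) (scaleV (c b v) b))"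
    proof (rule sum.cong[OF refl])
      fix b assume b: "b \<in> B"
      show "sw scaleV (\<lambda>x y. \<rho> i x (scaleV (c b (\<rho> i (S y) b)) v)) \<Lambda> =
          scaleV (1 / of_nat (d i)) (scaleV (c b v) b)"
        using averaging[OF i T B_V[OF b], of b] V.trace_rank_one[OF fin_dim_V[OF i] c v] by simp
    qed
    also have "\<dots> = scaleV (1 / of_nat (d i)) v"
      unfolding V.scale_sum_right[symmetric] c_def using B v
      by (subst V.sum_representation_eq) auto
    finally show ?thesis .
  qed
  have "adj i \<Lambda> = sw (*) (\<lambda>x y. trace_on scaleV (V i) (?F x y)) \<Lambda>"
    unfolding adj_eq
    by (simp add: V.trace_scale[OF fin_dim_V[OF i] lin_\<rho>[OF i] \<rho>_image[OF i]] \<chi>_eq[OF i] mult.commute)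
  also have "\<dots> = trace_on scaleV (V i) (\<lambda>v. sw scaleV (\<lambda>x y. ?F x y v) \<Lambda>)"
    by (rule trace_sw_V[OF i F, symmetric])
  also have "\<dots> = trace_on scaleV (V i) (\<lambda>v. scaleV (1 / of_nat (d i)) v)"
    by (rule V.trace_cong[OF fin_dim_V[OF i] lin_on_sw_V[OF i F] sw_V_closed[OF i F] avg])
  also have "\<dots> = 1" using trace_scalar_V[OF i, of "1 / of_nat (d i)"] d_pos[OF i] by simp
  finally show ?thesis .
qed

text \<open>As a character, \<open>\<chi>\<^sub>i s(\<chi>\<^sub>i)\<close> is a trace function, so its value at \<open>a\<close> depends on the \<open>\<chi>\<^sub>j(a)\<close> only.\<close>

lemma adj_expansion:
  assumes i: "i < n" shows "adj i a = (\<Sum>j<n. adj i (e j) / of_nat (d j) * \<chi> j a)"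
proof (rule trace_function_expansion)
  note lins = lin_intros lin_comp[OF lin_\<chi>[OF i]]
  show "lin scale (*) (adj i)" unfolding adj_eq[abs_def] by (intro lins)
  show "adj i (a * b) = adj i (b * a)" for a b
  proof -
    have "adj i (a * b) = sw (*) (\<lambda>x y. sw (*) (\<lambda>u v. \<chi> i (x * u) * \<chi> i (S (y * v))) b) a"
      unfolding adj_eq by (rule sw_mult) (intro lins)+
    also have "\<dots> = sw (*) (\<lambda>u v. sw (*) (\<lambda>x y. \<chi> i (x * u) * \<chi> i (S (y * v))) a) b"
      by (rule sw_swap[OF vs_field])
    also have "\<dots> = sw (*) (\<lambda>u v. sw (*) (\<lambda>x y. \<chi> i (u * x) * \<chi> i (S (v * y))) a) b"
    proof -
      have "\<chi> i (x * u) * \<chi> i (S (y * v)) = \<chi> i (u * x) * \<chi> i (S (v * y))" for x y u v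
        unfolding S_mult \<chi>_commute[OF i, of x u] \<chi>_commute[OF i, of "S v" "S y"] by (rule refl)
      then show ?thesis by simp
    qed
    also have "\<dots> = adj i (b * a)"
      unfolding adj_eq by (rule sw_mult[symmetric]) (intro lins)+
    finally show ?thesis .
  qed
qed

text \<open>
  By primitivity \<open>e\<^sub>0 \<Lambda>\<close> is \<open>0\<close> or \<open>e\<^sub>0\<close>, but it is also \<open>\<epsilon>(e\<^sub>0) \<Lambda> = \<Lambda>\<close>, as \<open>e\<^sub>0\<close> acts on \<open>V\<^sub>0\<close> by
  \<open>\<epsilon>(e\<^sub>0)\<close> and as the identity.
\<close>

lemma e_zero:
  assumes trivial: "trivial_module \<epsilon> scaleV (V 0) (\<rho> 0)" shows "e 0 = \<Lambda>"
proof -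
  have act: "\<rho> 0 h v = scaleV (\<epsilon> h) v" if "v \<in> V 0" for h v
    using trivial that by (simp add: trivial_module_def)
  obtain v where v: "v \<in> V 0" "v \<noteq> 0" by (rule obtain_nonzero[OF n_pos])
  have \<epsilon>e: "\<epsilon> (e 0) = 1"
    using scalar_eqD[OF n_pos, of "\<epsilon> (e 0)" 1] act e_acts[OF n_pos] by simp
  have "e 0 * \<Lambda> = 0 \<or> e 0 * \<Lambda> = e 0"
    by (rule e_primitive[OF n_pos \<Lambda>_idem \<Lambda>_central])
  moreover have "e 0 * \<Lambda> = \<Lambda>" by (simp add: \<Lambda>_left \<epsilon>e)
  ultimately show ?thesis using \<Lambda>_nonzero by metis
qed

end

lemma sum_PiE_atLeastAtMost_Suc:
  "(\<Sum>\<iota>\<in>{1..Suc K} \<rightarrow>\<^sub>E A. g \<iota>) = (\<Sum>j\<in>A. \<Sum>\<iota>\<in>{1..K} \<rightarrow>\<^sub>E A. g (\<iota>(Suc K := j)))"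
proof -
  have set: "{1..Suc K} = insert (Suc K) {1..K}" by auto
  have inj: "inj_on (\<lambda>(y, g). g(Suc K := y)) (A \<times> ({1..K} \<rightarrow>\<^sub>E A))"
    by (rule inj_combinator) simp
  have "(\<Sum>\<iota>\<in>{1..Suc K} \<rightarrow>\<^sub>E A. g \<iota>) =
      (\<Sum>p\<in>A \<times> ({1..K} \<rightarrow>\<^sub>E A). g ((snd p)(Suc K := fst p)))"
    unfolding set PiE_insert_eq sum.reindex[OF inj] by (simp add: case_prod_unfold)
  then show ?thesis by (simp add: sum.cartesian_product case_prod_unfold)
qed

context hopf_family
begin

abbreviation \<Lambda>\<Lambda> :: "nat \<Rightarrow> 'h" where "\<Lambda>\<Lambda> \<equiv> iterated_commutator scale \<Delta> S \<Lambda>"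

lemma iterated_character:
  assumes i: "i < n" shows "\<chi> i (\<Lambda>\<Lambda> (Suc (Suc m))) = 1 / of_nat (d i) * adj i (\<Lambda>\<Lambda> (Suc m))"
  by (simp only: iterated_commutator.simps character_commutator[OF i])

lemma second_character:
  assumes i: "i < n" shows "\<chi> i (\<Lambda>\<Lambda> 2) = 1 / of_nat (d i)"
  using iterated_character[OF i, of 0] adj_\<Lambda>[OF i] by (simp add: numeral_2_eq_2)

text \<open>
  Expanding \<open>\<chi>\<^sub>i s(\<chi>\<^sub>i)\<close> in characters turns the recursion into
  \<open>\<chi>\<^sub>i(\<Lambda>\<^bsup>{m+1}\<^esup>) = (1/d\<^sub>i) (\<Sum>j. \<langle>\<chi>\<^sub>i s(\<chi>\<^sub>i), e\<^sub>j\<rangle> / d\<^sub>j * \<chi>\<^sub>j(\<Lambda>\<^bsup>{m}\<^esup>))\<close>; each step adds one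
  summation index \<open>j\<close>. The index starts at \<open>K = 1\<close> since the formula refers to \<open>\<iota> K\<close>.
\<close>

lemma iterated_character_formula:
  assumes "0 < K" "i < n"
  shows "\<chi> i (\<Lambda>\<Lambda> (Suc (Suc K))) = 1 / of_nat (d i) *
    (\<Sum>\<iota>\<in>{1..K} \<rightarrow>\<^sub>E {..<n}.
       1 / (\<Prod>k=1..K. of_nat (d (\<iota> k)) ^ 2) *
       (\<Prod>k=2..K. adj (\<iota> k) (e (\<iota> (k - 1)))) * adj i (e (\<iota> K)))"
  using assms
proof (induction K arbitrary: i rule: nat_induct_non_zero)
  case 1
  have "\<chi> i (\<Lambda>\<Lambda> (Suc (Suc 1))) = 1 / of_nat (d i) * (\<Sum>j<n. adj i (e j) / of_nat (d j) * \<chi> j (\<Lambda>\<Lambda> 2))"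
  proof -
    have 2: "Suc 1 = 2" by simp
    show ?thesis using iterated_character[OF 1, of 1] adj_expansion[OF 1, of "\<Lambda>\<Lambda> 2"] unfolding 2 by (simp only:)
  qed
  also have "(\<Sum>j<n. adj i (e j) / of_nat (d j) * \<chi> j (\<Lambda>\<Lambda> 2)) =
      (\<Sum>j<n. 1 / of_nat (d j) ^ 2 * adj i (e j))"
    by (intro sum.cong) (auto simp: second_character power2_eq_square)
  finally have "\<chi> i (\<Lambda>\<Lambda> (Suc (Suc 1))) = 1 / of_nat (d i) *
      (\<Sum>j<n. 1 / of_nat (d j) ^ 2 * adj i (e j))" .
  moreover have "(\<Sum>\<iota>\<in>{1..1} \<rightarrow>\<^sub>E {..<n}. g \<iota>) = (\<Sum>j<n. g (\<lambda>a. if a = Suc 0 then j else undefined))"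
    for g :: "(nat \<Rightarrow> nat) \<Rightarrow> 'k"
    using sum_PiE_atLeastAtMost_Suc[of g 0 "{..<n}"] by (simp add: PiE_empty_domain fun_upd_def)
  ultimately show ?case by simp
next
  case (Suc K)
  let ?p = "\<lambda>\<iota>. (\<Prod>k=1..K. of_nat (d (\<iota> k)) ^ 2) :: 'k"
  let ?q = "\<lambda>\<iota>. \<Prod>k=2..K. adj (\<iota> k) (e (\<iota> (k - 1)))"
  let ?G = "\<lambda>\<iota>. 1 / (\<Prod>k=1..Suc K. of_nat (d (\<iota> k)) ^ 2) *
       (\<Prod>k=2..Suc K. adj (\<iota> k) (e (\<iota> (k - 1)))) * adj i (e (\<iota> (Suc K)))"
  have "\<chi> i (\<Lambda>\<Lambda> (Suc (Suc (Suc K)))) =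
      1 / of_nat (d i) * (\<Sum>j<n. adj i (e j) / of_nat (d j) * \<chi> j (\<Lambda>\<Lambda> (Suc (Suc K))))"
    unfolding iterated_character[OF Suc.prems] adj_expansion[OF Suc.prems, symmetric] ..
  also have "(\<Sum>j<n. adj i (e j) / of_nat (d j) * \<chi> j (\<Lambda>\<Lambda> (Suc (Suc K)))) =
      (\<Sum>j<n. \<Sum>\<iota>\<in>{1..K} \<rightarrow>\<^sub>E {..<n}. ?G (\<iota>(Suc K := j)))"
  proof (rule sum.cong[OF refl])
    fix j assume "j \<in> {..<n}"
    then have j: "j < n" by simp
    have "adj i (e j) / of_nat (d j) * \<chi> j (\<Lambda>\<Lambda> (Suc (Suc K))) =
        (\<Sum>\<iota>\<in>{1..K} \<rightarrow>\<^sub>E {..<n}. adj i (e j) / of_nat (d j) * (1 / of_nat (d j)) *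
          (1 / ?p \<iota> * ?q \<iota> * adj j (e (\<iota> K))))"
      unfolding Suc.IH[OF j] by (simp add: sum_distrib_left mult.assoc)
    also have "\<dots> = (\<Sum>\<iota>\<in>{1..K} \<rightarrow>\<^sub>E {..<n}. ?G (\<iota>(Suc K := j)))"
    proof (rule sum.cong[OF refl])
      fix \<iota>
      let ?j = "\<iota>(Suc K := j)"
      have p: "(\<Prod>k=1..Suc K. of_nat (d (?j k)) ^ 2) = ?p \<iota> * of_nat (d j) ^ 2"
      proof -
        have "(\<Prod>k=1..K. of_nat (d (?j k)) ^ 2) = ?p \<iota>" by (rule prod.cong) auto
        then show ?thesis by (simp add: prod.nat_ivl_Suc')
      qed
      have q: "(\<Prod>k=2..Suc K. adj (?j k) (e (?j (k - 1)))) = ?q \<iota> * adj j (e (\<iota> K))"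
      proof -
        have "(\<Prod>k=2..K. adj (?j k) (e (?j (k - 1)))) = ?q \<iota>" by (rule prod.cong) auto
        then show ?thesis using Suc.hyps by (simp add: prod.nat_ivl_Suc')
      qed
      show "adj i (e j) / of_nat (d j) * (1 / of_nat (d j)) *
          (1 / ?p \<iota> * ?q \<iota> * adj j (e (\<iota> K))) = ?G ?j"
        unfolding p q by (simp add: power2_eq_square mult_ac)
    qed
    finally show "adj i (e j) / of_nat (d j) * \<chi> j (\<Lambda>\<Lambda> (Suc (Suc K))) = \<dots>" .
  qed
  finally show ?case unfolding sum_PiE_atLeastAtMost_Suc .
qed

end

theorem corollary5p2:
  fixes scale :: "'k::{alg_closed_field, field_char_0} \<Rightarrow> 'h::ring_1 \<Rightarrow> 'h"
    and \<Delta> :: "'h \<Rightarrow> ('h \<times> 'h \<Rightarrow>\<^sub>0 'k)"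
    and \<epsilon> :: "'h \<Rightarrow> 'k"
    and S :: "'h \<Rightarrow> 'h"
    and \<Lambda> :: 'h
    and scaleV :: "'k \<Rightarrow> 'v::ab_group_add \<Rightarrow> 'v"
    and n :: nat
    and V :: "nat \<Rightarrow> 'v set"
    and \<rho> :: "nat \<Rightarrow> 'h \<Rightarrow> 'v \<Rightarrow> 'v"
    and e :: "nat \<Rightarrow> 'h"
    and \<chi> :: "nat \<Rightarrow> 'h \<Rightarrow> 'k"
    and d :: "nat \<Rightarrow> nat"
  assumes hopf: "hopf_algebra scale \<Delta> \<epsilon> S"
    and finite_dimensional: "\<exists>B. finite_dimensional_vector_space scale B"
    and semisimple: "semisimple_algebra scale"
    and integral: "idempotent_integral scale \<epsilon> \<Lambda>"
    and simples: "complete_simple_modules scale scaleV n V \<rho>"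
    and trivial: "0 < n" "trivial_module \<epsilon> scaleV (V 0) (\<rho> 0)"
    and idempotents: "\<forall>i<n. central_primitive_idempotent (e i) \<and> (\<forall>v\<in>V i. \<rho> i (e i) v = v)"
    and characters: "\<forall>i<n. \<chi> i = module_character scaleV (V i) (\<rho> i)"
    and dimensions: "\<forall>i<n. d i = vector_space.dim scaleV (V i)"
  shows
    "(\<forall>m>1. \<forall>i<n.
        \<chi> i (iterated_commutator scale \<Delta> S \<Lambda> m) =
          1 / of_nat (d i) *
          convolution \<Delta> (\<chi> i) (dual_antipode S (\<chi> i)) (iterated_commutator scale \<Delta> S \<Lambda> (m - 1))) \<and>
     (\<forall>m>1.
        module_character scale UNIV (*) (iterated_commutator scale \<Delta> S \<Lambda> m) =
          module_character scale UNIV (adjoint_action scale \<Delta> S)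
            (iterated_commutator scale \<Delta> S \<Lambda> (m - 1))) \<and>
     (\<forall>i<n. \<chi> i (iterated_commutator scale \<Delta> S \<Lambda> 1) = (if i = 0 then 1 else 0)) \<and>
     (\<forall>i<n. \<chi> i (iterated_commutator scale \<Delta> S \<Lambda> 2) = 1 / of_nat (d i)) \<and>
     (\<forall>m>2. \<forall>i<n.
        \<chi> i (iterated_commutator scale \<Delta> S \<Lambda> m) =
          1 / of_nat (d i) *
          (\<Sum>\<iota>\<in>{1..m - 2} \<rightarrow>\<^sub>E {..<n}.
             1 / (\<Prod>k=1..m - 2. of_nat (d (\<iota> k)) ^ 2) *
             (\<Prod>k=2..m - 2.
                convolution \<Delta> (\<chi> (\<iota> k)) (dual_antipode S (\<chi> (\<iota> k))) (e (\<iota> (k - 1)))) *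
             convolution \<Delta> (\<chi> i) (dual_antipode S (\<chi> i)) (e (\<iota> (m - 2)))))"
proof -
  interpret hopf scale \<Delta> \<epsilon> S using hopf by (rule hopf.intro)
  have fin: "fin_dim UNIV"
  proof -
    obtain B where "finite_dimensional_vector_space scale B" using finite_dimensional by blast
    then interpret F: finite_dimensional_vector_space scale B .
    show ?thesis using F.finite_Basis F.span_Basis by (auto simp: fin_dim_def)
  qed
  interpret hopf_family scale \<Delta> \<epsilon> S \<Lambda> scaleV n V \<rho> e \<chi> d
    by unfold_locales
      (rule fin semisimple integral simples trivial(1) idempotents characters dimensions)+
  have step: "m = Suc (Suc (m - 2))" "m - 1 = Suc (m - 2)" if "m > 1" for m :: nat
    using that by simp_all
  show ?thesis
    unfolding adj_def[symmetric]
  proof (intro conjI allI impI)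
    fix m :: nat and i assume "m > 1" "i < n"
    then show "\<chi> i (\<Lambda>\<Lambda> m) = 1 / of_nat (d i) * adj i (\<Lambda>\<Lambda> (m - 1))"
      using iterated_character[of i "m - 2"] step[of m] by metis
  next
    fix m :: nat assume "m > 1"
    then have "\<Lambda>\<Lambda> m = hopf_commutator scale \<Delta> S (\<Lambda>\<Lambda> (m - 1)) \<Lambda>"
      using step[of m] by (metis iterated_commutator.simps(3))
    then show "module_character scale UNIV (*) (\<Lambda>\<Lambda> m) =
        module_character scale UNIV (adjoint_action scale \<Delta> S) (\<Lambda>\<Lambda> (m - 1))"
      using regular_character_commutator by (simp add: module_character_def)
  next
    fix i assume i: "i < n"
    have "d 0 = 1" using trivial dimensions by (simp add: trivial_module_def)
    then show "\<chi> i (\<Lambda>\<Lambda> 1) = (if i = 0 then 1 else 0)"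
      using \<chi>_e[OF i trivial(1)] e_zero[OF trivial(2)] by auto
  next
    fix i assume "i < n"
    then show "\<chi> i (\<Lambda>\<Lambda> 2) = 1 / of_nat (d i)" by (rule second_character)
  next
    fix m :: nat and i assume m: "m > 2" and i: "i < n"
    show "\<chi> i (\<Lambda>\<Lambda> m) = 1 / of_nat (d i) *
        (\<Sum>\<iota>\<in>{1..m - 2} \<rightarrow>\<^sub>E {..<n}.
           1 / (\<Prod>k=1..m - 2. of_nat (d (\<iota> k)) ^ 2) *
           (\<Prod>k=2..m - 2. adj (\<iota> k) (e (\<iota> (k - 1)))) * adj i (e (\<iota> (m - 2))))"
      using iterated_character_formula[of "m - 2" i] m i step(1)[of m] by simp
  qed
qed

end
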